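(* The semigroup $\{e^{-(\mathcal A+B)t}\}_{t\ge0}$ is exponentially stable in $\mathcal H$, i.e. there exist constants $C,\omega>0$ such that $\|e^{-(\mathcal A+B)t}\|_{\mathcal L(\mathcal H)}\le Ce^{-\omega t}$ for all $t\ge0$.
   Context: Constants: $L,h_1,h_2,h_3,G_2>0$; $\rho_1,\rho_3>0$, $\rho_2\ge0$; $\alpha_1^1,\alpha_1^3>0$, $\beta^i>0$, $\gamma^i\in\mathbb R$, $\alpha^i=\alpha_1^i+(\gamma^i)^2\beta^i$ for $i=1,3$ (superscript $i$ is a layer index); $H=\frac{h_1+2h_2+h_3}{2}$, $m=\sum_{i=1}^3\rho_ih_i$, $K_1=\frac{\rho_1h_1^3+\rho_3h_3^3}{12}$, $K_2=\frac{\alpha^1h_1^3+\alpha^3h_3^3}{12}$; feedback gains $s_1,s_3,k_1,k_2>0$. Complex function spaces: $H^1_L(0,L)=\{\psi\in H^1(0,L):\psi(0)=0\}$, $H^2_L(0,L)=\{\psi\in H^2(0,L):\psi(0)=\psi_x(0)=0\}$, $\mathrm V=(H^1_L(0,L))^2\times H^2_L(0,L)$, $\mathrm H=(L^2(0,L))^2\times H^1_L(0,L)$ (the roman $\mathrm H$ is a space, the italic $H$ a number), $\mathcal H=\mathrm V\times\mathrm H$, with inner products $$\langle y,\psi\rangle_{\mathrm V}=\int_0^L\Big\{\alpha_1^1h_1(y_1)_x(\bar\psi_1)_x+\alpha_1^3h_3(y_2)_x(\bar\psi_2)_x+K_2(y_3)_{xx}(\bar\psi_3)_{xx}+\tfrac{G_2}{h_2}(-y_1+y_2+H(y_3)_x)(-\bar\psi_1+\bar\psi_2+H(\bar\psi_3)_x)\Big\}dx,$$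 $$\langle z,\psi\rangle_{\mathrm H}=\int_0^L\Big\{\rho_1h_1z_1\bar\psi_1+\rho_3h_3z_2\bar\psi_2+mz_3\bar\psi_3+K_1(z_3)_x(\bar\psi_3)_x\Big\}dx,$$ and the sum inner product on $\mathcal H$. Duals $\mathrm V',\mathrm H'$ are taken with pivot space $(L^2(0,L))^3$, so $\mathrm V\subset\mathrm H\subset(L^2(0,L))^3\subset\mathrm H'\subset\mathrm V'$. Operators: $A:\mathrm V\to\mathrm V'$, $\langle Ay,\psi\rangle=\langle y,\psi\rangle_{\mathrm V}$; $M:\mathrm H\to\mathrm H'$, $\langle Mz,\psi\rangle=\langle z,\psi\rangle_{\mathrm H}$ (an isomorphism); $D_0:\mathrm V\to\mathrm V'$, $\langle D_0y,\psi\rangle=s_1y_1(L)\bar\psi_1(L)+s_3y_2(L)\bar\psi_2(L)+k_1(y_3)_x(L)(\bar\psi_3)_x(L)$; $B_0:\mathrm H\to\mathrm H'$, $\langle B_0y,\psi\rangle=k_2y_3(L)\bar\psi_3(L)$. Then $$\mathcal A(y,z)=\big(-z,\ M^{-1}(Ay+D_0z)\big),\qquad \mathrm{Dom}(\mathcal A)=\{(y,z)\in\mathrm V\times\mathrm V:\ Ay+D_0z\in\mathrm H'\},$$ $$B(y,z)=\big(0,\ M^{-1}B_0z\big),\qquad (y,z)\in\mathcal H.$$ The equation $\dot\varphi+\mathcal A\varphi+B\varphi=0$ with $\varphi=(v^1,v^3,w,\dot v^1,\dot v^3,\dot w)$ is the abstract form of the electrostatic Rao-Nakra beam $\rho_ih_i\ddot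 v^i-\alpha_1^ih_iv^i_{xx}+\kappa(i)G_2\phi^2=0$ ($i=1,3$, $\kappa(1)=-1$, $\kappa(3)=1$), $m\ddot w-K_1\ddot w_{xx}+K_2w_{xxxx}-G_2H\phi^2_x=0$, $\phi^2=\frac1{h_2}(-v^1+v^3+Hw_x)$, with $v^i(0)=w(0)=w_x(0)=0$, $\alpha_1^ih_iv^i_x(L)=-s_i\dot v^i(L)$, $K_2w_{xx}(L)=-k_1\dot w_x(L)$, $K_1\ddot w_x(L)-K_2w_{xxx}(L)+G_2H\phi^2(L)=-k_2\dot w(L)$. $e^{-(\mathcal A+B)t}$ denotes the $C_0$-semigroup on $\mathcal H$ generated by $-(\mathcal A+B)$. *)

theory Defs
  imports "HOL-Analysis.Analysis"
begin

section \<open>Complex vector spaces\<close>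

class scaleC =
  fixes scaleC :: "complex \<Rightarrow> 'a \<Rightarrow> 'a" (infixr \<open>*\<^sub>C\<close> 75)

class complex_vector = ab_group_add + scaleC +
  assumes scaleC_add_right: "a *\<^sub>C (x + y) = a *\<^sub>C x + a *\<^sub>C y"
    and scaleC_add_left: "(a + b) *\<^sub>C x = a *\<^sub>C x + b *\<^sub>C x"
    and scaleC_scaleC: "a *\<^sub>C b *\<^sub>C x = (a * b) *\<^sub>C x"
    and scaleC_one: "1 *\<^sub>C x = x"

instantiation prod :: (complex_vector, complex_vector) complex_vector
begin

definition scaleC_prod_def: "a *\<^sub>C p = (a *\<^sub>C fst p, a *\<^sub>C snd p)"

instance
  by standard (auto simp: scaleC_prod_def scaleC_add_right scaleC_add_left scaleC_scaleC scaleC_one)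

end

section \<open>Measurable functions modulo equality almost everywhere\<close>

quotient_type lfun = "real \<Rightarrow> complex" / partial:
  "\<lambda>f g. f \<in> borel_measurable lborel \<and> g \<in> borel_measurable lborel \<and> (AE x in lborel. f x = g x)"
  by (intro part_equivpI sympI transpI exI[of _ "\<lambda>x. 0"]) (auto simp: eq_commute elim: eventually_elim2)

instantiation lfun :: complex_vector
begin

lift_definition zero_lfun :: lfun is "\<lambda>_. 0" by simp

lift_definition plus_lfun :: "lfun \<Rightarrow> lfun \<Rightarrow> lfun" is "\<lambda>f g x. f x + g x"
  by (auto elim: eventually_elim2)

lift_definition minus_lfun :: "lfun \<Rightarrow> lfun \<Rightarrow> lfun" is "\<lambda>f g x. f x - g x"
  by (auto elim: eventually_elim2)

lift_definition uminus_lfun :: "lfun \<Rightarrow> lfun" is "\<lambda>f x. - f x"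
  by auto

lift_definition scaleC_lfun :: "complex \<Rightarrow> lfun \<Rightarrow> lfun" is "\<lambda>a f x. a * f x"
  by (auto elim: eventually_mono)

instance
  by standard (transfer; auto simp: algebra_simps)+

end

section \<open>Sobolev spaces on the interval \<open>(0, L)\<close>\<close>

text \<open>An element of \<open>L\<^sup>2(0,L)\<close> is represented by its extension by zero to the real line.\<close>

definition L2 :: "real \<Rightarrow> lfun set" where
  "L2 L = {u. (AE x in lborel. x \<notin> {0<..<L} \<longrightarrow> rep_lfun u x = 0) \<and>
              set_integrable lborel {0<..<L} (\<lambda>x. (cmod (rep_lfun u x))\<^sup>2)}"

definition inner_L2 :: "real \<Rightarrow> lfun \<Rightarrow> lfun \<Rightarrow> complex" where
  "inner_L2 L u v = (LINT x:{0<..<L}|lborel. rep_lfun u x * cnj (rep_lfun v x))"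

definition test_function :: "real \<Rightarrow> (real \<Rightarrow> real) \<Rightarrow> bool" where
  "test_function L \<phi> \<longleftrightarrow>
     (\<forall>n x. (deriv ^^ n) \<phi> field_differentiable at x) \<and>
     (\<exists>a b. 0 < a \<and> b < L \<and> (\<forall>x. x \<notin> {a..b} \<longrightarrow> \<phi> x = 0))"

definition has_weak_deriv :: "real \<Rightarrow> lfun \<Rightarrow> lfun \<Rightarrow> bool" where
  "has_weak_deriv L u v \<longleftrightarrow>
     (\<forall>\<phi>. test_function L \<phi> \<longrightarrow>
        (LINT x:{0<..<L}|lborel. rep_lfun u x * complex_of_real (deriv \<phi> x)) =
        - (LINT x:{0<..<L}|lborel. rep_lfun v x * complex_of_real (\<phi> x)))"

definition wderiv :: "real \<Rightarrow> lfun \<Rightarrow> lfun" where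
  "wderiv L u = (THE v. v \<in> L2 L \<and> has_weak_deriv L u v)"

definition H1 :: "real \<Rightarrow> lfun set" where
  "H1 L = {u \<in> L2 L. \<exists>v \<in> L2 L. has_weak_deriv L u v}"

definition H2 :: "real \<Rightarrow> lfun set" where
  "H2 L = {u \<in> H1 L. wderiv L u \<in> H1 L}"

text \<open>The value at a point of \<open>[0,L]\<close> of an element of \<open>H\<^sup>1(0,L)\<close> is that of its unique
  representative that is continuous on the closed interval.\<close>

definition value_at :: "real \<Rightarrow> lfun \<Rightarrow> real \<Rightarrow> complex" where
  "value_at L u x\<^sub>0 =
     (THE c. \<exists>f. continuous_on {0..L} f \<and>
                 (AE x in lborel. x \<in> {0<..<L} \<longrightarrow> rep_lfun u x = f x) \<and> f x\<^sub>0 = c)"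

definition H1L :: "real \<Rightarrow> lfun set" where
  "H1L L = {u \<in> H1 L. value_at L u 0 = 0}"

definition H2L :: "real \<Rightarrow> lfun set" where
  "H2L L = {u \<in> H2 L. value_at L u 0 = 0 \<and> value_at L (wderiv L u) 0 = 0}"

section \<open>Antiduals and semigroups on a subspace \<open>X\<close> with norm \<open>N\<close>\<close>

text \<open>The pairings are linear in the first and conjugate-linear in the second argument, so
  dual spaces consist of bounded conjugate-linear functionals.\<close>

definition antidual :: "'a::complex_vector set \<Rightarrow> ('a \<Rightarrow> real) \<Rightarrow> ('a \<Rightarrow> complex) set" where
  "antidual X N = {\<Lambda>. \<Lambda> \<in> extensional X \<and>
     (\<forall>x\<in>X. \<forall>y\<in>X. \<Lambda> (x + y) = \<Lambda> x + \<Lambda> y) \<and>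
     (\<forall>c. \<forall>x\<in>X. \<Lambda> (c *\<^sub>C x) = cnj c * \<Lambda> x) \<and>
     (\<exists>K. \<forall>x\<in>X. cmod (\<Lambda> x) \<le> K * N x)}"

definition bounded_clinear_on :: "'a::complex_vector set \<Rightarrow> ('a \<Rightarrow> real) \<Rightarrow> ('a \<Rightarrow> 'a) \<Rightarrow> bool" where
  "bounded_clinear_on X N S \<longleftrightarrow>
     (\<forall>x\<in>X. S x \<in> X) \<and>
     (\<forall>x\<in>X. \<forall>y\<in>X. S (x + y) = S x + S y) \<and>
     (\<forall>c. \<forall>x\<in>X. S (c *\<^sub>C x) = c *\<^sub>C S x) \<and>
     (\<exists>K. \<forall>x\<in>X. N (S x) \<le> K * N x)"

definition opnorm_on :: "'a::complex_vector set \<Rightarrow> ('a \<Rightarrow> real) \<Rightarrow> ('a \<Rightarrow> 'a) \<Rightarrow> real" where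
  "opnorm_on X N S = (SUP x\<in>{x\<in>X. N x \<le> 1}. N (S x))"

definition C0_semigroup_on ::
    "'a::complex_vector set \<Rightarrow> ('a \<Rightarrow> real) \<Rightarrow> (real \<Rightarrow> 'a \<Rightarrow> 'a) \<Rightarrow> bool" where
  "C0_semigroup_on X N T \<longleftrightarrow>
     (\<forall>t\<ge>0. bounded_clinear_on X N (T t)) \<and>
     (\<forall>x\<in>X. T 0 x = x) \<and>
     (\<forall>s\<ge>0. \<forall>t\<ge>0. \<forall>x\<in>X. T (s + t) x = T s (T t x)) \<and>
     (\<forall>x\<in>X. ((\<lambda>t. N (T t x - x)) \<longlongrightarrow> 0) (at_right 0))"

text \<open>\<open>G\<close> with domain \<open>D\<close> is the infinitesimal generator of \<open>T\<close>: \<open>D\<close> is the set of all \<open>x\<close> for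
  which the difference quotient \<open>(T t x - x) / t\<close> converges in \<open>X\<close>, and \<open>G x\<close> is the limit.\<close>

definition generator_on :: "'a::complex_vector set \<Rightarrow> ('a \<Rightarrow> real) \<Rightarrow> (real \<Rightarrow> 'a \<Rightarrow> 'a) \<Rightarrow>
    'a set \<Rightarrow> ('a \<Rightarrow> 'a) \<Rightarrow> bool" where
  "generator_on X N T D G \<longleftrightarrow>
     (let lim = (\<lambda>x y. ((\<lambda>t. N (complex_of_real (1 / t) *\<^sub>C (T t x - x) - y)) \<longlongrightarrow> 0) (at_right 0))
      in D = {x\<in>X. \<exists>y\<in>X. lim x y} \<and> (\<forall>x\<in>D. G x \<in> X \<and> lim x (G x)))"

section \<open>The electrostatic Rao-Nakra beam\<close>

text \<open>\<open>alpha1_i\<close> is the coefficient \<open>\<alpha>\<^sub>1\<^sup>i\<close> of layer \<open>i\<close>, whereas \<open>alpha_i\<close> below is the derived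
  constant \<open>\<alpha>\<^sup>i\<close>.\<close>

record beam =
  len :: real
  h1 :: real
  h2 :: real
  h3 :: real
  G2 :: real
  rho1 :: real
  rho2 :: real
  rho3 :: real
  alpha1_1 :: real
  alpha1_3 :: real
  beta1 :: real
  beta3 :: real
  gamma1 :: real
  gamma3 :: real
  s1 :: real
  s3 :: real
  k1 :: real
  k2 :: real

definition alpha_1 :: "beam \<Rightarrow> real" where
  "alpha_1 p = alpha1_1 p + (gamma1 p)\<^sup>2 * beta1 p"

definition alpha_3 :: "beam \<Rightarrow> real" where
  "alpha_3 p = alpha1_3 p + (gamma3 p)\<^sup>2 * beta3 p"

definition beam_H :: "beam \<Rightarrow> real" where
  "beam_H p = (h1 p + 2 * h2 p + h3 p) / 2"

definition beam_m :: "beam \<Rightarrow> real" where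
  "beam_m p = rho1 p * h1 p + rho2 p * h2 p + rho3 p * h3 p"

definition beam_K1 :: "beam \<Rightarrow> real" where
  "beam_K1 p = (rho1 p * h1 p ^ 3 + rho3 p * h3 p ^ 3) / 12"

definition beam_K2 :: "beam \<Rightarrow> real" where
  "beam_K2 p = (alpha_1 p * h1 p ^ 3 + alpha_3 p * h3 p ^ 3) / 12"

type_synonym triple = "lfun \<times> lfun \<times> lfun"
type_synonym state = "triple \<times> triple"

definition V_space :: "beam \<Rightarrow> triple set" where
  "V_space p = H1L (len p) \<times> H1L (len p) \<times> H2L (len p)"

definition H_space :: "beam \<Rightarrow> triple set" where
  "H_space p = L2 (len p) \<times> L2 (len p) \<times> H1L (len p)"

definition inner_V :: "beam \<Rightarrow> triple \<Rightarrow> triple \<Rightarrow> complex" where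
  "inner_V p = (\<lambda>(y1, y2, y3) (\<psi>1, \<psi>2, \<psi>3).
     let d = wderiv (len p); ip = inner_L2 (len p) in
       complex_of_real (alpha1_1 p * h1 p) * ip (d y1) (d \<psi>1) +
       complex_of_real (alpha1_3 p * h3 p) * ip (d y2) (d \<psi>2) +
       complex_of_real (beam_K2 p) * ip (d (d y3)) (d (d \<psi>3)) +
       complex_of_real (G2 p / h2 p) *
         ip (- y1 + y2 + complex_of_real (beam_H p) *\<^sub>C d y3)
            (- \<psi>1 + \<psi>2 + complex_of_real (beam_H p) *\<^sub>C d \<psi>3))"

definition inner_H :: "beam \<Rightarrow> triple \<Rightarrow> triple \<Rightarrow> complex" where
  "inner_H p = (\<lambda>(z1, z2, z3) (\<psi>1, \<psi>2, \<psi>3).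
     let d = wderiv (len p); ip = inner_L2 (len p) in
       complex_of_real (rho1 p * h1 p) * ip z1 \<psi>1 +
       complex_of_real (rho3 p * h3 p) * ip z2 \<psi>2 +
       complex_of_real (beam_m p) * ip z3 \<psi>3 +
       complex_of_real (beam_K1 p) * ip (d z3) (d \<psi>3))"

definition norm_V :: "beam \<Rightarrow> triple \<Rightarrow> real" where
  "norm_V p y = sqrt (Re (inner_V p y y))"

definition norm_H :: "beam \<Rightarrow> triple \<Rightarrow> real" where
  "norm_H p z = sqrt (Re (inner_H p z z))"

definition state_space :: "beam \<Rightarrow> state set" where
  "state_space p = V_space p \<times> H_space p"

definition inner_state :: "beam \<Rightarrow> state \<Rightarrow> state \<Rightarrow> complex" where
  "inner_state p = (\<lambda>(y, z) (y', z'). inner_V p y y' + inner_H p z z')"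

definition norm_state :: "beam \<Rightarrow> state \<Rightarrow> real" where
  "norm_state p \<phi> = sqrt (Re (inner_state p \<phi> \<phi>))"

definition V_dual :: "beam \<Rightarrow> (triple \<Rightarrow> complex) set" where
  "V_dual p = antidual (V_space p) (norm_V p)"

definition H_dual :: "beam \<Rightarrow> (triple \<Rightarrow> complex) set" where
  "H_dual p = antidual (H_space p) (norm_H p)"

text \<open>With pivot space \<open>L\<^sup>2(0,L)\<^sup>3\<close>, the inclusion of the dual of \<open>H_space\<close> in the dual of
  \<open>V_space\<close> is restriction of functionals; it is injective since \<open>V_space\<close> is dense in \<open>H_space\<close>.\<close>

definition embed_dual :: "beam \<Rightarrow> (triple \<Rightarrow> complex) \<Rightarrow> (triple \<Rightarrow> complex)" where
  "embed_dual p \<Lambda> = restrict \<Lambda> (V_space p)"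

definition op_A :: "beam \<Rightarrow> triple \<Rightarrow> (triple \<Rightarrow> complex)" where
  "op_A p y = restrict (inner_V p y) (V_space p)"

definition op_M :: "beam \<Rightarrow> triple \<Rightarrow> (triple \<Rightarrow> complex)" where
  "op_M p z = restrict (inner_H p z) (H_space p)"

definition op_M_inv :: "beam \<Rightarrow> (triple \<Rightarrow> complex) \<Rightarrow> triple" where
  "op_M_inv p = inv_into (H_space p) (op_M p)"

definition op_D0 :: "beam \<Rightarrow> triple \<Rightarrow> (triple \<Rightarrow> complex)" where
  "op_D0 p = (\<lambda>(y1, y2, y3). restrict (\<lambda>(\<psi>1, \<psi>2, \<psi>3).
     let d = wderiv (len p); at_L = (\<lambda>u. value_at (len p) u (len p)) in
       complex_of_real (s1 p) * at_L y1 * cnj (at_L \<psi>1) +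
       complex_of_real (s3 p) * at_L y2 * cnj (at_L \<psi>2) +
       complex_of_real (k1 p) * at_L (d y3) * cnj (at_L (d \<psi>3))) (V_space p))"

definition op_B0 :: "beam \<Rightarrow> triple \<Rightarrow> (triple \<Rightarrow> complex)" where
  "op_B0 p = (\<lambda>(y1, y2, y3). restrict (\<lambda>(\<psi>1, \<psi>2, \<psi>3).
     complex_of_real (k2 p) * value_at (len p) y3 (len p) * cnj (value_at (len p) \<psi>3 (len p)))
     (H_space p))"

definition op_A_D0 :: "beam \<Rightarrow> state \<Rightarrow> (triple \<Rightarrow> complex)" where
  "op_A_D0 p = (\<lambda>(y, z). restrict (\<lambda>\<psi>. op_A p y \<psi> + op_D0 p z \<psi>) (V_space p))"

definition dom_calA :: "beam \<Rightarrow> state set" where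
  "dom_calA p = {(y, z) \<in> V_space p \<times> V_space p. op_A_D0 p (y, z) \<in> embed_dual p ` H_dual p}"

definition calA :: "beam \<Rightarrow> state \<Rightarrow> state" where
  "calA p = (\<lambda>(y, z). (- z, op_M_inv p (inv_into (H_dual p) (embed_dual p) (op_A_D0 p (y, z)))))"

definition op_B :: "beam \<Rightarrow> state \<Rightarrow> state" where
  "op_B p = (\<lambda>(y, z). (0, op_M_inv p (op_B0 p z)))"

end

theory Submission
  imports Defs
begin

text \<open>Along a strong solution \<open>(y, z)\<close> the energy \<open>\<langle>(y, z), (y, z)\<rangle> / 2\<close> is dissipated only at the
  end \<open>x = L\<close>, at the rate
  \<open>d = s\<^sub>1 |z\<^sub>1(L)|\<^sup>2 + s\<^sub>3 |z\<^sub>2(L)|\<^sup>2 + k\<^sub>1 |z\<^sub>3'(L)|\<^sup>2 + k\<^sub>2 |z\<^sub>3(L)|\<^sup>2\<close>. The proof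
  perturbs the energy to a Lyapunov functional that decays at a rate proportional to itself.

  A first multiplier, with strains proportional to \<open>q(x) = exp (K x) - 1\<close>, produces the negative of
  the energy with weight \<open>q'\<close> (\<open>multiplier_estimate\<close>). The coupling through the shear
  \<open>F = - y\<^sub>1 + y\<^sub>2 + H y\<^sub>3'\<close> and the rotary inertia leave terms of lower order. The exponential
  weight makes these small: a Hardy inequality integrated from the end \<open>L\<close>, where the weight is
  largest, bounds a weighted norm by \<open>4 / K\<^sup>2\<close> times that of the derivative and a trace at \<open>L\<close>
  (\<open>Hardy\<close>). For large
  \<open>K\<close> everything is controlled by \<open>d\<close> and by \<open>|F(L)|\<^sup>2\<close>. The latter is not dissipated, but
  \<open>y \<mapsto> F(L)\<close> is represented in the elastic inner product by an explicit displacement \<open>\<eta>\<close>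
  (\<open>shear_trace_representation\<close>), and the second multiplier \<open>F(L) \<eta>\<close> yields \<open>- |F(L)|\<^sup>2\<close> up to
  terms controlled by \<open>d\<close> and a small part of the energy (\<open>shear_trace_estimate\<close>). A large multiple of
  the energy plus both multiplier terms is the functional of \<open>exponential_stability\<close>.

  To carry this out rigorously, \<open>L\<^sup>2(0,L)\<close> is shown to be complete, and \<open>H\<^sup>1\<close> functions are identified
  with primitives through the lemma of du Bois-Reymond. With the Volterra operator \<open>J\<close> (integration
  from \<open>0\<close>) the spaces of the beam become three copies of \<open>L\<^sup>2\<close> each, and the calculus reduces to
  \<open>by_parts\<close>, \<open>Mul_aff\<close> and \<open>energy_identity\<close>. The Riesz theorem inverts the mass operator
  and turns the generator into a weak equation (\<open>generator_weak_form\<close>) from which the regularity of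
  the strains is read off (\<open>domain_regularity\<close>).

  On the semigroup side only right derivatives of orbits on the domain are at hand. Baire's theorem
  on the time axis makes the semigroup locally bounded at positive times and hence its orbits continuous
  (\<open>T_locally_bounded\<close>), which suffices to integrate the differential inequality
  (\<open>exponential_decay_of_Lyapunov\<close>); the domain is dense (\<open>domain_dense\<close>).\<close>

section \<open>Semi-inner products on complex subspaces\<close>

lemma scaleC_zero_left [simp]: "(0::complex) *\<^sub>C (x::'a::complex_vector) = 0"
  using scaleC_add_left[of 0 0 x] by simp

lemma scaleC_zero_right [simp]: "c *\<^sub>C (0::'a::complex_vector) = 0"
  using scaleC_add_right[of c 0 "0::'a"] by simp

lemma scaleC_minus_left: "(- c) *\<^sub>C (x::'a::complex_vector) = - (c *\<^sub>C x)"
  using scaleC_add_left[of c "- c" x] by (simp add: add_eq_0_iff)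

lemma scaleC_minus_one [simp]: "(- 1) *\<^sub>C (x::'a::complex_vector) = - x"
  by (simp add: scaleC_minus_left scaleC_one)

text \<open>The function spaces here are carrier sets rather than types, because they depend on the
  length of the interval; so subspaces, semi-inner products and completeness are all relative to a
  carrier.\<close>

locale csubspace_on =
  fixes X :: "'a::complex_vector set"
  assumes zero_mem [simp, intro]: "0 \<in> X"
    and add_mem [simp, intro]: "\<lbrakk>x \<in> X; y \<in> X\<rbrakk> \<Longrightarrow> x + y \<in> X"
    and scale_mem [simp, intro]: "x \<in> X \<Longrightarrow> c *\<^sub>C x \<in> X"
begin

lemma minus_mem [simp, intro]: "x \<in> X \<Longrightarrow> - x \<in> X"
  using scale_mem[of x "- 1"] by simp

lemma diff_mem [simp, intro]: "\<lbrakk>x \<in> X; y \<in> X\<rbrakk> \<Longrightarrow> x - y \<in> X"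
  using add_mem[of x "- y"] by simp

end

locale semi_inner = csubspace_on X for X :: "'a::complex_vector set" +
  fixes ip :: "'a \<Rightarrow> 'a \<Rightarrow> complex"
  assumes ip_add_left: "\<lbrakk>x \<in> X; y \<in> X; z \<in> X\<rbrakk> \<Longrightarrow> ip (x + y) z = ip x z + ip y z"
    and ip_scale_left: "\<lbrakk>x \<in> X; z \<in> X\<rbrakk> \<Longrightarrow> ip (c *\<^sub>C x) z = c * ip x z"
    and ip_commute: "\<lbrakk>x \<in> X; y \<in> X\<rbrakk> \<Longrightarrow> ip y x = cnj (ip x y)"
    and ip_nonneg: "x \<in> X \<Longrightarrow> 0 \<le> Re (ip x x)"
begin

definition nrm :: "'a \<Rightarrow> real" where
  "nrm x = sqrt (Re (ip x x))"

lemma ip_add_right: "\<lbrakk>x \<in> X; y \<in> X; z \<in> X\<rbrakk> \<Longrightarrow> ip z (x + y) = ip z x + ip z y"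
  by (simp add: ip_add_left ip_commute[of _ z])

lemma ip_scale_right: "\<lbrakk>x \<in> X; z \<in> X\<rbrakk> \<Longrightarrow> ip z (c *\<^sub>C x) = cnj c * ip z x"
  by (simp add: ip_scale_left ip_commute[of _ z])

lemma ip_zero_left [simp]: "x \<in> X \<Longrightarrow> ip 0 x = 0"
  using ip_scale_left[of 0 x 0] by simp

lemma ip_zero_right [simp]: "x \<in> X \<Longrightarrow> ip x 0 = 0"
  using ip_scale_right[of 0 x 0] by simp

lemma ip_minus_left: "\<lbrakk>x \<in> X; z \<in> X\<rbrakk> \<Longrightarrow> ip (- x) z = - ip x z"
  using ip_scale_left[of x z "- 1"] by simp

lemma ip_minus_right: "\<lbrakk>x \<in> X; z \<in> X\<rbrakk> \<Longrightarrow> ip z (- x) = - ip z x"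
  using ip_scale_right[of x z "- 1"] by simp

lemma ip_diff_left: "\<lbrakk>x \<in> X; y \<in> X; z \<in> X\<rbrakk> \<Longrightarrow> ip (x - y) z = ip x z - ip y z"
  using ip_add_left[of x "- y" z] by (simp add: ip_minus_left)

lemma ip_diff_right: "\<lbrakk>x \<in> X; y \<in> X; z \<in> X\<rbrakk> \<Longrightarrow> ip z (x - y) = ip z x - ip z y"
  using ip_add_right[of x "- y" z] by (simp add: ip_minus_right)

lemmas ip_simps = ip_add_left ip_add_right ip_scale_left ip_scale_right ip_minus_left
  ip_minus_right ip_diff_left ip_diff_right

lemma ip_self_real: "x \<in> X \<Longrightarrow> ip x x = complex_of_real (Re (ip x x))"
  using arg_cong[OF ip_commute[of x x], of Im] by (simp add: complex_eq_iff)

lemma nrm_nonneg [simp]: "x \<in> X \<Longrightarrow> 0 \<le> nrm x"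
  by (simp add: nrm_def ip_nonneg)

lemma nrm_sq: "x \<in> X \<Longrightarrow> (nrm x)\<^sup>2 = Re (ip x x)"
  by (simp add: nrm_def ip_nonneg)

lemma nrm_zero [simp]: "nrm 0 = 0"
  by (simp add: nrm_def)

lemma nrm_scale: "x \<in> X \<Longrightarrow> nrm (c *\<^sub>C x) = cmod c * nrm x"
proof -
  assume x: "x \<in> X"
  have "ip (c *\<^sub>C x) (c *\<^sub>C x) = (c * cnj c) * ip x x"
    using x by (simp add: ip_simps)
  also have "\<dots> = complex_of_real ((cmod c)\<^sup>2 * Re (ip x x))"
    by (subst ip_self_real[OF x]) (simp add: complex_norm_square[symmetric])
  finally show ?thesis
    by (simp add: nrm_def real_sqrt_mult)
qed

lemma nrm_minus: "x \<in> X \<Longrightarrow> nrm (- x) = nrm x"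
  using nrm_scale[of x "- 1"] by simp

lemma nrm_minus_commute: "\<lbrakk>x \<in> X; y \<in> X\<rbrakk> \<Longrightarrow> nrm (x - y) = nrm (y - x)"
  using nrm_minus[of "x - y"] by simp

lemma Cauchy_Schwarz:
  assumes "x \<in> X" "y \<in> X"
  shows "cmod (ip x y) \<le> nrm x * nrm y"
proof -
  \<comment> \<open>the coefficient \<open>t \<langle>x, y\<rangle>\<close> turns the sesquilinear expansion into a real quadratic in \<open>t\<close>\<close>
  define A B C where "A = (nrm x)\<^sup>2" and "B = (nrm y)\<^sup>2" and "C = (cmod (ip x y))\<^sup>2"
  have pos: "0 \<le> A - 2 * t * C + t\<^sup>2 * C * B" for t :: real
  proof -
    define c where "c = complex_of_real t * ip x y"
    have "0 \<le> Re (ip (x - c *\<^sub>C y) (x - c *\<^sub>C y))"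
      using assms by (simp add: ip_nonneg)
    also have "ip (x - c *\<^sub>C y) (x - c *\<^sub>C y) =
        ip x x - cnj c * ip x y - c * cnj (ip x y) + (c * cnj c) * ip y y"
      using assms ip_commute[OF assms] by (simp add: ip_simps algebra_simps)
    also have "\<dots> = complex_of_real (A - 2 * t * C + t\<^sup>2 * C * B)"
    proof -
      have C': "complex_of_real C = ip x y * cnj (ip x y)"
        unfolding C_def by (rule complex_norm_square)
      have "cnj c * ip x y = complex_of_real (t * C)"
        "c * cnj (ip x y) = complex_of_real (t * C)"
        "c * cnj c = complex_of_real (t\<^sup>2 * C)"
        by (simp_all add: c_def C' power2_eq_square)
      moreover have "ip x x = complex_of_real A" "ip y y = complex_of_real B"
        using assms ip_self_real by (simp_all add: A_def B_def nrm_sq)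
      ultimately show ?thesis by simp
    qed
    finally show ?thesis by simp
  qed
  have nn: "0 \<le> A" "0 \<le> B" "0 \<le> C" by (auto simp: A_def B_def C_def)
  have "C \<le> A * B"
  proof (cases "B = 0")
    case True
    have "C = 0"
    proof (rule ccontr)
      assume "C \<noteq> 0"
      with pos[of "(A + 1) / C"] True nn show False by simp
    qed
    with nn show ?thesis by simp
  next
    case False
    with pos[of "1 / B"] nn show ?thesis by (simp add: field_simps power2_eq_square)
  qed
  then have "(cmod (ip x y))\<^sup>2 \<le> (nrm x * nrm y)\<^sup>2"
    by (simp add: A_def B_def C_def power_mult_distrib)
  then show ?thesis
    using assms by (meson mult_nonneg_nonneg nrm_nonneg power2_le_imp_le)
qed

lemma Re_ip_le: "\<lbrakk>x \<in> X; y \<in> X\<rbrakk> \<Longrightarrow> \<bar>Re (ip x y)\<bar> \<le> nrm x * nrm y"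
  using Cauchy_Schwarz abs_Re_le_cmod order_trans by blast

lemma nrm_sq_add:
  "\<lbrakk>x \<in> X; y \<in> X\<rbrakk> \<Longrightarrow> (nrm (x + y))\<^sup>2 = (nrm x)\<^sup>2 + 2 * Re (ip x y) + (nrm y)\<^sup>2"
  using ip_commute[of x y] by (simp add: nrm_sq ip_simps)

lemma nrm_triangle: "\<lbrakk>x \<in> X; y \<in> X\<rbrakk> \<Longrightarrow> nrm (x + y) \<le> nrm x + nrm y"
proof (rule power2_le_imp_le)
  assume xy: "x \<in> X" "y \<in> X"
  then show "(nrm (x + y))\<^sup>2 \<le> (nrm x + nrm y)\<^sup>2"
    using Re_ip_le[OF xy] by (simp add: nrm_sq_add power2_sum)
qed auto

lemma nrm_triangle3: "\<lbrakk>x \<in> X; y \<in> X; z \<in> X\<rbrakk> \<Longrightarrow> nrm (x - z) \<le> nrm (x - y) + nrm (y - z)"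
  using nrm_triangle[of "x - y" "y - z"] by simp

lemma nrm_triangle2': "\<lbrakk>x \<in> X; y \<in> X\<rbrakk> \<Longrightarrow> \<bar>nrm x - nrm y\<bar> \<le> nrm (x - y)"
  using nrm_triangle[of "x - y" y] nrm_triangle[of "y - x" x] nrm_minus_commute[of x y]
  by simp

lemma parallelogram:
  "\<lbrakk>x \<in> X; y \<in> X\<rbrakk> \<Longrightarrow> (nrm (x + y))\<^sup>2 + (nrm (x - y))\<^sup>2 = 2 * (nrm x)\<^sup>2 + 2 * (nrm y)\<^sup>2"
  using ip_commute[of x y] by (simp add: nrm_sq ip_simps)

definition complete_on :: "'a set \<Rightarrow> bool" where
  "complete_on Y \<longleftrightarrow> (\<forall>s. (\<forall>n. s n \<in> Y) \<longrightarrow>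
     (\<forall>e>0. \<exists>N. \<forall>m\<ge>N. \<forall>n\<ge>N. nrm (s m - s n) < e) \<longrightarrow>
     (\<exists>x\<in>Y. (\<lambda>n. nrm (s n - x)) \<longlonglongrightarrow> 0))"

lemma semi_inner_subset:
  assumes "csubspace_on Y" "Y \<subseteq> X"
  shows "semi_inner Y ip"
proof -
  interpret Y: csubspace_on Y by fact
  show ?thesis
    using assms(2)
    by unfold_locales (simp_all add: ip_add_left ip_scale_left ip_nonneg subset_iff ip_commute[symmetric])
qed

text \<open>A bounded conjugate-linear functional is represented by the minimiser of
  \<open>N(u)\<^sup>2 - 2 Re (\<Lambda> u)\<close>: the parallelogram law makes minimising sequences Cauchy, and the
  vanishing of the first variation in every direction is the representation.\<close>

theorem Riesz_representation:
  assumes compl: "complete_on X"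
    and \<Lambda>_add: "\<And>x y. \<lbrakk>x \<in> X; y \<in> X\<rbrakk> \<Longrightarrow> \<Lambda> (x + y) = \<Lambda> x + \<Lambda> y"
    and \<Lambda>_scale: "\<And>c x. x \<in> X \<Longrightarrow> \<Lambda> (c *\<^sub>C x) = cnj c * \<Lambda> x"
    and \<Lambda>_bdd: "\<And>x. x \<in> X \<Longrightarrow> cmod (\<Lambda> x) \<le> K * nrm x"
  shows "\<exists>z\<in>X. \<forall>\<psi>\<in>X. ip z \<psi> = \<Lambda> \<psi>"
proof -
  define E where "E u = (nrm u)\<^sup>2 - 2 * Re (\<Lambda> u)" for u
  have E_low: "- K\<^sup>2 \<le> E u" if "u \<in> X" for u
  proof -
    have "Re (\<Lambda> u) \<le> K * nrm u"
      using \<Lambda>_bdd[OF that] complex_Re_le_cmod order_trans by blast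
    moreover have "0 \<le> (nrm u - K)\<^sup>2" by simp
    ultimately show ?thesis by (simp add: E_def power2_diff mult_ac)
  qed
  have bdd: "bdd_below (E ` X)"
    using E_low by (auto intro!: bdd_belowI)
  define i where "i = Inf (E ` X)"
  have i_le: "i \<le> E u" if "u \<in> X" for u
    unfolding i_def using bdd that by (intro cInf_lower) auto
  have "\<exists>u\<in>X. E u < i + 1 / Suc n" for n
  proof (rule ccontr)
    assume "\<not> ?thesis"
    then have "i + 1 / Suc n \<le> Inf (E ` X)"
      by (intro cInf_greatest) (auto simp: not_less)
    then show False by (simp add: i_def)
  qed
  then obtain s where sX: "s n \<in> X" and s: "E (s n) < i + 1 / Suc n" for n
    by metis
  \<comment> \<open>parallelogram law: the midpoint of \<open>u\<close> and \<open>v\<close> cannot go below the infimum\<close>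
  have E_par: "(nrm (u - v))\<^sup>2 \<le> 2 * (E u - i) + 2 * (E v - i)" if uv: "u \<in> X" "v \<in> X" for u v
  proof -
    have mid: "i \<le> E ((1/2) *\<^sub>C (u + v))"
      using uv by (intro i_le) auto
    have "nrm ((1/2) *\<^sub>C (u + v)) = (1/2) * nrm (u + v)"
      using uv by (simp add: nrm_scale norm_divide)
    moreover have "\<Lambda> ((1/2) *\<^sub>C (u + v)) = (1/2) * (\<Lambda> u + \<Lambda> v)"
      using uv by (simp add: \<Lambda>_scale \<Lambda>_add)
    ultimately have "E ((1/2) *\<^sub>C (u + v)) =
        ((1/2) * nrm (u + v))\<^sup>2 - Re (\<Lambda> u) - Re (\<Lambda> v)"
      unfolding E_def by (simp only:) (simp add: add_divide_distrib)
    then have "4 * i \<le> (nrm (u + v))\<^sup>2 - 4 * Re (\<Lambda> u) - 4 * Re (\<Lambda> v)"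
      using mid by (simp add: power_mult_distrib power_divide)
    with parallelogram[OF uv] show ?thesis
      by (simp add: E_def)
  qed
  have Cau: "\<exists>N. \<forall>m\<ge>N. \<forall>n\<ge>N. nrm (s m - s n) < e" if "e > 0" for e
  proof -
    obtain N where N: "4 / e\<^sup>2 < real N" using reals_Archimedean2 by blast
    have "nrm (s m - s n) < e" if "m \<ge> N" "n \<ge> N" for m n
    proof (rule power_less_imp_less_base[of _ 2])
      have "E (s k) - i < e\<^sup>2 / 4" if "k \<ge> N" for k
      proof -
        have "4 / e\<^sup>2 < real (Suc k)" using N that by linarith
        then have "1 / real (Suc k) < e\<^sup>2 / 4" using \<open>e > 0\<close> by (simp add: field_simps)
        then show ?thesis using s[of k] by linarith
      qed
      from this[OF \<open>m \<ge> N\<close>] this[OF \<open>n \<ge> N\<close>]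
      have "2 * (E (s m) - i) + 2 * (E (s n) - i) < e\<^sup>2"
        by (simp add: field_simps)
      with E_par[OF sX[of m] sX[of n]] show "(nrm (s m - s n))\<^sup>2 < e\<^sup>2"
        by (rule order.strict_trans1)
    qed (use \<open>e > 0\<close> in simp)
    then show ?thesis by blast
  qed
  then obtain z where z: "z \<in> X" and lim: "(\<lambda>n. nrm (s n - z)) \<longlonglongrightarrow> 0"
    using compl[unfolded complete_on_def, rule_format, of s] sX by auto
  have Ez: "E z \<le> i"
  proof (rule LIMSEQ_le_const)
    have "(\<lambda>n. (nrm (s n))\<^sup>2 - 2 * Re (\<Lambda> (s n))) \<longlonglongrightarrow> (nrm z)\<^sup>2 - 2 * Re (\<Lambda> z)"
    proof (intro tendsto_intros)
      show "(\<lambda>n. nrm (s n)) \<longlonglongrightarrow> nrm z"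
        by (rule LIM_zero_cancel, rule Lim_null_comparison[OF _ lim])
          (use nrm_triangle2'[OF sX z] in simp)
      have "(\<lambda>n. K * nrm (s n - z)) \<longlonglongrightarrow> 0"
        using tendsto_mult_right_zero[OF lim] by simp
      moreover have "norm (\<Lambda> (s n) - \<Lambda> z) \<le> K * nrm (s n - z)" for n
        using \<Lambda>_bdd[of "s n - z"] \<Lambda>_add[of "s n - z" z] sX[of n] z by simp
      ultimately show "(\<lambda>n. \<Lambda> (s n)) \<longlonglongrightarrow> \<Lambda> z"
        by (intro LIM_zero_cancel[of _ "\<Lambda> z"] Lim_null_comparison[of "\<lambda>n. \<Lambda> (s n) - \<Lambda> z"]) auto
    qed
    moreover have "(\<lambda>n. E (s n)) \<longlonglongrightarrow> i"
    proof (rule tendsto_sandwich[of "\<lambda>n. i" _ _ "\<lambda>n. i + 1 / Suc n"])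
      show "(\<lambda>n. i + 1 / real (Suc n)) \<longlonglongrightarrow> i"
        using tendsto_add[OF tendsto_const LIMSEQ_inverse_real_of_nat, of i]
        by (simp add: inverse_eq_divide)
    qed (use i_le sX s in \<open>simp_all add: less_imp_le\<close>)
    ultimately have "E z = i"
      unfolding E_def using LIMSEQ_unique by blast
    then show "(\<lambda>n. i) \<longlonglongrightarrow> i" "\<exists>N. \<forall>n\<ge>N. E z \<le> i" by auto
  qed
  have Re_eq: "Re (ip z \<psi>) = Re (\<Lambda> \<psi>)" if \<psi>: "\<psi> \<in> X" for \<psi>
  proof (rule ccontr)
    define b where "b = Re (ip z \<psi>) - Re (\<Lambda> \<psi>)"
    assume "\<not> ?thesis"
    then have b: "b \<noteq> 0" by (simp add: b_def)
    define a where "a = (nrm \<psi>)\<^sup>2 + 1"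
    have a: "a > 0" by (simp add: a_def add_nonneg_pos)
    have "0 \<le> 2 * t * b + t\<^sup>2 * (nrm \<psi>)\<^sup>2" for t :: real
    proof -
      have "E z \<le> E (z + complex_of_real t *\<^sub>C \<psi>)"
        using Ez i_le[of "z + complex_of_real t *\<^sub>C \<psi>"] z \<psi> by (simp add: scale_mem add_mem)
      also have "\<dots> = E z + 2 * t * b + t\<^sup>2 * (nrm \<psi>)\<^sup>2"
        using z \<psi>
        by (simp add: E_def b_def nrm_sq_add nrm_scale \<Lambda>_add \<Lambda>_scale ip_scale_right
            power_mult_distrib algebra_simps)
      finally show ?thesis by simp
    qed
    from this[of "- b / a"] have "2 * (b * b) / a \<le> (b * b) * (nrm \<psi>)\<^sup>2 / a\<^sup>2"
      by (simp add: power_divide power2_eq_square)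
    then have "2 * (b * b) * a \<le> (b * b) * (nrm \<psi>)\<^sup>2"
      using a by (simp add: field_simps power2_eq_square)
    then have "(b * b) * (2 * a) \<le> (b * b) * (nrm \<psi>)\<^sup>2"
      by (simp only: mult_ac)
    moreover have "0 < b * b"
      using b not_real_square_gt_zero by blast
    ultimately have "2 * a \<le> (nrm \<psi>)\<^sup>2"
      by (rule mult_left_le_imp_le)
    then show False
      by (simp add: a_def) (smt (verit) zero_le_power2)
  qed
  have "ip z \<psi> = \<Lambda> \<psi>" if \<psi>: "\<psi> \<in> X" for \<psi>
    using Re_eq[OF \<psi>] Re_eq[of "\<i> *\<^sub>C \<psi>"] z \<psi>
    by (simp add: ip_scale_right \<Lambda>_scale complex_eq_iff scale_mem)
  with z show ?thesis by blast
qed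

text \<open>The closure of \<open>Y\<close> in a complete space is itself complete, so the functional \<open>ip x\<close>
  restricted to it has a representing vector: the orthogonal projection of \<open>x\<close>.\<close>

lemma dense_of_trivial_complement:
  assumes compl: "complete_on X" and Y: "csubspace_on Y" "Y \<subseteq> X"
    and triv: "\<And>w. \<lbrakk>w \<in> X; \<And>y. y \<in> Y \<Longrightarrow> ip w y = 0\<rbrakk> \<Longrightarrow> nrm w = 0"
    and x: "x \<in> X" and e: "e > 0"
  shows "\<exists>y\<in>Y. nrm (x - y) < e"
proof -
  interpret Y: csubspace_on Y by fact
  define Z where "Z = {u \<in> X. \<forall>e>0. \<exists>y\<in>Y. nrm (u - y) < e}"
  have ZD: "\<exists>y\<in>Y. nrm (u - y) < e" if "u \<in> Z" "e > 0" for u e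
    using that unfolding Z_def by simp
  have ZX: "Z \<subseteq> X"
    unfolding Z_def by simp
  have ZI: "u \<in> Z" if "u \<in> X" "\<And>e. e > 0 \<Longrightarrow> \<exists>y\<in>Y. nrm (u - y) < e" for u
    using that unfolding Z_def by simp
  have YZ: "Y \<subseteq> Z"
  proof
    fix y assume y: "y \<in> Y"
    show "y \<in> Z"
      by (rule ZI) (use y Y(2) in \<open>auto intro!: bexI[of _ y]\<close>)
  qed
  have Z: "csubspace_on Z"
  proof
    show "0 \<in> Z" using YZ by auto
  next
    fix u v assume uv: "u \<in> Z" "v \<in> Z"
    show "u + v \<in> Z"
    proof (rule ZI)
      fix e :: real assume "e > 0"
      then have e2: "e/2 > 0" by simp
      obtain y y' where y: "y \<in> Y" "y' \<in> Y" "nrm (u - y) < e/2" "nrm (v - y') < e/2"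
        using ZD[OF uv(1) e2] ZD[OF uv(2) e2] by blast
      have "nrm ((u - y) + (v - y')) \<le> nrm (u - y) + nrm (v - y')"
        using uv y Y(2) ZX by (intro nrm_triangle) auto
      with y show "\<exists>y\<in>Y. nrm (u + v - y) < e"
        by (intro bexI[of _ "y + y'"]) (auto simp: algebra_simps)
    qed (use uv ZX in auto)
  next
    fix u c assume u: "u \<in> Z"
    show "c *\<^sub>C u \<in> Z"
    proof (rule ZI)
      fix e :: real assume "e > 0"
      then have "e / (cmod c + 1) > 0" by (simp add: add_nonneg_pos)
      then obtain y where y: "y \<in> Y" "nrm (u - y) < e / (cmod c + 1)"
        using ZD[OF u] by blast
      have uX: "u - y \<in> X" using u y Y(2) ZX by auto
      have "c *\<^sub>C u - c *\<^sub>C y = c *\<^sub>C (u - y)"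
        using scaleC_add_right[of c "u - y" y] by simp
      then have "nrm (c *\<^sub>C u - c *\<^sub>C y) = cmod c * nrm (u - y)"
        using uX by (simp add: nrm_scale)
      also have "\<dots> \<le> (cmod c + 1) * nrm (u - y)"
        using uX by (intro mult_right_mono) auto
      also have "\<dots> < e"
        using y(2) by (subst mult.commute) (simp add: pos_less_divide_eq add_nonneg_pos)
      finally show "\<exists>y\<in>Y. nrm (c *\<^sub>C u - y) < e"
        using y(1) by blast
    qed (use u ZX in auto)
  qed
  interpret Z: semi_inner Z ip
    using Z ZX by (rule semi_inner_subset)
  have "Z.complete_on Z"
    unfolding Z.complete_on_def
  proof (intro allI impI)
    fix s assume sZ: "\<forall>n::nat. s n \<in> Z"
      and Cau: "\<forall>e>0. \<exists>N. \<forall>m\<ge>N. \<forall>n\<ge>N. nrm (s m - s n) < e"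
    have "\<forall>n. s n \<in> X" using sZ by (simp add: Z_def)
    then obtain u where u: "u \<in> X" and lim: "(\<lambda>n. nrm (s n - u)) \<longlonglongrightarrow> 0"
      using compl[unfolded complete_on_def, rule_format, of s] Cau by auto
    have "u \<in> Z"
    proof (rule ZI)
      fix e :: real assume "e > 0"
      then have e2: "e/2 > 0" by simp
      then obtain n where n: "nrm (s n - u) < e/2"
        using order_tendstoD(2)[OF lim, of "e/2"] by (auto simp: eventually_sequentially)
      obtain y where y: "y \<in> Y" "nrm (s n - y) < e/2"
        using ZD[OF _ e2] sZ by blast
      have sX: "s n \<in> X" and yX: "y \<in> X" using sZ y Y(2) ZX by auto
      from nrm_triangle3[OF u sX yX] nrm_minus_commute[OF sX u] n y
      show "\<exists>y\<in>Y. nrm (u - y) < e"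
        by (intro bexI[of _ y]) auto
    qed (rule u)
    with lim show "\<exists>x\<in>Z. (\<lambda>n. nrm (s n - x)) \<longlonglongrightarrow> 0" by blast
  qed
  then have "\<exists>z\<in>Z. \<forall>\<psi>\<in>Z. ip z \<psi> = ip x \<psi>"
  proof (intro Z.Riesz_representation[of "ip x" "nrm x"])
    show "cmod (ip x v) \<le> nrm x * Z.nrm v" if "v \<in> Z" for v
      using Cauchy_Schwarz[OF x] that ZX by auto
  qed (simp_all add: x ip_add_right ip_scale_right subsetD[OF ZX])
  then obtain z where z: "z \<in> Z" "\<And>\<psi>. \<psi> \<in> Z \<Longrightarrow> ip z \<psi> = ip x \<psi>" by blast
  have zX: "z \<in> X" using z(1) ZX by blast
  have orth: "nrm (x - z) = 0"
  proof (rule triv)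
    show "ip (x - z) y = 0" if "y \<in> Y" for y
    proof -
      have "y \<in> Z" "y \<in> X" using that YZ Y(2) by auto
      then show ?thesis using z(2)[of y] x zX by (simp add: ip_diff_left)
    qed
  qed (use x zX in auto)
  obtain y where y: "y \<in> Y" "nrm (z - y) < e"
    using ZD[OF z(1) e] by blast
  have "y \<in> X" using y(1) Y(2) by blast
  then show ?thesis
    using nrm_triangle3[OF x zX, of y] orth y by (intro bexI[of _ y]) auto
qed

end

section \<open>Lyapunov functionals for strongly continuous semigroups\<close>

text \<open>The generator gives derivatives of orbits from the right only. At the last time at which
  \<open>f(s) - e s \<le> f(0)\<close> holds, the right derivative would let it hold a little longer.\<close>

lemma nonincreasing_of_right_derivative:
  fixes f :: "real \<Rightarrow> real"
  assumes cont: "continuous_on {0..} f"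
    and deriv: "\<And>t. t \<ge> 0 \<Longrightarrow> \<exists>D\<le>0. (f has_real_derivative D) (at_right t)"
    and t: "t \<ge> 0"
  shows "f t \<le> f 0"
proof (rule field_le_epsilon)
  fix e' :: real assume "e' > 0"
  define e where "e = e' / (t + 1)"
  have e: "e > 0" using \<open>e' > 0\<close> t by (simp add: e_def)
  define g where "g s = f s - e * s" for s
  have contg: "continuous_on {0..} g"
    unfolding g_def by (intro continuous_intros cont)
  have "g t \<le> g 0"
  proof (rule ccontr)
    assume neg: "\<not> g t \<le> g 0"
    define A where "A = {s \<in> {0..t}. g s \<le> g 0}"
    have "closed A"
    proof -
      have "A = {0..t} \<inter> g -` {..g 0}" by (auto simp: A_def)
      then show ?thesis
        by (simp only:) (intro continuous_closed_preimage continuous_on_subset[OF contg]; auto)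
    qed
    moreover have "A \<noteq> {}" "bounded A"
      using t by (auto simp: A_def intro: bounded_subset[of "{0..t}"])
    ultimately obtain s where s: "s \<in> A" "\<And>r. r \<in> A \<Longrightarrow> r \<le> s"
      using compact_attains_sup[of A] by (auto simp: compact_eq_bounded_closed)
    have st: "0 \<le> s" "s < t" "g s \<le> g 0"
      using s neg by (auto simp: A_def order_less_le)
    obtain D where D: "D \<le> 0" "(f has_real_derivative D) (at_right s)"
      using deriv st by blast
    then have "((\<lambda>h. (f h - f s) / (h - s)) \<longlongrightarrow> D) (at_right s)"
      by (simp add: has_field_derivative_iff)
    then have "\<forall>\<^sub>F h in at_right s. (f h - f s) / (h - s) < e"
      by (rule order_tendstoD) (use D e in auto)
    moreover have "\<forall>\<^sub>F h in at_right s. h \<in> {s<..<t}"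
      using eventually_at_right_real[OF st(2)] .
    ultimately have "\<forall>\<^sub>F h in at_right s. h \<in> {s<..<t} \<and> (f h - f s) / (h - s) < e"
      by eventually_elim auto
    then obtain h where h: "s < h" "h < t" "(f h - f s) / (h - s) < e"
      by (auto dest!: eventually_happens)
    then have "f h - f s \<le> e * (h - s)"
      by (simp add: field_simps)
    then have "h \<in> A"
      using h st by (auto simp: A_def g_def algebra_simps)
    with s h show False by fastforce
  qed
  then have "f t \<le> f 0 + e * t" by (simp add: g_def)
  also have "e * t \<le> e'"
    using t \<open>e' > 0\<close> by (simp add: e_def field_simps)
  finally show "f t \<le> f 0 + e'" by simp
qed

locale csemigroup = semi_inner X ip for X :: "'a::complex_vector set" and ip +
  fixes T :: "real \<Rightarrow> 'a \<Rightarrow> 'a"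
  assumes C0: "C0_semigroup_on X nrm T"
begin

lemma T_bounded_clinear: "t \<ge> 0 \<Longrightarrow> bounded_clinear_on X nrm (T t)"
  using C0 by (simp add: C0_semigroup_on_def)

lemma T_mem [simp, intro]: "\<lbrakk>t \<ge> 0; x \<in> X\<rbrakk> \<Longrightarrow> T t x \<in> X"
  and T_add: "\<lbrakk>t \<ge> 0; x \<in> X; y \<in> X\<rbrakk> \<Longrightarrow> T t (x + y) = T t x + T t y"
  and T_scale: "\<lbrakk>t \<ge> 0; x \<in> X\<rbrakk> \<Longrightarrow> T t (c *\<^sub>C x) = c *\<^sub>C T t x"
  using T_bounded_clinear[of t] by (auto simp: bounded_clinear_on_def)

lemma T_diff: "\<lbrakk>t \<ge> 0; x \<in> X; y \<in> X\<rbrakk> \<Longrightarrow> T t (x - y) = T t x - T t y"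
  using T_add[of t x "- y"] T_scale[of t y "- 1"] by simp

lemma T_zero: "x \<in> X \<Longrightarrow> T 0 x = x"
  using C0 by (simp add: C0_semigroup_on_def)

lemma T_plus: "\<lbrakk>s \<ge> 0; t \<ge> 0; x \<in> X\<rbrakk> \<Longrightarrow> T (s + t) x = T s (T t x)"
  using C0 by (simp add: C0_semigroup_on_def)

lemma T_lim: "x \<in> X \<Longrightarrow> ((\<lambda>t. nrm (T t x - x)) \<longlongrightarrow> 0) (at_right 0)"
  using C0 by (simp add: C0_semigroup_on_def)

lemma T_bound:
  assumes "t \<ge> 0"
  obtains K where "K \<ge> 0" "\<And>x. x \<in> X \<Longrightarrow> nrm (T t x) \<le> K * nrm x"
proof -
  obtain K where K: "\<And>x. x \<in> X \<Longrightarrow> nrm (T t x) \<le> K * nrm x"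
    using T_bounded_clinear[OF assms] unfolding bounded_clinear_on_def by blast
  have "nrm (T t x) \<le> max K 0 * nrm x" if "x \<in> X" for x
    using K[OF that] that by (meson max.cobounded1 mult_right_mono nrm_nonneg order_trans)
  then show ?thesis by (intro that[of "max K 0"]) auto
qed

lemma T_right_continuous:
  assumes "t \<ge> 0" "x \<in> X"
  shows "((\<lambda>h. nrm (T (t + h) x - T t x)) \<longlongrightarrow> 0) (at_right 0)"
proof -
  obtain K where K: "K \<ge> 0" "\<And>x. x \<in> X \<Longrightarrow> nrm (T t x) \<le> K * nrm x"
    using T_bound[OF assms(1)] by blast
  have "\<forall>\<^sub>F h in at_right 0. norm (nrm (T (t + h) x - T t x)) \<le> K * nrm (T h x - x)"
    unfolding eventually_at_filter
  proof (intro always_eventually allI impI)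
    fix h :: real assume "h \<in> {0<..}"
    then have "h \<ge> 0" by simp
    then show "norm (nrm (T (t + h) x - T t x)) \<le> K * nrm (T h x - x)"
      using assms K(2)[of "T h x - x"] by (simp add: T_plus T_diff)
  qed
  then show ?thesis
    by (rule Lim_null_comparison) (use tendsto_mult_right_zero[OF T_lim[OF assms(2)]] in simp)
qed

text \<open>The operators are bounded one at a time. Each set \<open>S n\<close> of times at which the bound \<open>n\<close>
  is exceeded contains a right neighbourhood of each of its points, so if it were dense it would
  have dense interior; by Baire's theorem on the time axis not all of them are dense, which bounds
  the semigroup on some interval, and composition moves that interval anywhere to the right.\<close>

lemma T_locally_bounded:
  assumes \<tau>: "\<tau> > 0"
  obtains \<delta> K where "0 < \<delta>" "\<delta> \<le> \<tau>" "K \<ge> 0"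
    "\<And>s x. \<lbrakk>\<tau> - \<delta> < s; s \<le> \<tau>; x \<in> X\<rbrakk> \<Longrightarrow> nrm (T s x) \<le> K * nrm x"
proof -
  define S where "S n = {t. t \<ge> 0 \<and> (\<exists>x\<in>X. nrm (T t x) > real n * nrm x)}" for n
  have right_open: "\<exists>e>0. {t..<t + e} \<subseteq> S n" if "t \<in> S n" for t n
  proof -
    have t: "t \<ge> 0" and "\<exists>x\<in>X. nrm (T t x) > real n * nrm x"
      using that by (simp_all add: S_def)
    then obtain x where x: "x \<in> X" "nrm (T t x) > real n * nrm x"
      by blast
    have "\<forall>\<^sub>F h in at_right 0. nrm (T (t + h) x - T t x) < nrm (T t x) - real n * nrm x"
      using T_right_continuous[OF t x(1)] x(2) by (intro order_tendstoD) auto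
    then obtain e where e: "e > 0"
      and *: "\<And>h. \<lbrakk>0 < h; h < e\<rbrakk> \<Longrightarrow>
        nrm (T (t + h) x - T t x) < nrm (T t x) - real n * nrm x"
      by (auto simp: eventually_at_right_field)
    have "s \<in> S n" if "s \<in> {t..<t + e}" for s
    proof (cases "s = t")
      case False
      then have "nrm (T s x - T t x) < nrm (T t x) - real n * nrm x"
        using *[of "s - t"] that by simp
      moreover have "\<bar>nrm (T s x) - nrm (T t x)\<bar> \<le> nrm (T s x - T t x)"
        using that t x by (intro nrm_triangle2') auto
      ultimately show ?thesis
        using that t x by (auto simp: S_def intro!: bexI[of _ x])
    qed (use \<open>t \<in> S n\<close> in simp)
    with e show ?thesis by blast
  qed
  define G where "G n = {0..\<tau>} \<inter> interior (S n)" for n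
  have "\<exists>n. \<not> {0..\<tau>} \<subseteq> closure (G n)"
  proof (rule ccontr)
    assume "\<not> ?thesis"
    then have "{0..\<tau>} \<subseteq> closure (\<Inter>(range G))"
      by (intro Baire) (auto simp: G_def openin_open)
    then have "\<Inter>(range G) \<noteq> {}" using \<tau> by force
    then obtain t where t: "\<And>n. t \<in> G n" by blast
    have tS: "t \<in> S n" for n
      using t[of n] interior_subset by (auto simp: G_def)
    then have "t \<ge> 0" by (auto simp: S_def)
    then obtain K where K: "K \<ge> 0" "\<And>x. x \<in> X \<Longrightarrow> nrm (T t x) \<le> K * nrm x"
      using T_bound by blast
    obtain n where n: "K \<le> real n" using real_arch_simple by blast
    obtain x where x: "x \<in> X" "real n * nrm x < nrm (T t x)"
      using tS[of n] unfolding S_def by blast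
    have "K * nrm x \<le> real n * nrm x"
      using n x by (intro mult_right_mono) auto
    with K(2)[OF x(1)] x(2) show False by simp
  qed
  then obtain n p where p: "p \<in> {0..\<tau>}" "p \<notin> closure (G n)" by blast
  then obtain e where e: "e > 0" "ball p e \<subseteq> - closure (G n)"
    using open_contains_ball[of "- closure (G n)"] by auto
  define a where "a = max 0 (p - e)"
  define b where "b = min \<tau> (p + e)"
  have ab: "0 \<le> a" "a < b" "b \<le> \<tau>"
    using p(1) e(1) \<tau> by (auto simp: a_def b_def)
  have notS: "t \<notin> S n" if "a < t" "t < b" for t
  proof
    assume "t \<in> S n"
    then obtain d where d: "d > 0" "{t..<t + d} \<subseteq> S n" using right_open by blast
    define r where "r = (t + min (t + d) b) / 2"
    have r: "t < r" "r < t + d" "r < b"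
      using d(1) that by (auto simp: r_def min_def field_simps)
    have "{t<..<t + d} \<subseteq> S n" using d(2) by force
    then have "r \<in> interior (S n)"
      using r by (intro interiorI[of "{t<..<t + d}"]) auto
    then have "r \<in> G n" using r that ab by (auto simp: G_def)
    moreover have "r \<in> ball p e"
      using r that by (auto simp: a_def b_def dist_real_def)
    ultimately show False using e(2) closure_subset[of "G n"] by blast
  qed
  have bd: "nrm (T t x) \<le> real n * nrm x" if "a < t" "t < b" "x \<in> X" for t x
    using notS[OF that(1,2)] that ab by (auto simp: S_def not_less)
  define c where "c = (a + b) / 2"
  define \<delta> where "\<delta> = (b - a) / 2"
  have c: "0 \<le> \<tau> - c" "c - \<delta> = a" "c < b"
    using ab by (auto simp: c_def \<delta>_def field_simps)
  obtain K where K: "K \<ge> 0" "\<And>x. x \<in> X \<Longrightarrow> nrm (T (\<tau> - c) x) \<le> K * nrm x"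
    using T_bound[OF c(1)] by blast
  show ?thesis
  proof (rule that[of \<delta> "real n * K"])
    fix s x assume s: "\<tau> - \<delta> < s" "s \<le> \<tau>" "x \<in> X"
    define r where "r = s - (\<tau> - c)"
    have r: "a < r" "r < b" using s c by (auto simp: r_def)
    have "T s x = T r (T (\<tau> - c) x)"
      using T_plus[of r "\<tau> - c" x] r ab c s by (simp add: r_def)
    also have "nrm \<dots> \<le> real n * nrm (T (\<tau> - c) x)"
      using r s c by (intro bd) auto
    also have "\<dots> \<le> real n * (K * nrm x)"
      using K(2)[OF s(3)] by (intro mult_left_mono) auto
    finally show "nrm (T s x) \<le> real n * K * nrm x" by (simp add: mult.assoc)
  qed (use ab K in \<open>auto simp: \<delta>_def\<close>)
qed

text \<open>Continuity from the left is where local boundedness enters: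
  \<open>T (t - h) x - T t x = T (t - h) (x - T h x)\<close>.\<close>

lemma T_continuous:
  assumes "t \<ge> 0" "x \<in> X"
  shows "((\<lambda>s. nrm (T s x - T t x)) \<longlongrightarrow> 0) (at t within {0..})"
proof -
  have R: "((\<lambda>s. nrm (T s x - T t x)) \<longlongrightarrow> 0) (at_right t)"
    unfolding filterlim_at_right_to_0[of _ _ t]
    using T_right_continuous[OF assms] by (simp add: add.commute)
  show ?thesis
  proof (cases "t = 0")
    case True
    have "at t within {0..} = at_right t"
      unfolding True by (rule at_within_Ici_at_right)
    with R show ?thesis by simp
  next
    case False
    then have t: "t > 0" using assms by simp
    obtain \<delta> K where \<delta>: "0 < \<delta>" "\<delta> \<le> t" "K \<ge> 0"
      and K: "\<And>s x. \<lbrakk>t - \<delta> < s; s \<le> t; x \<in> X\<rbrakk> \<Longrightarrow> nrm (T s x) \<le> K * nrm x"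
      using T_locally_bounded[OF t] by blast
    have Lz: "((\<lambda>h. nrm (T (t - h) x - T t x)) \<longlongrightarrow> 0) (at_right 0)"
    proof (rule Lim_null_comparison)
      show "((\<lambda>h. K * nrm (T h x - x)) \<longlongrightarrow> 0) (at_right 0)"
        using tendsto_mult_right_zero[OF T_lim[OF assms(2)]] by simp
      have "\<forall>\<^sub>F h in at_right 0. h \<in> {0<..<\<delta>}"
        using eventually_at_right_real[OF \<delta>(1)] .
      then show "\<forall>\<^sub>F h in at_right 0. norm (nrm (T (t - h) x - T t x)) \<le> K * nrm (T h x - x)"
      proof eventually_elim
        case (elim h)
        have "T t x = T (t - h) (T h x)"
          using T_plus[of "t - h" h x] elim \<delta> assms by simp
        then have "T (t - h) x - T t x = T (t - h) (x - T h x)"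
          using elim \<delta> assms by (simp add: T_diff)
        then have "nrm (T (t - h) x - T t x) \<le> K * nrm (x - T h x)"
          using elim assms by (simp add: K)
        then show ?case
          using elim \<delta> assms nrm_minus_commute[of x "T h x"] by simp
      qed
    qed
    have "((\<lambda>s. nrm (T s x - T t x)) \<longlongrightarrow> 0) (at_left t)"
      unfolding filterlim_at_left_to_right
      using Lz filterlim_at_right_to_0[of "\<lambda>s. nrm (T (- s) x - T t x)" "nhds 0" "- t"]
      by simp
    with R have "((\<lambda>s. nrm (T s x - T t x)) \<longlongrightarrow> 0) (at t)"
      by (simp add: filterlim_split_at)
    then show ?thesis by (rule tendsto_within_subset) simp
  qed
qed

text \<open>For \<open>x\<close> in the domain, \<open>t \<mapsto> exp (c t / M) B (T t x) (T t x)\<close> is continuous with nonpositive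
  right derivative, hence does not increase. The resulting bound is uniform on the domain, so it
  passes to its closure because each single \<open>T t\<close> is bounded. The form \<open>B\<close> is
  real-bilinear, to accommodate the real parts of multiplier functionals.\<close>

theorem exponential_decay_of_Lyapunov:
  fixes B :: "'a \<Rightarrow> 'a \<Rightarrow> real"
  assumes gen: "generator_on X nrm T D G"
    and dense: "\<And>x e. \<lbrakk>x \<in> X; e > 0\<rbrakk> \<Longrightarrow> \<exists>y\<in>D. nrm (x - y) < e"
    and B_add_left: "\<And>x y z. \<lbrakk>x \<in> X; y \<in> X; z \<in> X\<rbrakk> \<Longrightarrow> B (x + y) z = B x z + B y z"
    and B_add_right: "\<And>x y z. \<lbrakk>x \<in> X; y \<in> X; z \<in> X\<rbrakk> \<Longrightarrow> B z (x + y) = B z x + B z y"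
    and B_scale_left: "\<And>r x y. \<lbrakk>x \<in> X; y \<in> X\<rbrakk> \<Longrightarrow> B (complex_of_real r *\<^sub>C x) y = r * B x y"
    and B_scale_right: "\<And>r x y. \<lbrakk>x \<in> X; y \<in> X\<rbrakk> \<Longrightarrow> B y (complex_of_real r *\<^sub>C x) = r * B y x"
    and B_bdd: "\<And>x y. \<lbrakk>x \<in> X; y \<in> X\<rbrakk> \<Longrightarrow> \<bar>B x y\<bar> \<le> M * (nrm x * nrm y)"
    and B_pos: "\<And>x. x \<in> X \<Longrightarrow> (nrm x)\<^sup>2 \<le> B x x"
    and M: "M > 0" and c: "c > 0"
    and decay: "\<And>x. x \<in> D \<Longrightarrow> B (G x) x + B x (G x) \<le> - c * (nrm x)\<^sup>2"
  shows "\<exists>C>0. \<exists>\<omega>>0. \<forall>t\<ge>0. opnorm_on X nrm (T t) \<le> C * exp (- \<omega> * t)"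
proof -
  define lim where "lim x y \<longleftrightarrow>
      ((\<lambda>t. nrm (complex_of_real (1 / t) *\<^sub>C (T t x - x) - y)) \<longlongrightarrow> 0) (at_right 0)" for x y
  have D_eq: "D = {x\<in>X. \<exists>y\<in>X. lim x y}"
    and G: "\<And>x. x \<in> D \<Longrightarrow> G x \<in> X \<and> lim x (G x)"
    using gen unfolding generator_on_def Let_def lim_def by auto
  have B_diff_left: "B (x - y) z = B x z - B y z" if "x \<in> X" "y \<in> X" "z \<in> X" for x y z
    using B_add_left[of "x - y" y z] that by simp
  have B_diff_right: "B z (x - y) = B z x - B z y" if "x \<in> X" "y \<in> X" "z \<in> X" for x y z
    using B_add_right[of "x - y" y z] that by simp
  have DX: "x \<in> X" if "x \<in> D" for x using that D_eq by blast
  have TD: "T t x \<in> D" if t: "t \<ge> 0" and x: "x \<in> D" for t x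
  proof -
    have X: "x \<in> X" "G x \<in> X" using x DX G by auto
    obtain K where K: "K \<ge> 0" "\<And>x. x \<in> X \<Longrightarrow> nrm (T t x) \<le> K * nrm x"
      using T_bound[OF t] by blast
    have "lim (T t x) (T t (G x))"
      unfolding lim_def
    proof (rule Lim_null_comparison)
      show "((\<lambda>h. K * nrm (complex_of_real (1 / h) *\<^sub>C (T h x - x) - G x)) \<longlongrightarrow> 0) (at_right 0)"
        using tendsto_mult_right_zero[OF conjunct2[OF G[OF x], unfolded lim_def]] by simp
      show "\<forall>\<^sub>F h in at_right 0. norm (nrm (complex_of_real (1 / h) *\<^sub>C (T h (T t x) - T t x) - T t (G x)))
          \<le> K * nrm (complex_of_real (1 / h) *\<^sub>C (T h x - x) - G x)"
        unfolding eventually_at_filter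
      proof (intro always_eventually allI impI)
        fix h :: real assume "h \<in> {0<..}"
        then have h: "h > 0" by simp
        let ?d = "complex_of_real (1 / h) *\<^sub>C (T h x - x) - G x"
        have d: "?d \<in> X" using X h by (intro diff_mem scale_mem T_mem) auto
        have "T h (T t x) = T t (T h x)"
          using T_plus[of h t x] T_plus[of t h x] h t X by (simp add: add.commute)
        then have "T t ?d = complex_of_real (1 / h) *\<^sub>C (T h (T t x) - T t x) - T t (G x)"
          using X h t by (simp add: T_diff T_scale)
        then show "norm (nrm (complex_of_real (1 / h) *\<^sub>C (T h (T t x) - T t x) - T t (G x)))
            \<le> K * nrm ?d"
          using K(2)[OF d] d t by (metis T_mem nrm_nonneg abs_of_nonneg real_norm_def)
      qed
    qed
    with X t show ?thesis unfolding D_eq by blast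
  qed
  have nrm_decay: "nrm (T t x) \<le> sqrt M * exp (- (c / (2 * M)) * t) * nrm x"
    if x: "x \<in> D" and t: "t \<ge> 0" for x t
  proof -
    have xX: "x \<in> X" using x DX by blast
    define f where "f s = B (T s x) (T s x)" for s
    have derf: "(f has_real_derivative B (G (T s x)) (T s x) + B (T s x) (G (T s x))) (at_right s)"
      if s: "s \<ge> 0" for s
    proof -
      define u where "u = T s x"
      have u: "u \<in> D" "u \<in> X" "G u \<in> X" using TD[OF s x] DX G by (auto simp: u_def)
      define \<delta> where "\<delta> h = T h u - u" for h
      define d where "d h = complex_of_real (1 / h) *\<^sub>C \<delta> h" for h
      have X\<delta>: "\<delta> h \<in> X" "d h \<in> X" if "h > 0" for h
        using that u by (auto simp: \<delta>_def d_def)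
      have l1: "((\<lambda>h. nrm (d h - G u)) \<longlongrightarrow> 0) (at_right 0)"
        using G[OF u(1)] by (simp add: lim_def d_def \<delta>_def)
      have l2: "((\<lambda>h. nrm (\<delta> h)) \<longlongrightarrow> 0) (at_right 0)"
        using T_lim[OF u(2)] by (simp add: \<delta>_def)
      have "((\<lambda>h. M * (nrm (d h - G u) * (2 * nrm u)) +
          M * ((nrm (d h - G u) + nrm (G u)) * nrm (\<delta> h))) \<longlongrightarrow>
          M * (0 * (2 * nrm u)) + M * ((0 + nrm (G u)) * 0)) (at_right 0)"
        by (intro tendsto_intros l1 l2)
      then have l3: "((\<lambda>h. M * (nrm (d h - G u) * (2 * nrm u)) +
          M * ((nrm (d h - G u) + nrm (G u)) * nrm (\<delta> h))) \<longlongrightarrow> 0) (at_right 0)"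
        by simp
      have "((\<lambda>h. (f (s + h) - f s) / h - (B (G u) u + B u (G u))) \<longlongrightarrow> 0) (at_right 0)"
      proof (rule Lim_null_comparison[OF _ l3])
        show "\<forall>\<^sub>F h in at_right 0. norm ((f (s + h) - f s) / h - (B (G u) u + B u (G u)))
          \<le> M * (nrm (d h - G u) * (2 * nrm u)) + M * ((nrm (d h - G u) + nrm (G u)) * nrm (\<delta> h))"
          unfolding eventually_at_filter
        proof (intro always_eventually allI impI)
          fix h :: real assume "h \<in> {0<..}"
          then have h: "h > 0" by simp
          have "T (s + h) x = u + \<delta> h"
            using T_plus[of h s x] s h xX by (simp add: \<delta>_def u_def add.commute)
          then have "f (s + h) - f s = B (\<delta> h) u + B u (\<delta> h) + B (\<delta> h) (\<delta> h)"
            using u X\<delta>[OF h] by (simp add: f_def u_def[symmetric] B_add_left B_add_right)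
          then have "(f (s + h) - f s) / h = B (d h) u + B u (d h) + B (d h) (\<delta> h)"
            using u X\<delta>[OF h] B_scale_left[of "\<delta> h" u "1 / h"] B_scale_right[of "\<delta> h" u "1 / h"]
              B_scale_left[of "\<delta> h" "\<delta> h" "1 / h"]
            by (simp add: d_def add_divide_distrib)
          then have "(f (s + h) - f s) / h - (B (G u) u + B u (G u)) =
              B (d h - G u) u + B u (d h - G u) + B (d h) (\<delta> h)"
            using u X\<delta>[OF h] by (simp add: B_diff_left B_diff_right)
          also have "\<bar>\<dots>\<bar> \<le> \<bar>B (d h - G u) u\<bar> + \<bar>B u (d h - G u)\<bar> + \<bar>B (d h) (\<delta> h)\<bar>"
            by linarith
          also have "\<dots> \<le> M * (nrm (d h - G u) * nrm u) + M * (nrm u * nrm (d h - G u)) +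
              M * (nrm (d h) * nrm (\<delta> h))"
            using u X\<delta>[OF h] by (intro add_mono B_bdd) auto
          also have "M * (nrm (d h) * nrm (\<delta> h)) \<le>
              M * ((nrm (d h - G u) + nrm (G u)) * nrm (\<delta> h))"
            using nrm_triangle[of "d h - G u" "G u"] u X\<delta>[OF h] M
            by (intro mult_left_mono mult_right_mono) auto
          finally show "norm ((f (s + h) - f s) / h - (B (G u) u + B u (G u))) \<le>
              M * (nrm (d h - G u) * (2 * nrm u)) +
              M * ((nrm (d h - G u) + nrm (G u)) * nrm (\<delta> h))"
            by (simp add: algebra_simps)
        qed
      qed
      then have "((\<lambda>h. (f (s + h) - f s) / h) \<longlongrightarrow> B (G u) u + B u (G u)) (at_right 0)"
        by (rule LIM_zero_cancel)
      then have "((\<lambda>r. (f r - f s) / (r - s)) \<longlongrightarrow> B (G u) u + B u (G u)) (at_right s)"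
        using filterlim_at_right_to_0[of "\<lambda>r. (f r - f s) / (r - s)" _ s]
        by (simp add: add.commute)
      then show ?thesis
        by (simp add: has_field_derivative_iff u_def)
    qed
    have contf: "continuous_on {0..} f"
      unfolding continuous_on_def
    proof
      fix s :: real assume "s \<in> {0..}"
      then have s: "s \<ge> 0" by simp
      define u where "u = T s x"
      have u: "u \<in> X" using s xX by (simp add: u_def)
      have l1: "((\<lambda>r. nrm (T r x - u)) \<longlongrightarrow> 0) (at s within {0..})"
        unfolding u_def by (rule T_continuous[OF s xX])
      have "((\<lambda>r. M * (nrm (T r x - u) * (2 * nrm u)) + M * (nrm (T r x - u) * nrm (T r x - u)))
          \<longlongrightarrow> M * (0 * (2 * nrm u)) + M * (0 * 0)) (at s within {0..})"
        by (intro tendsto_intros l1)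
      then have l3: "((\<lambda>r. M * (nrm (T r x - u) * (2 * nrm u)) +
          M * (nrm (T r x - u) * nrm (T r x - u))) \<longlongrightarrow> 0) (at s within {0..})"
        by simp
      have "((\<lambda>r. f r - f s) \<longlongrightarrow> 0) (at s within {0..})"
      proof (rule Lim_null_comparison[OF _ l3])
        show "\<forall>\<^sub>F r in at s within {0..}. norm (f r - f s) \<le>
          M * (nrm (T r x - u) * (2 * nrm u)) + M * (nrm (T r x - u) * nrm (T r x - u))"
          unfolding eventually_at_filter
        proof (intro always_eventually allI impI)
          fix r :: real assume "r \<in> {0..}"
          then have r: "T r x \<in> X" using xX by simp
          define v where "v = T r x - u"
          have v: "v \<in> X" "T r x = u + v" using r u by (auto simp: v_def)
          have "f r - f s = B v u + B u v + B v v"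
            using u v by (simp add: f_def u_def[symmetric] B_add_left B_add_right)
          also have "\<bar>\<dots>\<bar> \<le> \<bar>B v u\<bar> + \<bar>B u v\<bar> + \<bar>B v v\<bar>" by linarith
          also have "\<dots> \<le> M * (nrm v * nrm u) + M * (nrm u * nrm v) + M * (nrm v * nrm v)"
            using u v by (intro add_mono B_bdd) auto
          finally show "norm (f r - f s) \<le>
              M * (nrm (T r x - u) * (2 * nrm u)) + M * (nrm (T r x - u) * nrm (T r x - u))"
            by (simp add: v_def[symmetric] algebra_simps)
        qed
      qed
      then show "(f \<longlongrightarrow> f s) (at s within {0..})" by (rule LIM_zero_cancel)
    qed
    define k where "k = c / M"
    have k: "k > 0" using c M by (simp add: k_def)
    have "exp (k * t) * f t \<le> f 0"
    proof (rule order_trans[OF nonincreasing_of_right_derivative[of "\<lambda>t. exp (k * t) * f t", OF _ _ t]])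
      show "continuous_on {0..} (\<lambda>t. exp (k * t) * f t)"
        by (intro continuous_intros contf)
      fix s :: real assume s: "s \<ge> 0"
      define D' where "D' = B (G (T s x)) (T s x) + B (T s x) (G (T s x))"
      have u: "T s x \<in> D" "T s x \<in> X" using TD[OF s x] DX by auto
      have "((\<lambda>t. exp (k * t) * f t) has_real_derivative
          exp (k * s) * D' + exp (k * s) * k * f s) (at_right s)"
        unfolding D'_def by (rule derivative_eq_intros derf[OF s] refl | simp)+
      moreover have "k * f s + D' \<le> 0"
      proof -
        have "f s \<le> M * (nrm (T s x) * nrm (T s x))"
          using B_bdd[OF u(2) u(2)] by (simp add: f_def)
        then have "k * f s \<le> k * (M * (nrm (T s x) * nrm (T s x)))"
          using k by (intro mult_left_mono) auto
        also have "\<dots> = c * (nrm (T s x))\<^sup>2"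
          using M by (simp add: k_def power2_eq_square)
        finally show ?thesis using decay[OF u(1)] by (simp add: D'_def)
      qed
      then have "exp (k * s) * D' + exp (k * s) * k * f s \<le> 0"
        using mult_left_mono[of "k * f s + D'" 0 "exp (k * s)"] by (simp add: algebra_simps)
      ultimately show "\<exists>D\<le>0. ((\<lambda>t. exp (k * t) * f t) has_real_derivative D) (at_right s)"
        by blast
    qed simp
    moreover have "f 0 \<le> M * (nrm x)\<^sup>2"
      using B_bdd[OF xX xX] by (simp add: f_def T_zero[OF xX] power2_eq_square)
    moreover have "exp (k * t) * (nrm (T t x))\<^sup>2 \<le> exp (k * t) * f t"
      using B_pos[of "T t x"] t xX by (simp add: f_def)
    ultimately have "exp (k * t) * (nrm (T t x))\<^sup>2 \<le> M * (nrm x)\<^sup>2" by linarith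
    then have "(nrm (T t x))\<^sup>2 \<le> M * exp (- (k * t)) * (nrm x)\<^sup>2"
      by (simp add: exp_minus field_simps)
    also have "\<dots> = (sqrt M * exp (- (c / (2 * M)) * t) * nrm x)\<^sup>2"
      using M by (simp add: power_mult_distrib k_def flip: exp_double)
    finally show ?thesis
      using M xX by (rule_tac power2_le_imp_le) auto
  qed
  have all: "nrm (T t x) \<le> sqrt M * exp (- (c / (2 * M)) * t) * nrm x"
    if x: "x \<in> X" and t: "t \<ge> 0" for x t
  proof (rule field_le_epsilon)
    fix e :: real assume e: "e > 0"
    define a where "a = sqrt M * exp (- (c / (2 * M)) * t)"
    have a: "a \<ge> 0" using M by (simp add: a_def)
    obtain K where K: "K \<ge> 0" "\<And>x. x \<in> X \<Longrightarrow> nrm (T t x) \<le> K * nrm x"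
      using T_bound[OF t] by blast
    have "e / (a + K + 1) > 0" using e a K by simp
    then obtain y where y: "y \<in> D" "nrm (x - y) < e / (a + K + 1)"
      using dense[OF x] by blast
    have yX: "y \<in> X" using y DX by blast
    have "nrm (T t x) \<le> nrm (T t (x - y)) + nrm (T t y)"
      using nrm_triangle[of "T t (x - y)" "T t y"] x yX t by (simp add: T_diff)
    also have "\<dots> \<le> K * nrm (x - y) + a * nrm y"
      unfolding a_def using x yX by (intro add_mono K nrm_decay y t) auto
    also have "\<dots> \<le> K * nrm (x - y) + a * (nrm x + nrm (x - y))"
      using a nrm_triangle2'[OF x yX] by (intro add_left_mono mult_left_mono) auto
    also have "\<dots> = a * nrm x + (a + K) * nrm (x - y)" by (simp add: algebra_simps)
    also have "(a + K) * nrm (x - y) \<le> (a + K + 1) * nrm (x - y)"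
      using x yX by (intro mult_right_mono) auto
    also have "\<dots> \<le> e"
      using y(2) a K by (simp add: field_simps)
    finally show "nrm (T t x) \<le> sqrt M * exp (- (c / (2 * M)) * t) * nrm x + e"
      by (simp add: a_def)
  qed
  have "opnorm_on X nrm (T t) \<le> sqrt M * exp (- (c / (2 * M)) * t)" if t: "t \<ge> 0" for t
    unfolding opnorm_on_def
  proof (rule cSUP_least)
    show "{x \<in> X. nrm x \<le> 1} \<noteq> {}" by (auto intro!: exI[of _ 0])
    fix x assume "x \<in> {x \<in> X. nrm x \<le> 1}"
    then have x: "x \<in> X" "nrm x \<le> 1" by auto
    have "nrm (T t x) \<le> sqrt M * exp (- (c / (2 * M)) * t) * nrm x"
      by (rule all[OF x(1) t])
    also have "\<dots> \<le> sqrt M * exp (- (c / (2 * M)) * t) * 1"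
      using x M by (intro mult_left_mono) auto
    finally show "nrm (T t x) \<le> sqrt M * exp (- (c / (2 * M)) * t)" by simp
  qed
  then show ?thesis
    using M c by (intro exI[of _ "sqrt M"] conjI exI[of _ "c / (2 * M)"]) auto
qed

end

section \<open>Test functions on an interval\<close>

text \<open>The flat functions \<open>P(1/t) exp(-1/t)\<close>, extended by \<open>0\<close> to \<open>t \<le> 0\<close>, are closed under
  differentiation; this is the reason for carrying the polynomial \<open>P\<close>.\<close>

definition flat :: "real poly \<Rightarrow> real \<Rightarrow> real" where
  "flat P t = (if t > 0 then poly P (1 / t) * exp (- (1 / t)) else 0)"

lemma poly_div_exp_tendsto_0: "((\<lambda>x::real. poly P x / exp x) \<longlongrightarrow> 0) at_top"
proof -
  have "((\<lambda>x::real. \<Sum>i\<le>degree P. coeff P i * (x ^ i / exp x)) \<longlongrightarrow> (\<Sum>i\<le>degree P. coeff P i * 0)) at_top"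
    by (intro tendsto_intros tendsto_power_div_exp_0)
  then show ?thesis
    by (simp add: poly_altdef sum_divide_distrib)
qed

lemma flat_has_derivative:
  "(flat P has_real_derivative flat ([:0, 0, 1:] * (P - pderiv P)) t) (at t)"
proof (cases t "0::real" rule: linorder_cases)
  case less
  have "((\<lambda>_. 0) has_real_derivative 0) (at t)" by simp
  then have "(flat P has_real_derivative 0) (at t)"
    by (rule has_field_derivative_transform_within_open[where S="{..<0}"])
      (use less in \<open>auto simp: flat_def\<close>)
  then show ?thesis using less by (simp add: flat_def)
next
  case greater
  have "((\<lambda>t. poly P (1 / t) * exp (- (1 / t))) has_real_derivative
      flat ([:0, 0, 1:] * (P - pderiv P)) t) (at t)"
    using greater
    by (auto intro!: derivative_eq_intros DERIV_chain'[OF _ poly_DERIV]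
        simp: flat_def field_simps power2_eq_square)
  then show ?thesis
    by (rule has_field_derivative_transform_within_open[where S="{0<..}"])
      (use greater in \<open>auto simp: flat_def\<close>)
next
  case equal
  have "((\<lambda>h. poly (pCons 0 P) h / exp h) \<longlongrightarrow> 0) at_top"
    by (rule poly_div_exp_tendsto_0)
  then have "((\<lambda>h. poly (pCons 0 P) (inverse h) / exp (inverse h)) \<longlongrightarrow> 0) (at_right 0)"
    by (rule filterlim_compose[OF _ filterlim_inverse_at_top_right])
  then have R: "((\<lambda>h. flat P h / h) \<longlongrightarrow> 0) (at_right 0)"
    by (rule Lim_transform_eventually)
      (auto simp: eventually_at_filter flat_def exp_minus field_simps)
  have L: "((\<lambda>h. flat P h / h) \<longlongrightarrow> 0) (at_left 0)"
    by (rule tendsto_eventually) (auto simp: eventually_at_filter flat_def)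
  show ?thesis
    using filterlim_split_at[OF L R] unfolding equal
    by (simp add: has_field_derivative_iff flat_def)
qed

text \<open>An inductive class that contains the flat functions and is visibly closed under
  differentiation, sums and products.\<close>

inductive smooth :: "(real \<Rightarrow> real) \<Rightarrow> bool" where
  flat: "smooth (\<lambda>x. flat P (a * x + b))"
| const: "smooth (\<lambda>x. c)"
| add: "\<lbrakk>smooth f; smooth g\<rbrakk> \<Longrightarrow> smooth (\<lambda>x. f x + g x)"
| mult: "\<lbrakk>smooth f; smooth g\<rbrakk> \<Longrightarrow> smooth (\<lambda>x. f x * g x)"

lemma smooth_has_derivative:
  "smooth f \<Longrightarrow> \<exists>g. smooth g \<and> (\<forall>x. (f has_real_derivative g x) (at x))"
proof (induction rule: smooth.induct)
  case (flat P a b)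
  let ?Q = "[:0, 0, 1:] * (P - pderiv P)"
  have "((\<lambda>x. flat P (a * x + b)) has_real_derivative a * flat ?Q (a * x + b)) (at x)" for x
    by (rule DERIV_chain2[THEN DERIV_cong, OF flat_has_derivative])
      (auto intro!: derivative_eq_intros)
  then show ?case
    by (intro exI[of _ "\<lambda>x. a * flat ?Q (a * x + b)"] conjI smooth.intros) auto
next
  case (const c)
  show ?case by (intro exI[of _ "\<lambda>x. 0"] conjI smooth.intros) auto
next
  case (add f g)
  then obtain f' g' where "smooth f'" "\<And>x. (f has_real_derivative f' x) (at x)"
    "smooth g'" "\<And>x. (g has_real_derivative g' x) (at x)" by blast
  then show ?case
    by (intro exI[of _ "\<lambda>x. f' x + g' x"] conjI smooth.intros allI derivative_intros)
next
  case (mult f g)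
  then obtain f' g' where "smooth f'" "\<And>x. (f has_real_derivative f' x) (at x)"
    "smooth g'" "\<And>x. (g has_real_derivative g' x) (at x)" by blast
  with mult show ?case
    by (intro exI[of _ "\<lambda>x. f' x * g x + g' x * f x"] conjI smooth.intros allI)
      (auto intro!: derivative_eq_intros)
qed

lemma smooth_iterated_deriv: "smooth f \<Longrightarrow> (deriv ^^ n) f field_differentiable at x"
proof (induction n arbitrary: f)
  case 0
  then show ?case
    using smooth_has_derivative field_differentiable_def by fastforce
next
  case (Suc n)
  obtain g where g: "smooth g" "\<And>x. (f has_real_derivative g x) (at x)"
    using smooth_has_derivative[OF Suc.prems] by blast
  have "deriv f = g" using g(2) by (auto simp: fun_eq_iff intro: DERIV_imp_deriv)
  with Suc.IH[OF g(1)] show ?case by (simp add: funpow_swap1)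
qed

lemma smooth_continuous: "smooth f \<Longrightarrow> continuous_on S f"
  using smooth_has_derivative DERIV_isCont continuous_at_imp_continuous_on by metis

text \<open>Both ends of the support move: \<open>bump a n\<close> lives in \<open>(a/(n+2), a - a/(n+2))\<close> and tends to
  the indicator of \<open>(0,a)\<close>, so that \<open>a = L\<close> is allowed.\<close>

definition bump :: "real \<Rightarrow> nat \<Rightarrow> real \<Rightarrow> real" where
  "bump a n x = flat 1 (real (Suc n) * x + - (real (Suc n) * a / real (n + 2))) *
     flat 1 (- real (Suc n) * x + real (Suc n) * (a - a / real (n + 2)))"

lemma smooth_bump: "smooth (bump a n)"
  unfolding bump_def[abs_def] by (intro smooth.intros)

lemma flat_1_bounds: "0 \<le> flat 1 t" "flat 1 t \<le> 1"
  by (auto simp: flat_def)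

lemma bump_bounds: "0 \<le> bump a n x" "bump a n x \<le> 1"
  by (auto simp: bump_def flat_1_bounds intro!: mult_le_one)

lemma bump_eq_0:
  assumes "x \<notin> {a / real (n + 2)<..<a - a / real (n + 2)}"
  shows "bump a n x = 0"
proof -
  have "x \<le> a / real (n + 2) \<or> x \<ge> a - a / real (n + 2)" using assms by auto
  then have "real (Suc n) * x \<le> real (Suc n) * (a / real (n + 2)) \<or>
      real (Suc n) * x \<ge> real (Suc n) * (a - a / real (n + 2))"
    by (meson mult_left_mono of_nat_0_le_iff)
  then have "flat 1 (real (Suc n) * x + - (real (Suc n) * a / real (n + 2))) = 0 \<or>
      flat 1 (- real (Suc n) * x + real (Suc n) * (a - a / real (n + 2))) = 0"
    by (auto simp: flat_def simp del: of_nat_Suc)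
  then show ?thesis
    unfolding bump_def by auto
qed

lemma bump_tendsto:
  assumes "a > 0"
  shows "(\<lambda>n. bump a n x) \<longlonglongrightarrow> indicator {0<..<a} x"
proof (cases "x \<in> {0<..<a}")
  case True
  have lim: "(\<lambda>n. flat 1 (u n)) \<longlonglongrightarrow> 1" if u: "filterlim u at_top sequentially" for u
  proof -
    have "(\<lambda>n. exp (- inverse (u n))) \<longlonglongrightarrow> exp (- 0)"
      by (intro tendsto_intros tendsto_inverse_0_at_top u)
    moreover have "\<forall>\<^sub>F n in sequentially. exp (- inverse (u n)) = flat 1 (u n)"
      using filterlim_at_top_dense[THEN iffD1, OF u, rule_format, of 0]
      by eventually_elim (simp add: flat_def inverse_eq_divide)
    ultimately show ?thesis by (simp add: tendsto_cong)
  qed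
  have at_top: "filterlim (\<lambda>n. real (Suc n) * y + - (real (Suc n) * a / real (n + 2))) at_top sequentially"
    if y: "y > 0" for y
  proof (rule filterlim_at_top_mono)
    show "filterlim (\<lambda>n. - a + y * real (Suc n)) at_top sequentially"
      by (intro filterlim_tendsto_add_at_top[OF tendsto_const]
          filterlim_tendsto_pos_mult_at_top[OF tendsto_const y]
          filterlim_compose[OF filterlim_real_sequentially filterlim_Suc])
    show "\<forall>\<^sub>F n in sequentially. - a + y * real (Suc n) \<le>
        real (Suc n) * y + - (real (Suc n) * a / real (n + 2))"
      using assms by (intro always_eventually) (auto simp: field_simps)
  qed
  have "(\<lambda>n. bump a n x) \<longlonglongrightarrow> 1 * 1"
    unfolding bump_def
  proof (intro tendsto_mult lim)
    show "filterlim (\<lambda>n. real (Suc n) * x + - (real (Suc n) * a / real (n + 2))) at_top sequentially"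
      using True by (intro at_top) auto
    have "- real (Suc n) * x + real (Suc n) * (a - a / real (n + 2)) =
        real (Suc n) * (a - x) + - (real (Suc n) * a / real (n + 2))" for n
      by (simp add: algebra_simps)
    then show "filterlim (\<lambda>n. - real (Suc n) * x + real (Suc n) * (a - a / real (n + 2))) at_top sequentially"
      using True at_top[of "a - x"] by simp
  qed
  with True show ?thesis by simp
next
  case False
  have "bump a n x = 0" for n
  proof (rule bump_eq_0)
    have "0 \<le> a / real (n + 2)" using assms by simp
    with False show "x \<notin> {a / real (n + 2)<..<a - a / real (n + 2)}" by auto
  qed
  with False show ?thesis by simp
qed

lemma test_functionI:
  assumes "\<And>x. (f has_real_derivative g x) (at x)" "smooth g"
    and "0 < a" "b < L" "\<And>x. x \<notin> {a..b} \<Longrightarrow> f x = 0"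
  shows "test_function L f"
proof -
  have "deriv f = g" using assms(1) by (auto simp: fun_eq_iff intro: DERIV_imp_deriv)
  then have "(deriv ^^ n) f field_differentiable at x" for n x
    using assms(1) smooth_iterated_deriv[OF assms(2)]
    by (cases n) (auto simp: funpow_swap1 field_differentiable_def)
  with assms(3-5) show ?thesis unfolding test_function_def by blast
qed

lemma bump_support:
  assumes "0 < a" "a \<le> L"
  shows "0 < a / real (n + 2)" "a - a / real (n + 2) < L"
proof -
  show "0 < a / real (n + 2)" using assms by simp
  then show "a - a / real (n + 2) < L" using assms by linarith
qed

lemma test_function_bump:
  assumes "0 < a" "a \<le> L"
  shows "test_function L (bump a n)"
proof -
  obtain g where g: "smooth g" "\<And>x. (bump a n has_real_derivative g x) (at x)"
    using smooth_has_derivative[OF smooth_bump] by blast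
  show ?thesis
    by (rule test_functionI[OF g(2,1) bump_support[OF assms, of n]]) (auto intro: bump_eq_0)
qed

section \<open>The fundamental lemma and the lemma of du Bois-Reymond\<close>

text \<open>Half-lines form an intersection-stable generator of the Borel sets.\<close>

lemma AE_eq_0_of_initial_integrals:
  fixes f :: "real \<Rightarrow> complex"
  assumes f: "integrable lborel f"
    and init: "\<And>a. set_lebesgue_integral lborel {..a} f = 0"
    and total: "integral\<^sup>L lborel f = 0"
  shows "AE x in lborel. f x = 0"
proof (rule sigma_finite_measure.density_zero[OF sigma_finite_lborel f])
  fix A :: "real set" assume "A \<in> sets lborel"
  then have A: "A \<in> sigma_sets UNIV (range atMost)"
    by (simp add: borel_eq_atMost)
  have stable: "Int_stable (range (atMost :: real \<Rightarrow> real set))"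
    by (auto simp: Int_stable_def Int_atMost)
  have sub: "range (atMost :: real \<Rightarrow> real set) \<subseteq> Pow UNIV" by simp
  have meas: "A \<in> sets lborel" if "A \<in> sigma_sets UNIV (range atMost)" for A :: "real set"
    using that by (simp add: borel_eq_atMost)
  have si: "set_integrable lborel A f" if "A \<in> sigma_sets UNIV (range atMost)" for A
    unfolding set_integrable_def using integrable_mult_indicator[OF meas[OF that] f] .
  from stable sub A show "set_lebesgue_integral lborel A f = 0"
  proof (induction A rule: sigma_sets_induct_disjoint)
    case (basic A)
    then show ?case using init by auto
  next
    case empty
    show ?case by (simp add: set_lebesgue_integral_def)
  next
    case (compl A)
    have "set_lebesgue_integral lborel UNIV f =
        set_lebesgue_integral lborel A f + set_lebesgue_integral lborel (UNIV - A) f"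
      using compl f
      by (subst set_integral_Un[symmetric])
        (auto intro!: si sigma_sets.Compl simp: Un_Diff_cancel)
    then show ?case
      using compl total by (simp add: set_lebesgue_integral_def)
  next
    case (union A)
    then have A: "A i \<in> sigma_sets UNIV (range atMost)" for i by blast
    have "set_lebesgue_integral lborel (\<Union>i. A i) f = (\<Sum>i. set_lebesgue_integral lborel (A i) f)"
      using union(1) meas[OF A] si[OF sigma_sets.Union[OF A]]
      by (intro lebesgue_integral_countable_add) (auto simp: disjoint_family_on_def)
    with union show ?case by simp
  qed
qed

abbreviation II :: "real \<Rightarrow> (real \<Rightarrow> complex) \<Rightarrow> complex" where
  "II L f \<equiv> (LINT x:{0<..<L}|lborel. f x)"

lemma set_integrable_mult_bounded:
  fixes w :: "real \<Rightarrow> complex"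
  assumes w: "set_integrable lborel {0<..<L} w"
    and g: "g \<in> borel_measurable lborel" "\<And>x. x \<in> {0<..<L} \<Longrightarrow> cmod (g x) \<le> C"
  shows "set_integrable lborel {0<..<L} (\<lambda>x. w x * g x)"
proof -
  have [measurable]: "(\<lambda>x. indicator {0<..<L} x *\<^sub>R w x) \<in> borel_measurable lborel"
    using w by (simp add: set_integrable_def borel_measurable_integrable)
  note [measurable] = g(1)
  have eq: "indicator {0<..<L} x *\<^sub>R (w x * g x) = (indicator {0<..<L} x *\<^sub>R w x) * g x" for x
    by simp
  have i: "integrable lborel (\<lambda>x. C *\<^sub>R norm (indicator {0<..<L} x *\<^sub>R w x))"
    using w by (intro integrable_scaleR_right integrable_norm) (simp add: set_integrable_def)
  show ?thesis
    unfolding set_integrable_def eq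
  proof (rule Bochner_Integration.integrable_bound[OF i])
    show "AE x in lborel. norm (indicator {0<..<L} x *\<^sub>R w x * g x) \<le>
        norm (C *\<^sub>R norm (indicator {0<..<L} x *\<^sub>R w x))"
    proof (rule AE_I2)
      fix x :: real
      show "norm (indicator {0<..<L} x *\<^sub>R w x * g x) \<le>
          norm (C *\<^sub>R norm (indicator {0<..<L} x *\<^sub>R w x))"
      proof (cases "x \<in> {0<..<L}")
        case True
        then have "cmod (g x) \<le> \<bar>C\<bar>" using g(2)[of x] by simp
        with True show ?thesis
          by (simp add: norm_mult abs_mult mult.commute mult_right_mono)
      qed simp
    qed
  qed measurable
qed

lemma smooth_measurable: "smooth f \<Longrightarrow> f \<in> borel_measurable borel"
  by (intro borel_measurable_continuous_onI smooth_continuous)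

text \<open>Dominated convergence along bumps gives \<open>\<integral>\<^sub>0\<^sup>a w = 0\<close> for every \<open>a\<close>.\<close>

lemma fundamental_lemma:
  fixes w :: "real \<Rightarrow> complex"
  assumes L: "L > 0" and w: "set_integrable lborel {0<..<L} w"
    and zero: "\<And>a n. \<lbrakk>0 < a; a \<le> L\<rbrakk> \<Longrightarrow> II L (\<lambda>x. w x * complex_of_real (bump a n x)) = 0"
  shows "AE x in lborel. x \<in> {0<..<L} \<longrightarrow> w x = 0"
proof -
  define f where "f x = indicator {0<..<L} x *\<^sub>R w x" for x
  have f: "integrable lborel f" using w by (simp add: f_def[abs_def] set_integrable_def)
  note [measurable] = smooth_measurable[OF smooth_bump]
  have [measurable]: "f \<in> borel_measurable lborel" using f by auto
  have init: "set_lebesgue_integral lborel {0<..<a} f = 0" if a: "0 < a" "a \<le> L" for a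
  proof -
    have "(\<lambda>n. LINT x|lborel. bump a n x *\<^sub>R f x) \<longlonglongrightarrow> (LINT x|lborel. indicator {0<..<a} x *\<^sub>R f x)"
    proof (rule integral_dominated_convergence[where w="\<lambda>x. norm (f x)"])
      show "AE x in lborel. (\<lambda>n. bump a n x *\<^sub>R f x) \<longlonglongrightarrow> indicator {0<..<a} x *\<^sub>R f x"
        by (intro AE_I2 tendsto_intros bump_tendsto a)
      show "AE x in lborel. norm (bump a n x *\<^sub>R f x) \<le> norm (f x)" for n
        by (intro AE_I2) (simp add: bump_bounds abs_of_nonneg mult_left_le_one_le)
    qed (use f in auto)
    moreover have "(LINT x|lborel. bump a n x *\<^sub>R f x) = 0" for n
    proof -
      have "(LINT x|lborel. bump a n x *\<^sub>R f x) = II L (\<lambda>x. w x * complex_of_real (bump a n x))"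
        unfolding set_lebesgue_integral_def f_def
        by (intro Bochner_Integration.integral_cong) (auto simp: scaleR_conv_of_real mult_ac)
      with zero[OF a] show ?thesis by simp
    qed
    ultimately show ?thesis
      by (simp add: set_lebesgue_integral_def LIMSEQ_const_iff)
  qed
  have supp: "f x = 0" if "x \<notin> {0<..<L}" for x using that by (simp add: f_def)
  have total: "integral\<^sup>L lborel f = 0"
  proof -
    have "integral\<^sup>L lborel f = set_lebesgue_integral lborel {0<..<L} f"
      unfolding set_lebesgue_integral_def
      by (intro Bochner_Integration.integral_cong) (auto simp: indicator_def supp)
    with init[of L] L show ?thesis by simp
  qed
  have "AE x in lborel. f x = 0"
  proof (rule AE_eq_0_of_initial_integrals[OF f _ total])
    fix a
    consider "a \<le> 0" | "0 < a" "a \<le> L" | "L < a" by linarith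
    then show "set_lebesgue_integral lborel {..a} f = 0"
    proof cases
      case 1
      then have "indicator {..a} x *\<^sub>R f x = 0" for x
        using supp[of x] by (auto simp: indicator_def)
      then show ?thesis unfolding set_lebesgue_integral_def by (simp only:) simp
    next
      case 2
      have "set_lebesgue_integral lborel {..a} f = set_lebesgue_integral lborel {0<..<a} f"
        unfolding set_lebesgue_integral_def
        by (intro integral_cong_AE) (use AE_lborel_singleton[of a] in
          \<open>auto elim!: eventually_mono simp: indicator_def supp\<close>)
      with init 2 show ?thesis by simp
    next
      case 3
      have "set_lebesgue_integral lborel {..a} f = integral\<^sup>L lborel f"
        unfolding set_lebesgue_integral_def
        by (intro Bochner_Integration.integral_cong) (use 3 in \<open>auto simp: indicator_def supp\<close>)
      with total show ?thesis by simp
    qed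
  qed
  then show ?thesis
    by (auto elim!: eventually_mono simp: f_def)
qed

text \<open>For \<open>h\<close> a bump, \<open>h\<close> minus the multiple of a fixed bump with the same integral is the
  derivative of a test function. So orthogonality to all derivatives says that \<open>w - c\<close> is
  orthogonal to every bump, for one constant \<open>c\<close>.\<close>

lemma du_Bois_Reymond:
  fixes w :: "real \<Rightarrow> complex"
  assumes L: "L > 0" and w: "set_integrable lborel {0<..<L} w"
    and zero: "\<And>\<phi>. test_function L \<phi> \<Longrightarrow> II L (\<lambda>x. w x * complex_of_real (deriv \<phi> x)) = 0"
  shows "\<exists>c. AE x in lborel. x \<in> {0<..<L} \<longrightarrow> w x = c"
proof -
  have cont: "continuous_on S (bump a n)" for S a n
    by (intro smooth_continuous smooth_bump)
  define J where "J f = integral {0..L} f" for f :: "real \<Rightarrow> real"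
  define \<eta> where "\<eta> = bump L 1"
  have int: "(bump a n) integrable_on {c..d}" for a n c d
    by (intro integrable_continuous_interval cont)
  have J\<eta>: "J \<eta> > 0"
  proof -
    have "\<eta> (L/2) > 0"
      using L by (simp add: \<eta>_def bump_def flat_def field_simps)
    have "J \<eta> \<noteq> 0"
    proof
      assume "J \<eta> = 0"
      then have "(\<eta> has_integral 0) (cbox 0 L)"
        using int[of L 1 0 L] by (simp add: J_def \<eta>_def has_integral_integral)
      then have "\<eta> (L/2) = 0"
        using has_integral_0_cbox_imp_0[of 0 L \<eta> "L/2"] L cont
        by (auto simp: \<eta>_def bump_bounds)
      with \<open>\<eta> (L/2) > 0\<close> show False by simp
    qed
    moreover have "J \<eta> \<ge> 0"
      unfolding J_def \<eta>_def by (intro integral_nonneg int) (auto simp: bump_bounds)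
    ultimately show ?thesis by simp
  qed
  define c where "c = II L (\<lambda>x. w x * complex_of_real (\<eta> x)) / complex_of_real (J \<eta>)"
  have wb: "set_integrable lborel {0<..<L} (\<lambda>x. w x * complex_of_real (bump a n x))" for a n
    by (rule set_integrable_mult_bounded[OF w, of _ 1])
      (auto simp: bump_bounds abs_of_nonneg intro!: measurable_compose[OF smooth_measurable[OF smooth_bump] borel_measurable_of_real])
  have one: "set_integrable lborel {0<..<L} (\<lambda>x. c)" for c :: complex
    using L by (auto simp: set_integrable_def intro!: integrable_real_indicator integrable_scaleR_left)
  have bint: "II L (\<lambda>x. complex_of_real (bump a n x)) = complex_of_real (J (bump a n))" for a n
  proof -
    have "set_integrable lborel {0..L} (bump a n)"
      using cont by (intro borel_integrable_atLeastAtMost') auto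
    then have si: "set_integrable lborel {0<..<L} (bump a n)"
      by (rule set_integrable_subset) auto
    have "II L (\<lambda>x. complex_of_real (bump a n x)) =
        complex_of_real (LINT x:{0<..<L}|lborel. bump a n x)"
      by (rule set_integral_complex_of_real)
    also have "(LINT x:{0<..<L}|lborel. bump a n x) = integral {0<..<L} (bump a n)"
      by (rule set_borel_integral_eq_integral[OF si])
    also have "\<dots> = J (bump a n)"
      unfolding J_def by (rule integral_open_interval_real[symmetric])
    finally show ?thesis .
  qed
  have "AE x in lborel. x \<in> {0<..<L} \<longrightarrow> w x - c = 0"
  proof (rule fundamental_lemma[OF L])
    show wc: "set_integrable lborel {0<..<L} (\<lambda>x. w x - c)"
      by (intro set_integral_diff w one)
    fix a n assume a: "0 < a" "a \<le> (L::real)"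
    define r where "r = J (bump a n) / J \<eta>"
    define k where "k x = bump a n x + (- r) * \<eta> x" for x
    have k: "smooth k"
      unfolding k_def[abs_def] \<eta>_def by (intro smooth.intros smooth_bump)
    have contk: "continuous_on S k" for S by (intro smooth_continuous k)
    define \<alpha> where "\<alpha> = min (a / real (n + 2)) (L / 3)"
    define \<beta> where "\<beta> = max (a - a / real (n + 2)) (L - L / 3)"
    have \<alpha>\<beta>: "0 < \<alpha>" "\<alpha> \<le> \<beta>" "\<beta> < L"
      using bump_support[OF a, of n] L by (auto simp: \<alpha>_def \<beta>_def)
    have k0: "k x = 0" if "x \<notin> {\<alpha>..\<beta>}" for x
    proof -
      have "bump a n x = 0" using that by (intro bump_eq_0) (auto simp: \<alpha>_def \<beta>_def)
      moreover have "\<eta> x = 0"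
        unfolding \<eta>_def using that by (intro bump_eq_0) (auto simp: \<alpha>_def \<beta>_def)
      ultimately show ?thesis by (simp add: k_def)
    qed
    define \<phi> where "\<phi> x = integral {0..x} k" for x
    have \<phi>0: "\<phi> x = 0" if "x < \<alpha>" for x
    proof -
      have "\<phi> x = integral {0..x} (\<lambda>x. 0)"
        unfolding \<phi>_def using that by (intro integral_cong k0) auto
      then show ?thesis by simp
    qed
    have Jk: "J k = 0"
    proof -
      have "J k = J (bump a n) + (- r) * J \<eta>"
        unfolding J_def k_def[abs_def]
        by (subst Henstock_Kurzweil_Integration.integral_add[OF int
              integrable_on_mult_right[OF int[of L 1, folded \<eta>_def]]])
          (simp only: Henstock_Kurzweil_Integration.integral_mult_right)
      then show ?thesis using J\<eta> by (simp add: r_def)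
    qed
    have \<phi>1: "\<phi> x = 0" if "x > \<beta>" for x
    proof -
      have kint: "k integrable_on {u..v}" for u v by (intro integrable_continuous_interval contk)
      have z: "integral {\<beta>'..y} k = 0" if "\<beta>' > \<beta>" for \<beta>' y
      proof -
        have "integral {\<beta>'..y} k = integral {\<beta>'..y} (\<lambda>x. 0)"
          using that by (intro integral_cong k0) auto
        then show ?thesis by simp
      qed
      have "\<phi> x + integral {x..max x L} k = integral {0..max x L} k"
        unfolding \<phi>_def using that \<alpha>\<beta>
        by (intro Henstock_Kurzweil_Integration.integral_combine kint) auto
      moreover have "J k + integral {L..max x L} k = integral {0..max x L} k"
        unfolding J_def using L
        by (intro Henstock_Kurzweil_Integration.integral_combine kint) auto
      ultimately show ?thesis using Jk z[of x] z[of L] that \<alpha>\<beta> by simp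
    qed
    have der: "(\<phi> has_real_derivative k x) (at x)" for x
    proof (cases "x < \<alpha>")
      case True
      have "((\<lambda>_. 0) has_real_derivative 0) (at x)" by simp
      then have "(\<phi> has_real_derivative 0) (at x)"
        by (rule has_field_derivative_transform_within_open[where S="{..<\<alpha>}"])
          (use True \<phi>0 in auto)
      with True k0[of x] show ?thesis by simp
    next
      case False
      then have x: "0 < x" "x < x + 1" using \<alpha>\<beta> by auto
      have "(\<phi> has_real_derivative k x) (at x within {0..x+1})"
        unfolding \<phi>_def using x by (intro integral_has_real_derivative contk) auto
      with x show ?thesis by (simp add: at_within_Icc_at)
    qed
    have test: "test_function L \<phi>"
      by (rule test_functionI[OF der k \<alpha>\<beta>(1,3)]) (use \<phi>0 \<phi>1 in force)
    have "deriv \<phi> = k" using der by (auto simp: fun_eq_iff intro: DERIV_imp_deriv)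
    then have "0 = II L (\<lambda>x. w x * complex_of_real (k x))"
      using zero[OF test] by simp
    also have "\<dots> = II L (\<lambda>x. w x * complex_of_real (bump a n x) -
        complex_of_real r * (w x * complex_of_real (\<eta> x)))"
      by (intro set_lebesgue_integral_cong) (auto simp: k_def algebra_simps)
    also have "\<dots> = II L (\<lambda>x. w x * complex_of_real (bump a n x)) -
        complex_of_real r * II L (\<lambda>x. w x * complex_of_real (\<eta> x))"
      using wb by (subst set_integral_diff) (auto simp: \<eta>_def intro!: set_integrable_mult_right)
    also have "complex_of_real r * II L (\<lambda>x. w x * complex_of_real (\<eta> x)) =
        c * II L (\<lambda>x. complex_of_real (bump a n x))"
      using J\<eta> by (simp add: r_def c_def bint)
    finally have eq: "II L (\<lambda>x. w x * complex_of_real (bump a n x)) =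
        c * II L (\<lambda>x. complex_of_real (bump a n x))" by simp
    have cb: "set_integrable lborel {0<..<L} (\<lambda>x. c * complex_of_real (bump a n x))"
      by (rule set_integrable_mult_bounded[OF one, of _ 1])
        (auto simp: bump_bounds abs_of_nonneg intro!: measurable_compose[OF smooth_measurable[OF smooth_bump] borel_measurable_of_real])
    have "II L (\<lambda>x. (w x - c) * complex_of_real (bump a n x)) =
       II L (\<lambda>x. w x * complex_of_real (bump a n x) - c * complex_of_real (bump a n x))"
      by (intro set_lebesgue_integral_cong) (auto simp: algebra_simps)
    also have "\<dots> = 0"
      using eq by (subst set_integral_diff[OF wb cb]) simp
    finally show "II L (\<lambda>x. (w x - c) * complex_of_real (bump a n x)) = 0" .
  qed
  then show ?thesis
    by (intro exI[of _ c]) (auto elim: eventually_mono)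
qed

section \<open>Primitives of integrable functions\<close>

definition prim :: "(real \<Rightarrow> complex) \<Rightarrow> real \<Rightarrow> complex" where
  "prim f x = (LINT t:{0<..<x}|lborel. f t)"

lemma prim_0 [simp]: "prim f 0 = 0"
  by (simp add: prim_def set_lebesgue_integral_def)

lemma prim_cong_AE:
  assumes "AE t in lborel. t \<in> {0<..<L} \<longrightarrow> f t = g t" "x \<le> L"
    and "set_borel_measurable lborel {0<..<x} f" "set_borel_measurable lborel {0<..<x} g"
  shows "prim f x = prim g x"
  unfolding prim_def set_lebesgue_integral_def
  by (rule integral_cong_AE)
    (use assms in \<open>auto simp: set_borel_measurable_def indicator_def elim!: eventually_mono\<close>)

lemma set_integrable_initial:
  fixes f :: "real \<Rightarrow> complex"
  assumes "set_integrable lborel {0<..<L} f" "x \<le> L"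
  shows "set_integrable lborel {0<..<x} f"
  using assms by (intro set_integrable_subset[OF assms(1)]) auto

lemma prim_add:
  assumes "set_integrable lborel {0<..<L} f" "set_integrable lborel {0<..<L} g" "x \<le> L"
  shows "prim (\<lambda>t. f t + g t) x = prim f x + prim g x"
  unfolding prim_def by (intro set_integral_add set_integrable_initial[OF _ assms(3)] assms)

lemma prim_mult_left: "prim (\<lambda>t. c * f t) x = c * prim f x"
  unfolding prim_def by simp

lemma prim_eq_integral:
  assumes "set_integrable lborel {0<..<L} f" "x \<le> L"
  shows "prim f x = integral {0..x} f"
  unfolding prim_def using set_borel_integral_eq_integral(2)[OF set_integrable_initial[OF assms]]
  by (simp add: integral_open_interval_real)

lemma prim_continuous:
  assumes "set_integrable lborel {0<..<L} f"
  shows "continuous_on {0..L} (prim f)"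
proof -
  have "f integrable_on {0<..<L}"
    using assms by (rule set_borel_integral_eq_integral)
  then have "f integrable_on {0..L}"
    by (simp add: integrable_on_open_interval_real)
  then have "continuous_on {0..L} (\<lambda>x. integral {0..x} f)"
    by (rule indefinite_integral_continuous_1)
  then show ?thesis
    by (rule continuous_on_eq) (simp add: prim_eq_integral[OF assms])
qed

text \<open>Fubini's theorem on the square \<open>(0,x) \<times> (0,x)\<close>, cut along the diagonal.\<close>

lemma prim_mult:
  assumes f: "set_integrable lborel {0<..<L} f" and g: "set_integrable lborel {0<..<L} g"
    and x: "x \<le> L"
  shows "prim f x * prim g x = prim (\<lambda>s. f s * prim g s) x + prim (\<lambda>s. prim f s * g s) x"
proof -
  define F where "F s = indicator {0<..<x} s *\<^sub>R f s" for s
  define G where "G s = indicator {0<..<x} s *\<^sub>R g s" for s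
  have F: "integrable lborel F" and G: "integrable lborel G"
    using set_integrable_initial[OF f x] set_integrable_initial[OF g x]
    by (simp_all add: set_integrable_def F_def[abs_def] G_def[abs_def])
  have [measurable]: "F \<in> borel_measurable lborel" "G \<in> borel_measurable lborel"
    using F G by auto
  define h where "h p = F (fst p) * G (snd p)" for p
  have h: "integrable (lborel \<Otimes>\<^sub>M lborel) h"
  proof (rule lborel_pair.Fubini_integrable)
    show "h \<in> borel_measurable (lborel \<Otimes>\<^sub>M lborel)" unfolding h_def[abs_def] by measurable
    have "integrable lborel (\<lambda>s. norm (F s) * (\<integral>t. norm (G t) \<partial>lborel))"
      using F by (intro integrable_mult_left integrable_norm)
    then show "integrable lborel (\<lambda>s. \<integral>t. norm (h (s, t)) \<partial>lborel)"
      by (simp add: h_def norm_mult)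
    show "AE s in lborel. integrable lborel (\<lambda>t. h (s, t))"
      using G by (simp add: h_def)
  qed
  define A where "A = {p :: real \<times> real. snd p < fst p}"
  have A: "A \<in> sets (lborel \<Otimes>\<^sub>M lborel)" "- A \<in> sets (lborel \<Otimes>\<^sub>M lborel)"
    unfolding A_def lborel_prod sets_lborel
    by (simp_all add: Compl_eq not_less borel_open borel_closed open_Collect_less
        closed_Collect_le continuous_on_fst continuous_on_snd)
  have h1: "integrable (lborel \<Otimes>\<^sub>M lborel) (\<lambda>p. indicator A p *\<^sub>R h p)"
    and h2: "integrable (lborel \<Otimes>\<^sub>M lborel) (\<lambda>p. indicator (- A) p *\<^sub>R h p)"
    using integrable_mult_indicator[OF _ h] A by auto
  have "prim f x * prim g x = (\<integral>s. F s \<partial>lborel) * (\<integral>t. G t \<partial>lborel)"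
    by (simp add: prim_def set_lebesgue_integral_def F_def G_def)
  also have "\<dots> = (\<integral>s. (\<integral>t. h (s, t) \<partial>lborel) \<partial>lborel)"
    by (simp add: h_def)
  also have "\<dots> = integral\<^sup>L (lborel \<Otimes>\<^sub>M lborel) h"
    by (rule lborel_pair.integral_fst'[OF h])
  also have "\<dots> = integral\<^sup>L (lborel \<Otimes>\<^sub>M lborel) (\<lambda>p. indicator A p *\<^sub>R h p) +
      integral\<^sup>L (lborel \<Otimes>\<^sub>M lborel) (\<lambda>p. indicator (- A) p *\<^sub>R h p)"
    by (subst Bochner_Integration.integral_add[OF h1 h2, symmetric])
      (auto intro!: Bochner_Integration.integral_cong simp: indicator_def)
  also have "integral\<^sup>L (lborel \<Otimes>\<^sub>M lborel) (\<lambda>p. indicator A p *\<^sub>R h p) =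
      (\<integral>s. (\<integral>t. indicator A (s, t) *\<^sub>R h (s, t) \<partial>lborel) \<partial>lborel)"
    by (rule lborel_pair.integral_fst'[OF h1, symmetric])
  also have "\<dots> = prim (\<lambda>s. f s * prim g s) x"
    unfolding prim_def set_lebesgue_integral_def
  proof (rule Bochner_Integration.integral_cong[OF refl])
    fix s :: real
    have "(\<integral>t. indicator A (s, t) *\<^sub>R h (s, t) \<partial>lborel) =
        (\<integral>t. F s * (indicator {..<s} t *\<^sub>R G t) \<partial>lborel)"
      by (intro Bochner_Integration.integral_cong) (auto simp: A_def h_def indicator_def)
    also have "\<dots> = F s * (\<integral>t. indicator {..<s} t *\<^sub>R G t \<partial>lborel)"
      by (rule integral_mult_right_zero)
    also have "\<dots> = indicator {0<..<x} s *\<^sub>R (f s * (LINT t|lborel. indicator {0<..<s} t *\<^sub>R g t))"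
    proof (cases "s \<in> {0<..<x}")
      case True
      then have "indicator {..<s} t *\<^sub>R G t = indicator {0<..<s} t *\<^sub>R g t" for t
        by (auto simp: G_def indicator_def)
      with True show ?thesis by (simp add: F_def)
    qed (simp add: F_def)
    finally show "(\<integral>t. indicator A (s, t) *\<^sub>R h (s, t) \<partial>lborel) =
        indicator {0<..<x} s *\<^sub>R (f s * (LINT t|lborel. indicator {0<..<s} t *\<^sub>R g t))" .
  qed
  also have "integral\<^sup>L (lborel \<Otimes>\<^sub>M lborel) (\<lambda>p. indicator (- A) p *\<^sub>R h p) =
      (\<integral>t. (\<integral>s. indicator (- A) (s, t) *\<^sub>R h (s, t) \<partial>lborel) \<partial>lborel)"
    using lborel_pair.integral_snd[of "\<lambda>s t. indicator (- A) (s, t) *\<^sub>R h (s, t)"] h2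
    by (simp add: case_prod_unfold)
  also have "\<dots> = prim (\<lambda>s. prim f s * g s) x"
    unfolding prim_def set_lebesgue_integral_def
  proof (rule Bochner_Integration.integral_cong[OF refl])
    fix t :: real
    have "(\<integral>s. indicator (- A) (s, t) *\<^sub>R h (s, t) \<partial>lborel) =
        (\<integral>s. (indicator {..t} s *\<^sub>R F s) * G t \<partial>lborel)"
      by (intro Bochner_Integration.integral_cong) (auto simp: A_def h_def indicator_def)
    also have "\<dots> = (\<integral>s. indicator {..t} s *\<^sub>R F s \<partial>lborel) * G t"
      by (rule integral_mult_left_zero)
    also have "\<dots> = indicator {0<..<x} t *\<^sub>R ((LINT s|lborel. indicator {0<..<t} s *\<^sub>R f s) * g t)"
    proof (cases "t \<in> {0<..<x}")
      case True
      have "(\<integral>s. indicator {..t} s *\<^sub>R F s \<partial>lborel) = (\<integral>s. indicator {0<..<t} s *\<^sub>R F s \<partial>lborel)"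
      proof (rule integral_cong_AE)
        show "AE s in lborel. indicator {..t} s *\<^sub>R F s = indicator {0<..<t} s *\<^sub>R F s"
          using AE_lborel_singleton[of t] by (auto elim!: eventually_mono simp: F_def indicator_def)
      qed measurable
      also have "(\<lambda>s. indicator {0<..<t} s *\<^sub>R F s) = (\<lambda>s. indicator {0<..<t} s *\<^sub>R f s)"
        using True by (auto simp: F_def indicator_def)
      finally show ?thesis using True by (simp add: G_def)
    qed (simp add: G_def)
    finally show "(\<integral>s. indicator (- A) (s, t) *\<^sub>R h (s, t) \<partial>lborel) =
        indicator {0<..<x} t *\<^sub>R ((LINT s|lborel. indicator {0<..<t} s *\<^sub>R f s) * g t)" .
  qed
  finally show ?thesis .
qed

section \<open>The space of square-integrable functions\<close>

lemma rep_measurable [measurable]: "rep_lfun u \<in> borel_measurable borel"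
  using Quotient_rep_reflp[OF Quotient_lfun, of u] by simp

lemma rep_abs_AE: "f \<in> borel_measurable borel \<Longrightarrow> AE x in lborel. rep_lfun (abs_lfun f) x = f x"
  using Quotient3_rep_abs[OF Quotient3_lfun, of f] by simp

lemma lfun_eqI: "AE x in lborel. rep_lfun u x = rep_lfun v x \<Longrightarrow> u = v"
  using Quotient3_rel_rep[OF Quotient3_lfun, of u v] by simp

lemma rep_add: "AE x in lborel. rep_lfun (u + v) x = rep_lfun u x + rep_lfun v x"
  unfolding plus_lfun_def by (auto intro!: rep_abs_AE simp: comp_def)

lemma rep_scale: "AE x in lborel. rep_lfun (c *\<^sub>C u) x = c * rep_lfun u x"
  unfolding scaleC_lfun_def by (auto intro!: rep_abs_AE simp: comp_def)

lemma rep_diff: "AE x in lborel. rep_lfun (u - v) x = rep_lfun u x - rep_lfun v x"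
  unfolding minus_lfun_def by (auto intro!: rep_abs_AE simp: comp_def)

lemma rep_zero: "AE x in lborel. rep_lfun 0 x = 0"
  unfolding zero_lfun_def by (auto intro!: rep_abs_AE simp: comp_def)

text \<open>\<open>sqi\<close> is a condition on functions whose values outside \<open>(0,L)\<close> are irrelevant; \<open>mk\<close> passes
  to the class of the extension by zero.\<close>

definition sqi :: "real \<Rightarrow> (real \<Rightarrow> complex) \<Rightarrow> bool" where
  "sqi L f \<longleftrightarrow> set_borel_measurable lborel {0<..<L} f \<and>
     set_integrable lborel {0<..<L} (\<lambda>x. (cmod (f x))\<^sup>2)"

definition mk :: "real \<Rightarrow> (real \<Rightarrow> complex) \<Rightarrow> lfun" where
  "mk L f = abs_lfun (\<lambda>x. indicator {0<..<L} x *\<^sub>R f x)"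

lemma mk_rep_AE:
  assumes "sqi L f"
  shows "AE x in lborel. rep_lfun (mk L f) x = indicator {0<..<L} x *\<^sub>R f x"
  using assms unfolding mk_def sqi_def set_borel_measurable_def by (intro rep_abs_AE) simp

lemma mk_rep:
  assumes "sqi L f"
  shows "AE x in lborel. x \<in> {0<..<L} \<longrightarrow> rep_lfun (mk L f) x = f x"
  using mk_rep_AE[OF assms] by (auto elim!: eventually_mono)

lemma measurable_set_borel:
  fixes f :: "real \<Rightarrow> complex"
  assumes [measurable]: "f \<in> borel_measurable borel"
  shows "set_borel_measurable lborel {0<..<L::real} f"
  unfolding set_borel_measurable_def by measurable

lemma L2_sqi: "u \<in> L2 L \<Longrightarrow> sqi L (rep_lfun u)"
  by (auto simp: L2_def sqi_def intro: measurable_set_borel)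

lemma set_integrable_sq_cong:
  fixes f g :: "real \<Rightarrow> complex"
  assumes "AE x in lborel. x \<in> {0<..<L} \<longrightarrow> f x = g x"
    and "set_borel_measurable lborel {0<..<L} f" "sqi L g"
  shows "set_integrable lborel {0<..<L} (\<lambda>x. (cmod (f x))\<^sup>2)"
proof -
  have m: "(\<lambda>x. indicator {0<..<L} x *\<^sub>R (cmod (h x))\<^sup>2) \<in> borel_measurable lborel"
    if "set_borel_measurable lborel {0<..<L} h" for h :: "real \<Rightarrow> complex"
  proof -
    have eq: "indicator {0<..<L} x *\<^sub>R (cmod (h x))\<^sup>2 = (cmod (indicator {0<..<L} x *\<^sub>R h x))\<^sup>2" for x
      by (simp add: indicator_def)
    show ?thesis using that unfolding eq set_borel_measurable_def by measurable
  qed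
  have "integrable lborel (\<lambda>x. indicator {0<..<L} x *\<^sub>R (cmod (g x))\<^sup>2)"
    using assms(3) by (simp add: sqi_def set_integrable_def)
  then show ?thesis
    unfolding set_integrable_def
    by (rule integrable_cong_AE_imp[OF _ m[OF assms(2)]])
      (use assms(1) in \<open>auto elim!: eventually_mono simp: indicator_def\<close>)
qed

lemma mk_mem: "sqi L f \<Longrightarrow> mk L f \<in> L2 L"
  unfolding L2_def
proof (safe)
  assume f: "sqi L f"
  show "AE x in lborel. x \<notin> {0<..<L} \<longrightarrow> rep_lfun (mk L f) x = 0"
    using mk_rep_AE[OF f] by (auto elim!: eventually_mono)
  show "set_integrable lborel {0<..<L} (\<lambda>x. (cmod (rep_lfun (mk L f) x))\<^sup>2)"
    by (rule set_integrable_sq_cong[OF mk_rep[OF f] _ f]) (simp add: measurable_set_borel)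
qed

lemma L2_eqI:
  assumes "u \<in> L2 L" "v \<in> L2 L" "AE x in lborel. x \<in> {0<..<L} \<longrightarrow> rep_lfun u x = rep_lfun v x"
  shows "u = v"
proof (rule lfun_eqI)
  have "AE x in lborel. x \<notin> {0<..<L} \<longrightarrow> rep_lfun u x = 0"
    "AE x in lborel. x \<notin> {0<..<L} \<longrightarrow> rep_lfun v x = 0"
    using assms by (auto simp: L2_def)
  with assms(3) show "AE x in lborel. rep_lfun u x = rep_lfun v x"
    by eventually_elim auto
qed

lemma sqi_mult_integrable:
  assumes "sqi L f" "sqi L g"
  shows "set_integrable lborel {0<..<L} (\<lambda>x. f x * g x)"
proof -
  define F where "F x = indicator {0<..<L} x *\<^sub>R f x" for x
  define G where "G x = indicator {0<..<L} x *\<^sub>R g x" for x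
  have [measurable]: "F \<in> borel_measurable lborel" "G \<in> borel_measurable lborel"
    using assms by (simp_all add: sqi_def set_borel_measurable_def F_def[abs_def] G_def[abs_def])
  have eq: "indicator {0<..<L} x *\<^sub>R (f x * g x) = F x * G x" for x
    by (simp add: F_def G_def indicator_def)
  have "integrable lborel (\<lambda>x. indicator {0<..<L} x *\<^sub>R (cmod (f x))\<^sup>2 + indicator {0<..<L} x *\<^sub>R (cmod (g x))\<^sup>2)"
    using assms by (intro Bochner_Integration.integrable_add) (simp_all add: sqi_def set_integrable_def)
  then show ?thesis
    unfolding set_integrable_def eq
  proof (rule Bochner_Integration.integrable_bound)
    show "AE x in lborel. norm (F x * G x) \<le> norm (indicator {0<..<L} x *\<^sub>R (cmod (f x))\<^sup>2 +
        indicator {0<..<L} x *\<^sub>R (cmod (g x))\<^sup>2)"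
    proof (rule AE_I2)
      fix x
      have "2 * (cmod (f x) * cmod (g x)) \<le> (cmod (f x))\<^sup>2 + (cmod (g x))\<^sup>2"
        using sum_squares_bound[of "cmod (f x)" "cmod (g x)"] by simp
      moreover have "0 \<le> cmod (f x) * cmod (g x)" by simp
      ultimately have "cmod (f x) * cmod (g x) \<le> (cmod (f x))\<^sup>2 + (cmod (g x))\<^sup>2" by linarith
      then show "norm (F x * G x) \<le> norm (indicator {0<..<L} x *\<^sub>R (cmod (f x))\<^sup>2 +
        indicator {0<..<L} x *\<^sub>R (cmod (g x))\<^sup>2)"
        by (simp add: F_def G_def indicator_def norm_mult)
    qed
  qed measurable
qed

lemma sqi_add:
  assumes f: "sqi L f" and g: "sqi L g"
  shows "sqi L (\<lambda>x. f x + g x)"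
proof -
  have m: "set_borel_measurable lborel {0<..<L} (\<lambda>x. f x + g x)"
    using f g unfolding sqi_def set_borel_measurable_def scaleR_add_right
    by (intro borel_measurable_add) auto
  have eq: "indicator {0<..<L} x *\<^sub>R (cmod (f x + g x))\<^sup>2 =
      (cmod (indicator {0<..<L} x *\<^sub>R (f x + g x)))\<^sup>2" for x :: real
    by (simp add: indicator_def)
  have "integrable lborel (\<lambda>x. 2 * (indicator {0<..<L} x *\<^sub>R (cmod (f x))\<^sup>2) +
      2 * (indicator {0<..<L} x *\<^sub>R (cmod (g x))\<^sup>2))"
    using f g by (intro Bochner_Integration.integrable_add integrable_mult_right)
      (simp_all add: sqi_def set_integrable_def)
  then have "set_integrable lborel {0<..<L} (\<lambda>x. (cmod (f x + g x))\<^sup>2)"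
    unfolding set_integrable_def
  proof (rule Bochner_Integration.integrable_bound)
    show "(\<lambda>x. indicator {0<..<L} x *\<^sub>R (cmod (f x + g x))\<^sup>2) \<in> borel_measurable lborel"
      unfolding eq using m unfolding set_borel_measurable_def by measurable
    show "AE x in lborel. norm (indicator {0<..<L} x *\<^sub>R (cmod (f x + g x))\<^sup>2) \<le>
      norm (2 * (indicator {0<..<L} x *\<^sub>R (cmod (f x))\<^sup>2) + 2 * (indicator {0<..<L} x *\<^sub>R (cmod (g x))\<^sup>2))"
    proof (rule AE_I2)
      fix x
      have "(cmod (f x + g x))\<^sup>2 \<le> (cmod (f x) + cmod (g x))\<^sup>2"
        by (intro power_mono norm_triangle_ineq) auto
      also have "\<dots> \<le> 2 * (cmod (f x))\<^sup>2 + 2 * (cmod (g x))\<^sup>2"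
        using sum_squares_bound[of "cmod (f x)" "cmod (g x)"] by (simp add: power2_sum)
      finally show "norm (indicator {0<..<L} x *\<^sub>R (cmod (f x + g x))\<^sup>2) \<le>
        norm (2 * (indicator {0<..<L} x *\<^sub>R (cmod (f x))\<^sup>2) + 2 * (indicator {0<..<L} x *\<^sub>R (cmod (g x))\<^sup>2))"
        by (simp add: indicator_def)
    qed
  qed
  with m show ?thesis by (simp add: sqi_def)
qed

lemma sqi_bounded_mult:
  assumes f: "sqi L f" and g: "set_borel_measurable lborel {0<..<L} g"
    and bd: "\<And>x. x \<in> {0<..<L} \<Longrightarrow> cmod (g x) \<le> C"
  shows "sqi L (\<lambda>x. g x * f x)"
proof -
  have m: "set_borel_measurable lborel {0<..<L} (\<lambda>x. g x * f x)"
  proof -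
    have "(\<lambda>x. (indicator {0<..<L} x *\<^sub>R g x) * (indicator {0<..<L} x *\<^sub>R f x)) \<in> borel_measurable lborel"
      using f g unfolding sqi_def set_borel_measurable_def by (intro borel_measurable_times) auto
    moreover have "(indicator {0<..<L} x *\<^sub>R g x) * (indicator {0<..<L} x *\<^sub>R f x) =
        indicator {0<..<L} x *\<^sub>R (g x * f x)" for x by (simp add: indicator_def)
    ultimately show ?thesis unfolding set_borel_measurable_def by (simp only:)
  qed
  have eq: "indicator {0<..<L} x *\<^sub>R (cmod (g x * f x))\<^sup>2 =
      (cmod (indicator {0<..<L} x *\<^sub>R (g x * f x)))\<^sup>2" for x :: real
    by (simp add: indicator_def)
  have "integrable lborel (\<lambda>x. C\<^sup>2 * (indicator {0<..<L} x *\<^sub>R (cmod (f x))\<^sup>2))"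
    using f by (intro integrable_mult_right) (simp_all add: sqi_def set_integrable_def)
  then have "set_integrable lborel {0<..<L} (\<lambda>x. (cmod (g x * f x))\<^sup>2)"
    unfolding set_integrable_def
  proof (rule Bochner_Integration.integrable_bound)
    show "(\<lambda>x. indicator {0<..<L} x *\<^sub>R (cmod (g x * f x))\<^sup>2) \<in> borel_measurable lborel"
      unfolding eq using m unfolding set_borel_measurable_def by measurable
    show "AE x in lborel. norm (indicator {0<..<L} x *\<^sub>R (cmod (g x * f x))\<^sup>2) \<le>
      norm (C\<^sup>2 * (indicator {0<..<L} x *\<^sub>R (cmod (f x))\<^sup>2))"
    proof (rule AE_I2)
      fix x
      show "norm (indicator {0<..<L} x *\<^sub>R (cmod (g x * f x))\<^sup>2) \<le>
        norm (C\<^sup>2 * (indicator {0<..<L} x *\<^sub>R (cmod (f x))\<^sup>2))"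
      proof (cases "x \<in> {0<..<L}")
        case True
        then have "(cmod (g x))\<^sup>2 \<le> C\<^sup>2" using bd by (intro power_mono) auto
        with True show ?thesis
          by (simp add: norm_mult power_mult_distrib mult_right_mono)
      qed simp
    qed
  qed
  with m show ?thesis by (simp add: sqi_def)
qed

lemma sqi_scale: "sqi L f \<Longrightarrow> sqi L (\<lambda>x. c * f x)"
  by (rule sqi_bounded_mult[where C="cmod c"]) (auto intro: measurable_set_borel)

lemma sqi_const: "sqi L (\<lambda>x. c)"
proof -
  have "set_integrable lborel {0<..<L} (\<lambda>x. (cmod c)\<^sup>2)"
    by (cases "0 \<le> L") (auto simp: set_integrable_def intro!: integrable_scaleR_left integrable_real_indicator)
  then show ?thesis by (simp add: sqi_def measurable_set_borel)
qed

lemma continuous_set_borel_measurable: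
  fixes f :: "real \<Rightarrow> complex"
  assumes "continuous_on {0..L} f"
  shows "set_borel_measurable lborel {0<..<L} f"
  using borel_measurable_continuous_on_indicator[OF _ continuous_on_subset[OF assms], of "{0<..<L}"]
  by (simp add: set_borel_measurable_def greaterThanLessThan_subseteq_atLeastAtMost_iff)

lemma continuous_bounded_ex:
  fixes f :: "real \<Rightarrow> complex"
  assumes "continuous_on {0..L} f"
  obtains C where "\<And>x. x \<in> {0..L} \<Longrightarrow> cmod (f x) \<le> C"
proof -
  have "bounded (f ` {0..L})"
    using compact_continuous_image[OF assms] compact_imp_bounded by blast
  then obtain a where "\<And>x. x \<in> {0..L} \<Longrightarrow> cmod (f x) \<le> a"
    unfolding bounded_iff by blast
  then show ?thesis by (rule that)
qed

lemma sqi_continuous_mult: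
  assumes "continuous_on {0..L} g" "sqi L f"
  shows "sqi L (\<lambda>x. g x * f x)"
proof -
  obtain C where "\<And>x. x \<in> {0..L} \<Longrightarrow> cmod (g x) \<le> C"
    using continuous_bounded_ex[OF assms(1)] by blast
  then show ?thesis
    by (intro sqi_bounded_mult[where C=C] assms continuous_set_borel_measurable) auto
qed

lemma sqi_continuous: "continuous_on {0..L} f \<Longrightarrow> sqi L f"
  using sqi_continuous_mult[OF _ sqi_const[of L 1], of f] by simp

lemma sqi_integrable: "sqi L f \<Longrightarrow> set_integrable lborel {0<..<L} f"
  using sqi_mult_integrable[OF _ sqi_const[of L 1], of f] by simp

lemma sqi_cnj: "sqi L f \<Longrightarrow> sqi L (\<lambda>x. cnj (f x))"
proof -
  assume f: "sqi L f"
  have "(\<lambda>x. cnj (indicator {0<..<L} x *\<^sub>R f x)) \<in> borel_measurable lborel"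
    using f unfolding sqi_def set_borel_measurable_def
    by (intro borel_measurable_continuous_on[OF continuous_on_cnj[OF continuous_on_id]]) auto
  then show ?thesis
    using f by (simp add: sqi_def set_borel_measurable_def)
qed

lemma rep_integrable: "u \<in> L2 L \<Longrightarrow> set_integrable lborel {0<..<L} (rep_lfun u)"
  by (intro sqi_integrable L2_sqi)

lemma II_cong_AE:
  assumes "AE x in lborel. x \<in> {0<..<L} \<longrightarrow> f x = g x"
    and "set_borel_measurable lborel {0<..<L} f" "set_borel_measurable lborel {0<..<L} g"
  shows "II L f = II L g"
  using prim_cong_AE[OF assms(1) order_refl assms(2,3)] by (simp add: prim_def)

lemma set_integrable_measurable:
  "set_integrable lborel S (f :: real \<Rightarrow> complex) \<Longrightarrow> set_borel_measurable lborel S f"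
  unfolding set_integrable_def set_borel_measurable_def by auto

text \<open>The inner product may be computed from any representatives.\<close>

lemma inner_L2_eq:
  assumes u: "u \<in> L2 L" "AE x in lborel. x \<in> {0<..<L} \<longrightarrow> rep_lfun u x = f x" "sqi L f"
    and v: "v \<in> L2 L" "AE x in lborel. x \<in> {0<..<L} \<longrightarrow> rep_lfun v x = g x" "sqi L g"
  shows "inner_L2 L u v = II L (\<lambda>x. f x * cnj (g x))"
  unfolding inner_L2_def
proof (rule II_cong_AE)
  show "AE x in lborel. x \<in> {0<..<L} \<longrightarrow> rep_lfun u x * cnj (rep_lfun v x) = f x * cnj (g x)"
    using u(2) v(2) by eventually_elim auto
qed (intro set_integrable_measurable sqi_mult_integrable sqi_cnj L2_sqi u v)+

lemma csubspace_L2: "csubspace_on (L2 L)"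
proof
  have z: "mk L (\<lambda>x. 0) \<in> L2 L" by (intro mk_mem sqi_const)
  have "mk L (\<lambda>x. 0) = 0"
  proof (rule lfun_eqI)
    show "AE x in lborel. rep_lfun (mk L (\<lambda>x. 0)) x = rep_lfun 0 x"
      using mk_rep_AE[OF sqi_const[of L 0]] rep_zero by eventually_elim simp
  qed
  with z show "0 \<in> L2 L" by simp
next
  fix u v assume uv: "u \<in> L2 L" "v \<in> L2 L"
  have "mk L (\<lambda>x. rep_lfun u x + rep_lfun v x) = u + v"
  proof (rule lfun_eqI)
    have "AE x in lborel. x \<notin> {0<..<L} \<longrightarrow> rep_lfun u x = 0"
      "AE x in lborel. x \<notin> {0<..<L} \<longrightarrow> rep_lfun v x = 0"
      using uv by (auto simp: L2_def)
    with mk_rep_AE[OF sqi_add[OF L2_sqi[OF uv(1)] L2_sqi[OF uv(2)]]] rep_add[of u v]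
    show "AE x in lborel. rep_lfun (mk L (\<lambda>x. rep_lfun u x + rep_lfun v x)) x = rep_lfun (u + v) x"
      by eventually_elim (auto simp: indicator_def)
  qed
  then show "u + v \<in> L2 L" by (metis mk_mem sqi_add L2_sqi uv)
next
  fix u c assume u: "u \<in> L2 L"
  have "mk L (\<lambda>x. c * rep_lfun u x) = c *\<^sub>C u"
  proof (rule lfun_eqI)
    have "AE x in lborel. x \<notin> {0<..<L} \<longrightarrow> rep_lfun u x = 0"
      using u by (auto simp: L2_def)
    with mk_rep_AE[OF sqi_scale[OF L2_sqi[OF u], of c]] rep_scale[of c u]
    show "AE x in lborel. rep_lfun (mk L (\<lambda>x. c * rep_lfun u x)) x = rep_lfun (c *\<^sub>C u) x"
      by eventually_elim (auto simp: indicator_def)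
  qed
  then show "c *\<^sub>C u \<in> L2 L" by (metis mk_mem sqi_scale L2_sqi u)
qed

lemma rep_add_on: "AE x in lborel. x \<in> {0<..<L} \<longrightarrow> rep_lfun (u + v) x = rep_lfun u x + rep_lfun v x"
  using rep_add[of u v] by (auto elim: eventually_mono)

lemma rep_scale_on: "AE x in lborel. x \<in> {0<..<L} \<longrightarrow> rep_lfun (c *\<^sub>C u) x = c * rep_lfun u x"
  using rep_scale[of c u] by (auto elim: eventually_mono)

lemma rep_self: "AE x in lborel. x \<in> {0<..<L} \<longrightarrow> rep_lfun u x = rep_lfun u x"
  by simp

lemma inner_L2_self:
  assumes "u \<in> L2 L"
  shows "inner_L2 L u u = complex_of_real (LINT x:{0<..<L}|lborel. (cmod (rep_lfun u x))\<^sup>2)"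
  unfolding inner_L2_def set_integral_complex_of_real[symmetric]
  by (simp only: complex_norm_square)

lemma semi_inner_L2: "semi_inner (L2 L) (inner_L2 L)"
proof -
  interpret csubspace_on "L2 L" by (rule csubspace_L2)
  show ?thesis
  proof
    fix u v w assume m: "u \<in> L2 L" "v \<in> L2 L" "w \<in> L2 L"
    have "inner_L2 L (u + v) w = II L (\<lambda>x. (rep_lfun u x + rep_lfun v x) * cnj (rep_lfun w x))"
      by (intro inner_L2_eq rep_add_on rep_self sqi_add L2_sqi add_mem m)
    also have "\<dots> = inner_L2 L u w + inner_L2 L v w"
      unfolding inner_L2_def distrib_right
      by (intro set_integral_add sqi_mult_integrable sqi_cnj L2_sqi m)
    finally show "inner_L2 L (u + v) w = inner_L2 L u w + inner_L2 L v w" .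
  next
    fix u w c assume m: "u \<in> L2 L" "w \<in> L2 L"
    have "inner_L2 L (c *\<^sub>C u) w = II L (\<lambda>x. (c * rep_lfun u x) * cnj (rep_lfun w x))"
      by (intro inner_L2_eq rep_scale_on rep_self sqi_scale L2_sqi scale_mem m)
    then show "inner_L2 L (c *\<^sub>C u) w = c * inner_L2 L u w"
      by (simp add: inner_L2_def mult.assoc)
  next
    fix u v assume m: "u \<in> L2 L" "v \<in> L2 L"
    have "cnj (inner_L2 L u v) = II L (\<lambda>x. cnj (rep_lfun u x * cnj (rep_lfun v x)))"
      unfolding inner_L2_def set_lebesgue_integral_def
      by (rule trans[OF Bochner_Integration.integral_cnj[symmetric]]) (simp add: scaleR_conv_of_real del: Bochner_Integration.integral_cnj)
    then show "inner_L2 L v u = cnj (inner_L2 L u v)"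
      by (simp add: inner_L2_def mult.commute)
  next
    fix u assume u: "u \<in> L2 L"
    show "0 \<le> Re (inner_L2 L u u)"
      unfolding inner_L2_self[OF u] set_lebesgue_integral_def by simp
  qed
qed

interpretation L2: semi_inner "L2 L" "inner_L2 L" for L
  by (rule semi_inner_L2)

lemma L2_nrm_sq: "u \<in> L2 L \<Longrightarrow> (L2.nrm L u)\<^sup>2 = (LINT x:{0<..<L}|lborel. (cmod (rep_lfun u x))\<^sup>2)"
  by (simp add: L2.nrm_sq inner_L2_self)

lemma L2_nrm_eq_0:
  assumes u: "u \<in> L2 L" and z: "L2.nrm L u = 0"
  shows "u = 0"
proof (rule L2_eqI[OF u])
  have "(LINT x|lborel. indicator {0<..<L} x *\<^sub>R (cmod (rep_lfun u x))\<^sup>2) = 0"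
    using L2_nrm_sq[OF u] z by (simp add: set_lebesgue_integral_def)
  moreover have "integrable lborel (\<lambda>x. indicator {0<..<L} x *\<^sub>R (cmod (rep_lfun u x))\<^sup>2)"
    using L2_sqi[OF u] by (simp add: sqi_def set_integrable_def)
  ultimately have "AE x in lborel. indicator {0<..<L} x *\<^sub>R (cmod (rep_lfun u x))\<^sup>2 = 0"
    by (subst (asm) integral_nonneg_eq_0_iff_AE) auto
  with rep_zero show "AE x in lborel. x \<in> {0<..<L} \<longrightarrow> rep_lfun u x = rep_lfun 0 x"
    by eventually_elim auto
qed auto

section \<open>Completeness\<close>

lemma nn_integral_sq_dist:
  assumes u: "u \<in> L2 L" and v: "v \<in> L2 L"
  shows "(\<integral>\<^sup>+x. ennreal ((cmod (indicator {0<..<L} x *\<^sub>R rep_lfun u x - indicator {0<..<L} x *\<^sub>R rep_lfun v x))\<^sup>2) \<partial>lborel) =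
    ennreal ((L2.nrm L (u - v))\<^sup>2)"
proof -
  have uv: "u - v \<in> L2 L" using u v by simp
  have i: "integrable lborel (\<lambda>x. indicator {0<..<L} x *\<^sub>R (cmod (rep_lfun (u - v) x))\<^sup>2)"
    using L2_sqi[OF uv] by (simp add: sqi_def set_integrable_def)
  have "(\<integral>\<^sup>+x. ennreal ((cmod (indicator {0<..<L} x *\<^sub>R rep_lfun u x - indicator {0<..<L} x *\<^sub>R rep_lfun v x))\<^sup>2) \<partial>lborel) =
      (\<integral>\<^sup>+x. ennreal (indicator {0<..<L} x *\<^sub>R (cmod (rep_lfun (u - v) x))\<^sup>2) \<partial>lborel)"
    by (intro nn_integral_cong_AE)
      (use rep_diff[of u v] in \<open>auto elim!: eventually_mono simp: indicator_def\<close>)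
  also have "\<dots> = ennreal (LINT x|lborel. indicator {0<..<L} x *\<^sub>R (cmod (rep_lfun (u - v) x))\<^sup>2)"
    by (intro nn_integral_eq_integral i) auto
  finally show ?thesis
    by (simp add: L2_nrm_sq[OF uv] set_lebesgue_integral_def)
qed

text \<open>A subsequence with increments of norm at most \<open>4\<^sup>-\<^sup>k\<close> converges almost everywhere, since
  \<open>d \<le> 2\<^sup>k d\<^sup>2 + 2\<^sup>-\<^sup>k\<close> makes the increments summable; Fatou's lemma turns the pointwise limit
  into a limit in norm.\<close>

theorem L2_complete: "L2.complete_on L (L2 L)"
  unfolding L2.complete_on_def
proof (intro allI impI)
  fix s :: "nat \<Rightarrow> lfun"
  assume sm: "\<forall>n. s n \<in> L2 L"
    and Cau: "\<forall>e>0. \<exists>N. \<forall>m\<ge>N. \<forall>n\<ge>N. L2.nrm L (s m - s n) < e"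
  have "\<exists>N. \<forall>m\<ge>N. \<forall>n\<ge>N. L2.nrm L (s m - s n) < (1/4)^k" for k :: nat
    using Cau by simp
  then obtain N where N: "\<And>k m n. \<lbrakk>m \<ge> N k; n \<ge> N k\<rbrakk> \<Longrightarrow> L2.nrm L (s m - s n) < (1/4)^k"
    by metis
  define r where "r k = k + Max (N ` {..k})" for k
  have rN: "N k \<le> r k" "N k \<le> r (Suc k)" and rk: "k \<le> r k" for k
    unfolding r_def by (intro trans_le_add2 Max_ge; simp; fail)+ simp
  define g where "g n x = indicator {0<..<L} x *\<^sub>R rep_lfun (s n) x" for n x
  have [measurable]: "g n \<in> borel_measurable borel" for n
    unfolding g_def[abs_def] by measurable
  define d where "d k x = cmod (g (r (Suc k)) x - g (r k) x)" for k x
  have [measurable]: "d n \<in> borel_measurable borel" for n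
    unfolding d_def[abs_def] by measurable
  have dist: "(\<integral>\<^sup>+x. ennreal ((cmod (g m x - g n x))\<^sup>2) \<partial>lborel) = ennreal ((L2.nrm L (s m - s n))\<^sup>2)" for m n
    unfolding g_def using sm by (intro nn_integral_sq_dist) auto
  have int_d: "(\<integral>\<^sup>+x. ennreal (d k x) \<partial>lborel) \<le> ennreal ((1 + \<bar>L\<bar>) * (1/2)^k)" for k
  proof -
    have "(\<integral>\<^sup>+x. ennreal (d k x) \<partial>lborel) \<le>
        (\<integral>\<^sup>+x. ennreal (2^k) * ennreal ((d k x)\<^sup>2) + ennreal ((1/2)^k) * indicator {0<..<L} x \<partial>lborel)"
    proof (rule nn_integral_mono)
      fix x
      have d0: "d k x \<ge> 0" by (simp add: d_def)
      have "0 \<le> (2^k * d k x - 1)\<^sup>2" by simp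
      then have "2 * (2^k * d k x) \<le> (2^k * d k x)\<^sup>2 + 1" by (simp add: power2_diff)
      moreover have "0 \<le> 2^k * d k x" using d0 by simp
      ultimately have "2^k * d k x \<le> (2^k * d k x)\<^sup>2 + 1" by linarith
      then have "(1/2)^k * (2^k * d k x) \<le> (1/2)^k * ((2^k * d k x)\<^sup>2 + 1)"
        by (intro mult_left_mono) auto
      moreover have "(1/2)^k * (2^k * d k x) = d k x"
        by (simp add: power_one_over)
      moreover have "(1/2)^k * ((2^k * d k x)\<^sup>2 + 1) = 2^k * (d k x)\<^sup>2 + (1/2)^k"
        by (simp add: power_one_over power2_eq_square field_simps)
      ultimately have *: "d k x \<le> 2^k * (d k x)\<^sup>2 + (1/2)^k" by linarith
      show "ennreal (d k x) \<le>
          ennreal (2^k) * ennreal ((d k x)\<^sup>2) + ennreal ((1/2)^k) * indicator {0<..<L} x"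
      proof (cases "x \<in> {0<..<L}")
        case True
        have "ennreal (d k x) \<le> ennreal (2^k * (d k x)\<^sup>2 + (1/2)^k)"
          by (rule ennreal_leI[OF *])
        with True show ?thesis by (simp add: ennreal_plus ennreal_mult)
      qed (simp add: d_def g_def)
    qed
    also have "\<dots> = ennreal (2^k) * ennreal ((L2.nrm L (s (r (Suc k)) - s (r k)))\<^sup>2) +
        ennreal ((1/2)^k) * emeasure lborel {0<..<L}"
      by (subst nn_integral_add) (auto simp: nn_integral_cmult d_def dist)
    also have "\<dots> \<le> ennreal (2^k) * ennreal (((1/4)^k)\<^sup>2) + ennreal ((1/2)^k) * ennreal \<bar>L\<bar>"
    proof (intro add_mono mult_left_mono ennreal_leI power_mono)
      show "L2.nrm L (s (r (Suc k)) - s (r k)) \<le> (1/4)^k"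
        by (intro less_imp_le N rN)
      show "emeasure lborel {0<..<L} \<le> ennreal \<bar>L\<bar>"
        by (cases "0 \<le> L") auto
    qed (use sm in auto)
    also have "\<dots> = ennreal (2^k * ((1/4)^k)\<^sup>2 + (1/2)^k * \<bar>L\<bar>)"
      by (simp add: ennreal_mult ennreal_plus)
    also have "\<dots> \<le> ennreal ((1 + \<bar>L\<bar>) * (1/2)^k)"
    proof (rule ennreal_leI)
      have "2^k * ((1/4)^k)\<^sup>2 = ((1/8)::real)^k"
        by (simp add: power2_eq_square flip: power_mult_distrib)
      also have "\<dots> \<le> (1/2)^k" by (intro power_mono) auto
      finally show "2^k * ((1/4)^k)\<^sup>2 + (1/2)^k * \<bar>L\<bar> \<le> (1 + \<bar>L\<bar>) * (1/2)^k"
        by (simp add: algebra_simps)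
    qed
    finally show ?thesis .
  qed
  have "(\<integral>\<^sup>+x. (\<Sum>k. ennreal (d k x)) \<partial>lborel) = (\<Sum>k. \<integral>\<^sup>+x. ennreal (d k x) \<partial>lborel)"
    by (intro nn_integral_suminf) measurable
  also have "\<dots> \<le> (\<Sum>k. ennreal ((1 + \<bar>L\<bar>) * (1/2)^k))"
    by (intro suminf_le int_d summableI)
  also have "\<dots> < \<infinity>"
  proof -
    have "summable (\<lambda>k. (1 + \<bar>L\<bar>) * (1/2)^k)"
      by (intro summable_mult summable_geometric) auto
    then have "(\<Sum>k. ennreal ((1 + \<bar>L\<bar>) * (1/2)^k)) = ennreal (\<Sum>k. (1 + \<bar>L\<bar>) * (1/2)^k)"
      by (intro suminf_ennreal2) auto
    then show ?thesis by simp
  qed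
  finally have fin: "(\<integral>\<^sup>+x. (\<Sum>k. ennreal (d k x)) \<partial>lborel) \<noteq> \<infinity>" by simp
  have "AE x in lborel. (\<Sum>k. ennreal (d k x)) \<noteq> \<infinity>"
    by (rule nn_integral_PInf_AE[OF _ fin]) measurable
  then have conv: "AE x in lborel. convergent (\<lambda>k. g (r k) x)"
  proof eventually_elim
    case (elim x)
    have "summable (\<lambda>k. d k x)"
      by (rule summable_suminf_not_top) (use elim in \<open>auto simp: d_def\<close>)
    then have "summable (\<lambda>k. g (r (Suc k)) x - g (r k) x)"
      unfolding d_def by (rule summable_norm_cancel)
    then have "convergent (\<lambda>n. (\<Sum>k<n. g (r (Suc k)) x - g (r k) x))"
      by (simp add: summable_iff_convergent)
    then have "convergent (\<lambda>n. (\<Sum>k<n. g (r (Suc k)) x - g (r k) x) + g (r 0) x)"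
      by (intro convergent_add convergent_const)
    then show ?case
      by (simp add: sum_lessThan_telescope[of "\<lambda>k. g (r k) x"])
  qed
  define f where "f x = lim (\<lambda>k. g (r k) x)" for x
  have [measurable]: "f \<in> borel_measurable borel"
    unfolding f_def[abs_def] by (rule borel_measurable_lim_metric) measurable
  have lim: "AE x in lborel. (\<lambda>k. g (r k) x) \<longlonglongrightarrow> f x"
    using conv by eventually_elim (simp add: f_def convergent_LIMSEQ_iff)
  have est: "(\<integral>\<^sup>+x. ennreal ((cmod (f x - g n x))\<^sup>2) \<partial>lborel) \<le> ennreal (e\<^sup>2)"
    if "e > 0" "\<forall>m\<ge>M. L2.nrm L (s m - s n) < e" for e M n
  proof -
    have "(\<integral>\<^sup>+x. ennreal ((cmod (f x - g n x))\<^sup>2) \<partial>lborel) =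
        (\<integral>\<^sup>+x. liminf (\<lambda>k. ennreal ((cmod (g (r k) x - g n x))\<^sup>2)) \<partial>lborel)"
    proof (rule nn_integral_cong_AE)
      show "AE x in lborel. ennreal ((cmod (f x - g n x))\<^sup>2) =
          liminf (\<lambda>k. ennreal ((cmod (g (r k) x - g n x))\<^sup>2))"
        using lim
      proof eventually_elim
        case (elim x)
        have "(\<lambda>k. ennreal ((cmod (g (r k) x - g n x))\<^sup>2)) \<longlonglongrightarrow> ennreal ((cmod (f x - g n x))\<^sup>2)"
          by (intro tendsto_intros tendsto_ennrealI elim)
        then show ?case
          by (intro lim_imp_Liminf[symmetric]) auto
      qed
    qed
    also have "\<dots> \<le> liminf (\<lambda>k. \<integral>\<^sup>+x. ennreal ((cmod (g (r k) x - g n x))\<^sup>2) \<partial>lborel)"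
      by (intro nn_integral_liminf) measurable
    also have "\<dots> \<le> ennreal (e\<^sup>2)"
    proof (rule Liminf_le)
      have "\<forall>\<^sub>F k in sequentially. M \<le> k" by (rule eventually_ge_at_top)
      then show "\<forall>\<^sub>F k in sequentially. (\<integral>\<^sup>+x. ennreal ((cmod (g (r k) x - g n x))\<^sup>2) \<partial>lborel) \<le> ennreal (e\<^sup>2)"
      proof eventually_elim
        case (elim k)
        have "L2.nrm L (s (r k) - s n) \<le> e"
          using that(2) elim rk[of k] by (meson less_imp_le order_trans)
        then show ?case
          unfolding dist using sm by (intro ennreal_leI power_mono) auto
      qed
    qed simp
    finally show ?thesis .
  qed
  have sq_int: "integrable lborel (\<lambda>x. (cmod (f x - g n x))\<^sup>2)"
    if "(\<integral>\<^sup>+x. ennreal ((cmod (f x - g n x))\<^sup>2) \<partial>lborel) \<le> ennreal (e\<^sup>2)" for n e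
    by (rule integrableI_nonneg) (use that in \<open>auto simp: le_less_trans\<close>)
  have g_rep: "AE x in lborel. x \<in> {0<..<L} \<longrightarrow> g n x = rep_lfun (s n) x" for n
    by (simp add: g_def)
  obtain M where M: "\<forall>m\<ge>M. \<forall>n\<ge>M. L2.nrm L (s m - s n) < 1"
    using Cau by (meson zero_less_one)
  have sqi_diff: "sqi L (\<lambda>x. f x - g n x)" if "integrable lborel (\<lambda>x. (cmod (f x - g n x))\<^sup>2)" for n
  proof -
    have "set_integrable lborel {0<..<L} (\<lambda>x. (cmod (f x - g n x))\<^sup>2)"
      unfolding set_integrable_def by (rule integrable_mult_indicator[OF _ that]) simp
    moreover have "set_borel_measurable lborel {0<..<L} (\<lambda>x. f x - g n x)"
      by (intro measurable_set_borel) measurable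
    ultimately show ?thesis by (simp add: sqi_def)
  qed
  have sqi_g: "sqi L (g n)" for n
  proof -
    have "set_integrable lborel {0<..<L} (\<lambda>x. (cmod (g n x))\<^sup>2)"
      by (rule set_integrable_sq_cong[OF g_rep]) (use sm in \<open>auto intro!: L2_sqi measurable_set_borel\<close>)
    then show ?thesis by (simp add: sqi_def measurable_set_borel)
  qed
  have sqi_f: "sqi L f"
    using sqi_add[OF sqi_diff[OF sq_int[OF est[of 1 M M]]] sqi_g[of M]] M by simp
  define u where "u = mk L f"
  have u: "u \<in> L2 L" unfolding u_def by (rule mk_mem[OF sqi_f])
  have "\<forall>\<^sub>F n in sequentially. L2.nrm L (s n - u) < e" if e: "e > 0" for e
  proof -
    obtain M where M: "\<forall>m\<ge>M. \<forall>n\<ge>M. L2.nrm L (s m - s n) < e/2"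
      using Cau e by (meson half_gt_zero)
    have "L2.nrm L (s n - u) < e" if n: "n \<ge> M" for n
    proof -
      have "ennreal ((L2.nrm L (u - s n))\<^sup>2) =
          (\<integral>\<^sup>+x. ennreal ((cmod (indicator {0<..<L} x *\<^sub>R rep_lfun u x - indicator {0<..<L} x *\<^sub>R rep_lfun (s n) x))\<^sup>2) \<partial>lborel)"
        using u sm by (intro nn_integral_sq_dist[symmetric]) auto
      also have "\<dots> \<le> (\<integral>\<^sup>+x. ennreal ((cmod (f x - g n x))\<^sup>2) \<partial>lborel)"
        by (intro nn_integral_mono_AE)
          (use mk_rep[OF sqi_f] in \<open>auto elim!: eventually_mono simp: g_def u_def indicator_def\<close>)
      also have "\<dots> \<le> ennreal ((e/2)\<^sup>2)"
        using e M n by (intro est[of _ M]) auto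
      finally have "(L2.nrm L (u - s n))\<^sup>2 \<le> (e/2)\<^sup>2" by simp
      then have "L2.nrm L (u - s n) \<le> e/2"
        by (rule power2_le_imp_le) (use e in simp)
      then show ?thesis
        using e L2.nrm_minus_commute[OF u, of "s n"] sm by simp
    qed
    then show ?thesis by (auto simp: eventually_sequentially)
  qed
  then have "(\<lambda>n. L2.nrm L (s n - u)) \<longlonglongrightarrow> 0"
    using u sm by (intro tendstoI) (simp add: dist_real_def)
  with u show "\<exists>u\<in>L2 L. (\<lambda>n. L2.nrm L (s n - u)) \<longlonglongrightarrow> 0" by blast
qed

section \<open>The Volterra operator and multiplication operators\<close>

locale interval =
  fixes L :: real
  assumes L_pos: "0 < L"
begin

abbreviation "ip \<equiv> inner_L2 L"
abbreviation "nm \<equiv> L2.nrm L"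

definition one :: lfun where
  "one = mk L (\<lambda>_. 1)"

definition J :: "lfun \<Rightarrow> lfun" where
  "J u = mk L (prim (rep_lfun u))"

definition Mul :: "(real \<Rightarrow> real) \<Rightarrow> lfun \<Rightarrow> lfun" where
  "Mul r u = mk L (\<lambda>x. complex_of_real (r x) * rep_lfun u x)"

text \<open>The total integral over \<open>(0,L)\<close>, that is, the trace of \<open>J u\<close> at \<open>L\<close>.\<close>

definition ev :: "lfun \<Rightarrow> complex" where
  "ev u = prim (rep_lfun u) L"

text \<open>The absolutely continuous function with value \<open>k\<close> at \<open>0\<close> and derivative \<open>u\<close>.\<close>

definition aff :: "complex \<Rightarrow> lfun \<Rightarrow> lfun" where
  "aff k u = k *\<^sub>C one + J u"

lemma sqi_prim: "u \<in> L2 L \<Longrightarrow> sqi L (prim (rep_lfun u))"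
  by (intro sqi_continuous prim_continuous rep_integrable)

lemma one_mem [simp, intro]: "one \<in> L2 L"
  unfolding one_def by (intro mk_mem sqi_const)

lemma one_rep: "AE x in lborel. x \<in> {0<..<L} \<longrightarrow> rep_lfun one x = 1"
  unfolding one_def by (rule mk_rep[OF sqi_const])

lemma J_mem [simp, intro]: "u \<in> L2 L \<Longrightarrow> J u \<in> L2 L"
  unfolding J_def by (intro mk_mem sqi_prim)

lemma J_rep: "u \<in> L2 L \<Longrightarrow> AE x in lborel. x \<in> {0<..<L} \<longrightarrow> rep_lfun (J u) x = prim (rep_lfun u) x"
  unfolding J_def by (intro mk_rep sqi_prim)

lemma sqi_Mul: "\<lbrakk>continuous_on {0..L} r; u \<in> L2 L\<rbrakk> \<Longrightarrow> sqi L (\<lambda>x. complex_of_real (r x) * rep_lfun u x)"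
  by (intro sqi_continuous_mult continuous_on_of_real L2_sqi)

lemma Mul_mem [simp, intro]: "\<lbrakk>continuous_on {0..L} r; u \<in> L2 L\<rbrakk> \<Longrightarrow> Mul r u \<in> L2 L"
  unfolding Mul_def by (intro mk_mem sqi_Mul)

lemma Mul_rep: "\<lbrakk>continuous_on {0..L} r; u \<in> L2 L\<rbrakk> \<Longrightarrow>
    AE x in lborel. x \<in> {0<..<L} \<longrightarrow> rep_lfun (Mul r u) x = complex_of_real (r x) * rep_lfun u x"
  unfolding Mul_def by (intro mk_rep sqi_Mul)

lemma prim_cong_rep:
  assumes "AE x in lborel. x \<in> {0<..<L} \<longrightarrow> rep_lfun u x = f x" "sqi L f" "x \<le> L"
  shows "prim (rep_lfun u) x = prim f x"
  by (rule prim_cong_AE[OF assms(1,3)])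
    (intro measurable_set_borel rep_measurable set_integrable_measurable
      set_integrable_initial[OF sqi_integrable[OF assms(2)] assms(3)])+

lemma prim_rep_add:
  "\<lbrakk>u \<in> L2 L; v \<in> L2 L; x \<le> L\<rbrakk> \<Longrightarrow> prim (rep_lfun (u + v)) x = prim (rep_lfun u) x + prim (rep_lfun v) x"
  by (subst prim_cong_rep[OF rep_add_on]) (auto intro!: sqi_add L2_sqi prim_add rep_integrable)

lemma prim_rep_scale:
  "\<lbrakk>u \<in> L2 L; x \<le> L\<rbrakk> \<Longrightarrow> prim (rep_lfun (c *\<^sub>C u)) x = c * prim (rep_lfun u) x"
  by (subst prim_cong_rep[OF rep_scale_on]) (auto intro!: sqi_scale L2_sqi simp: prim_mult_left)

lemma J_add: "\<lbrakk>u \<in> L2 L; v \<in> L2 L\<rbrakk> \<Longrightarrow> J (u + v) = J u + J v"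
proof (rule L2_eqI)
  assume uv: "u \<in> L2 L" "v \<in> L2 L"
  show "AE x in lborel. x \<in> {0<..<L} \<longrightarrow> rep_lfun (J (u + v)) x = rep_lfun (J u + J v) x"
    using J_rep[OF uv(1)] J_rep[OF uv(2)] J_rep[OF L2.add_mem[OF uv]] rep_add[of "J u" "J v"]
    by eventually_elim (auto simp: prim_rep_add uv)
qed auto

lemma J_scale: "u \<in> L2 L \<Longrightarrow> J (c *\<^sub>C u) = c *\<^sub>C J u"
proof (rule L2_eqI)
  assume u: "u \<in> L2 L"
  show "AE x in lborel. x \<in> {0<..<L} \<longrightarrow> rep_lfun (J (c *\<^sub>C u)) x = rep_lfun (c *\<^sub>C J u) x"
    using J_rep[OF u] J_rep[OF L2.scale_mem[OF u]] rep_scale[of c "J u"]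
    by eventually_elim (auto simp: prim_rep_scale u)
qed auto

lemma J_minus: "u \<in> L2 L \<Longrightarrow> J (- u) = - J u"
  using J_scale[of u "- 1"] by simp

lemma J_diff: "\<lbrakk>u \<in> L2 L; v \<in> L2 L\<rbrakk> \<Longrightarrow> J (u - v) = J u - J v"
  using J_add[of u "- v"] by (simp add: J_minus)

lemma J_zero [simp]: "J 0 = 0"
  using J_scale[of 0 0] by simp

lemma ev_eq_ip: "u \<in> L2 L \<Longrightarrow> ev u = ip u one"
  using inner_L2_eq[OF _ rep_self L2_sqi one_mem one_rep sqi_const, of u]
  by (simp add: ev_def prim_def)

lemma ev_add: "\<lbrakk>u \<in> L2 L; v \<in> L2 L\<rbrakk> \<Longrightarrow> ev (u + v) = ev u + ev v"
  and ev_scale: "u \<in> L2 L \<Longrightarrow> ev (c *\<^sub>C u) = c * ev u"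
  and ev_minus: "u \<in> L2 L \<Longrightarrow> ev (- u) = - ev u"
  and ev_diff: "\<lbrakk>u \<in> L2 L; v \<in> L2 L\<rbrakk> \<Longrightarrow> ev (u - v) = ev u - ev v"
  by (simp_all add: ev_eq_ip L2.ip_simps)

lemma ev_zero [simp]: "ev 0 = 0"
  by (simp add: ev_eq_ip)

lemma ev_bound: "u \<in> L2 L \<Longrightarrow> cmod (ev u) \<le> nm one * nm u"
  using L2.Cauchy_Schwarz[of u L one] by (simp add: ev_eq_ip mult.commute)

lemma ip_one_left: "u \<in> L2 L \<Longrightarrow> ip one u = cnj (ev u)"
  by (simp add: ev_eq_ip L2.ip_commute[of u L one])

lemma by_parts:
  assumes u: "u \<in> L2 L" and v: "v \<in> L2 L"
  shows "ip (J u) v + ip u (J v) = ev u * cnj (ev v)"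
proof -
  have cv: "set_integrable lborel {0<..<L} (\<lambda>x. cnj (rep_lfun v x))"
    by (intro sqi_integrable sqi_cnj L2_sqi v)
  have prim_cnj: "prim (\<lambda>x. cnj (rep_lfun v x)) x = cnj (prim (rep_lfun v) x)" for x
    unfolding prim_def set_lebesgue_integral_def
    by (rule trans[OF _ Bochner_Integration.integral_cnj])
      (simp add: scaleR_conv_of_real del: Bochner_Integration.integral_cnj)
  have "ev u * cnj (ev v) = prim (rep_lfun u) L * prim (\<lambda>x. cnj (rep_lfun v x)) L"
    by (simp add: ev_def prim_cnj)
  also have "\<dots> = II L (\<lambda>x. rep_lfun u x * cnj (prim (rep_lfun v) x)) +
      II L (\<lambda>x. prim (rep_lfun u) x * cnj (rep_lfun v x))"
    by (subst prim_mult[OF rep_integrable[OF u] cv order_refl]) (simp add: prim_def[of _ L] prim_cnj)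
  also have "II L (\<lambda>x. rep_lfun u x * cnj (prim (rep_lfun v) x)) = ip u (J v)"
    by (intro inner_L2_eq[symmetric] J_rep J_mem rep_self L2_sqi sqi_prim u v)
  also have "II L (\<lambda>x. prim (rep_lfun u) x * cnj (rep_lfun v x)) = ip (J u) v"
    by (intro inner_L2_eq[symmetric] J_rep J_mem rep_self L2_sqi sqi_prim u v)
  finally show ?thesis by simp
qed

text \<open>The adjoint of the Volterra operator is \<open>u \<mapsto> \<integral>\<^sub>x\<^sup>L u = ev u - J u\<close>.\<close>

lemma ip_J_right: "\<lbrakk>u \<in> L2 L; v \<in> L2 L\<rbrakk> \<Longrightarrow> ip u (J v) = ip (ev u *\<^sub>C one - J u) v"
  using by_parts[of u v] by (simp add: L2.ip_simps ip_one_left algebra_simps)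

lemma aff_mem [simp, intro]: "u \<in> L2 L \<Longrightarrow> aff k u \<in> L2 L"
  unfolding aff_def by auto

lemma aff_rep:
  assumes "u \<in> L2 L"
  shows "AE x in lborel. x \<in> {0<..<L} \<longrightarrow> rep_lfun (aff k u) x = k + prim (rep_lfun u) x"
  unfolding aff_def using J_rep[OF assms] one_rep rep_add[of "k *\<^sub>C one" "J u"] rep_scale[of k one]
  by eventually_elim auto

lemma sqi_aff: "u \<in> L2 L \<Longrightarrow> sqi L (\<lambda>x. k + prim (rep_lfun u) x)"
  by (intro sqi_add sqi_const sqi_prim)

lemma Mul_add: "\<lbrakk>continuous_on {0..L} r; u \<in> L2 L; v \<in> L2 L\<rbrakk> \<Longrightarrow> Mul r (u + v) = Mul r u + Mul r v"
proof (rule L2_eqI)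
  assume uv: "continuous_on {0..L} r" "u \<in> L2 L" "v \<in> L2 L"
  show "AE x in lborel. x \<in> {0<..<L} \<longrightarrow> rep_lfun (Mul r (u + v)) x = rep_lfun (Mul r u + Mul r v) x"
    using Mul_rep[OF uv(1,2)] Mul_rep[OF uv(1,3)] Mul_rep[OF uv(1) L2.add_mem[OF uv(2,3)]]
      rep_add[of "Mul r u" "Mul r v"] rep_add[of u v]
    by eventually_elim (auto simp: algebra_simps)
qed auto

lemma Mul_scale: "\<lbrakk>continuous_on {0..L} r; u \<in> L2 L\<rbrakk> \<Longrightarrow> Mul r (c *\<^sub>C u) = c *\<^sub>C Mul r u"
proof (rule L2_eqI)
  assume u: "continuous_on {0..L} r" "u \<in> L2 L"
  show "AE x in lborel. x \<in> {0<..<L} \<longrightarrow> rep_lfun (Mul r (c *\<^sub>C u)) x = rep_lfun (c *\<^sub>C Mul r u) x"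
    using Mul_rep[OF u] Mul_rep[OF u(1) L2.scale_mem[OF u(2), of c]]
      rep_scale[of c "Mul r u"] rep_scale[of c u]
    by eventually_elim (auto simp: algebra_simps)
qed auto

lemma Mul_minus: "\<lbrakk>continuous_on {0..L} r; u \<in> L2 L\<rbrakk> \<Longrightarrow> Mul r (- u) = - Mul r u"
  using Mul_scale[of r u "- 1"] by simp

lemma Mul_cmult:
  assumes "continuous_on {0..L} r" "u \<in> L2 L"
  shows "Mul (\<lambda>x. c * r x) u = complex_of_real c *\<^sub>C Mul r u"
proof (rule L2_eqI)
  have c: "continuous_on {0..L} (\<lambda>x. c * r x)" by (intro continuous_intros assms)
  then show "Mul (\<lambda>x. c * r x) u \<in> L2 L" using assms by auto
  show "AE x in lborel. x \<in> {0<..<L} \<longrightarrow>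
      rep_lfun (Mul (\<lambda>x. c * r x) u) x = rep_lfun (complex_of_real c *\<^sub>C Mul r u) x"
    using Mul_rep[OF assms] Mul_rep[OF c assms(2)] rep_scale[of "complex_of_real c" "Mul r u"]
    by eventually_elim auto
qed (use assms in auto)

lemma ip_Mul_right:
  assumes "continuous_on {0..L} r" "u \<in> L2 L" "v \<in> L2 L"
  shows "ip u (Mul r v) = II L (\<lambda>x. complex_of_real (r x) * (rep_lfun u x * cnj (rep_lfun v x)))"
proof -
  have "ip u (Mul r v) = II L (\<lambda>x. rep_lfun u x * cnj (complex_of_real (r x) * rep_lfun v x))"
    by (intro inner_L2_eq Mul_rep Mul_mem rep_self L2_sqi sqi_Mul assms)
  then show ?thesis by (simp add: mult_ac)
qed

lemma Mul_symmetric: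
  assumes "continuous_on {0..L} r" "u \<in> L2 L" "v \<in> L2 L"
  shows "ip (Mul r u) v = ip u (Mul r v)"
proof -
  have "ip (Mul r u) v = II L (\<lambda>x. (complex_of_real (r x) * rep_lfun u x) * cnj (rep_lfun v x))"
    by (intro inner_L2_eq Mul_rep Mul_mem rep_self L2_sqi sqi_Mul assms)
  then show ?thesis using ip_Mul_right[OF assms] by (simp add: mult_ac)
qed

lemma ip_Mul_self:
  assumes "continuous_on {0..L} r" "u \<in> L2 L"
  shows "Re (ip u (Mul r u)) = (LINT x:{0<..<L}|lborel. r x * (cmod (rep_lfun u x))\<^sup>2)"
proof -
  have "ip u (Mul r u) = II L (\<lambda>x. complex_of_real (r x * (cmod (rep_lfun u x))\<^sup>2))"
    using ip_Mul_right[OF assms(1,2,2)]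
    by (simp only: of_real_mult complex_norm_square)
  also have "\<dots> = complex_of_real (LINT x:{0<..<L}|lborel. r x * (cmod (rep_lfun u x))\<^sup>2)"
    by (rule set_integral_complex_of_real)
  finally show ?thesis by simp
qed

lemma Mul_mono:
  assumes r: "continuous_on {0..L} r" "continuous_on {0..L} r'" and u: "u \<in> L2 L"
    and le: "\<And>x. x \<in> {0..L} \<Longrightarrow> r x \<le> r' x"
  shows "Re (ip u (Mul r u)) \<le> Re (ip u (Mul r' u))"
proof -
  have i: "set_integrable lborel {0<..<L} (\<lambda>x. r x * (cmod (rep_lfun u x))\<^sup>2)"
    if "continuous_on {0..L} r" for r
  proof -
    have "set_integrable lborel {0<..<L} (\<lambda>x. rep_lfun u x * cnj (complex_of_real (r x) * rep_lfun u x))"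
      by (intro sqi_mult_integrable sqi_cnj sqi_Mul that u L2_sqi)
    also have "(\<lambda>x. rep_lfun u x * cnj (complex_of_real (r x) * rep_lfun u x)) =
        (\<lambda>x. complex_of_real (r x * (cmod (rep_lfun u x))\<^sup>2))"
      by (simp only: of_real_mult complex_norm_square complex_cnj_mult complex_cnj_complex_of_real mult_ac)
    finally have "integrable lborel (\<lambda>x. complex_of_real (indicator {0<..<L} x *\<^sub>R (r x * (cmod (rep_lfun u x))\<^sup>2)))"
      by (simp add: set_integrable_def scaleR_conv_of_real)
    then show ?thesis unfolding set_integrable_def by (rule complex_of_real_integrable_eq[THEN iffD1])
  qed
  show ?thesis
    unfolding ip_Mul_self[OF r(1) u] ip_Mul_self[OF r(2) u]
    by (intro set_integral_mono i r mult_right_mono) (use le in auto)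
qed

lemma Mul_const_1: "u \<in> L2 L \<Longrightarrow> Mul (\<lambda>_. 1) u = u"
proof (rule L2_eqI)
  assume u: "u \<in> L2 L"
  show "AE x in lborel. x \<in> {0<..<L} \<longrightarrow> rep_lfun (Mul (\<lambda>_. 1) u) x = rep_lfun u x"
    using Mul_rep[OF continuous_on_const u, of 1] by eventually_elim auto
qed auto

text \<open>The product rule, in integrated form.\<close>

lemma Mul_aff:
  assumes der: "\<And>x. (r has_real_derivative r' x) (at x)" and cont': "continuous_on UNIV r'"
    and u: "u \<in> L2 L"
  shows "Mul r (aff k u) = aff (complex_of_real (r 0) * k) (Mul r' (aff k u) + Mul r u)"
    and "ev (Mul r' (aff k u) + Mul r u) =
      complex_of_real (r L) * (k + ev u) - complex_of_real (r 0) * k"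
proof -
  have cr: "continuous_on {0..L} r" and cr': "continuous_on {0..L} r'"
    by (rule continuous_at_imp_continuous_on, blast intro: DERIV_isCont der)
      (rule continuous_on_subset[OF cont'], simp)
  let ?U = "rep_lfun u"
  have i1: "sqi L (\<lambda>x. complex_of_real (r' x))"
    by (intro sqi_continuous continuous_on_of_real cr')
  have i2: "sqi L (\<lambda>x. complex_of_real (r' x) * (k + prim ?U x))"
    by (intro sqi_continuous_mult continuous_on_of_real cr' sqi_aff u)
  have i2': "sqi L (\<lambda>x. complex_of_real (r' x) * prim ?U x)"
    by (intro sqi_continuous_mult continuous_on_of_real cr' sqi_prim u)
  have i3: "sqi L (\<lambda>x. complex_of_real (r x) * ?U x)"
    by (rule sqi_Mul[OF cr u])
  have FTC: "prim (\<lambda>x. complex_of_real (r' x)) x = complex_of_real (r x - r 0)" if x: "x \<in> {0..L}" for x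
  proof -
    have "((\<lambda>x. complex_of_real (r' x)) has_integral complex_of_real (r x) - complex_of_real (r 0)) {0..x}"
      using x by (intro fundamental_theorem_of_calculus)
        (auto intro!: has_vector_derivative_of_real has_field_derivative_at_within der
          simp flip: has_real_derivative_iff_has_vector_derivative)
    then show ?thesis
      using prim_eq_integral[OF sqi_integrable[OF i1]] x by (simp add: integral_unique)
  qed
  have key: "complex_of_real (r x) * (k + prim ?U x) = complex_of_real (r 0) * k +
      prim (\<lambda>x. complex_of_real (r' x) * (k + prim ?U x) + complex_of_real (r x) * ?U x) x"
    if x: "x \<in> {0..L}" for x
  proof -
    have xL: "x \<le> L" using x by simp
    have "complex_of_real (r x - r 0) * prim ?U x =
        prim (\<lambda>s. complex_of_real (r' s) * prim ?U s) x +
        prim (\<lambda>s. prim (\<lambda>x. complex_of_real (r' x)) s * ?U s) x"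
      using prim_mult[OF sqi_integrable[OF i1] rep_integrable[OF u] xL] FTC[OF x] by simp
    also have "prim (\<lambda>s. prim (\<lambda>x. complex_of_real (r' x)) s * ?U s) x =
        prim (\<lambda>s. complex_of_real (r s) * ?U s + (- complex_of_real (r 0)) * ?U s) x"
      unfolding prim_def[of _ x]
      by (intro set_lebesgue_integral_cong) (use x in \<open>auto simp: FTC algebra_simps\<close>)
    also have "\<dots> = prim (\<lambda>s. complex_of_real (r s) * ?U s) x - complex_of_real (r 0) * prim ?U x"
      by (subst prim_add[OF sqi_integrable[OF i3] sqi_integrable[OF sqi_scale[OF L2_sqi[OF u]]] xL])
        (simp only: prim_mult_left, simp)
    finally have 1: "complex_of_real (r x) * prim ?U x =
        prim (\<lambda>s. complex_of_real (r' s) * prim ?U s) x + prim (\<lambda>s. complex_of_real (r s) * ?U s) x"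
      by (simp add: algebra_simps)
    have "prim (\<lambda>x. complex_of_real (r' x) * (k + prim ?U x) + complex_of_real (r x) * ?U x) x =
        prim (\<lambda>x. complex_of_real (r' x) * (k + prim ?U x)) x + prim (\<lambda>s. complex_of_real (r s) * ?U s) x"
      by (rule prim_add[OF sqi_integrable[OF i2] sqi_integrable[OF i3] xL])
    also have "prim (\<lambda>x. complex_of_real (r' x) * (k + prim ?U x)) x =
        prim (\<lambda>x. k * complex_of_real (r' x) + complex_of_real (r' x) * prim ?U x) x"
      by (simp add: algebra_simps)
    also have "\<dots> = k * complex_of_real (r x - r 0) + prim (\<lambda>s. complex_of_real (r' s) * prim ?U s) x"
      by (subst prim_add[OF sqi_integrable[OF sqi_scale[OF i1]] sqi_integrable[OF i2'] xL])
        (simp only: prim_mult_left FTC[OF x])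
    finally show ?thesis using 1 by (simp add: algebra_simps)
  qed
  let ?w = "Mul r' (aff k u) + Mul r u"
  have w: "?w \<in> L2 L" using cr cr' u by auto
  have w_rep: "AE x in lborel. x \<in> {0<..<L} \<longrightarrow>
      rep_lfun ?w x = complex_of_real (r' x) * (k + prim ?U x) + complex_of_real (r x) * ?U x"
    using Mul_rep[OF cr u] Mul_rep[OF cr' aff_mem[OF u, of k]] aff_rep[OF u, of k]
      rep_add[of "Mul r' (aff k u)" "Mul r u"]
    by eventually_elim auto
  have prim_w: "prim (rep_lfun ?w) x =
      prim (\<lambda>x. complex_of_real (r' x) * (k + prim ?U x) + complex_of_real (r x) * ?U x) x"
    if "x \<le> L" for x
    by (rule prim_cong_rep[OF w_rep _ that]) (intro sqi_add i2 i3)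
  show "Mul r (aff k u) = aff (complex_of_real (r 0) * k) ?w"
  proof (rule L2_eqI)
    show "AE x in lborel. x \<in> {0<..<L} \<longrightarrow>
        rep_lfun (Mul r (aff k u)) x = rep_lfun (aff (complex_of_real (r 0) * k) ?w) x"
      using Mul_rep[OF cr aff_mem[OF u, of k]] aff_rep[OF u, of k]
        aff_rep[OF w, of "complex_of_real (r 0) * k"]
      by eventually_elim (auto simp: key prim_w)
  qed (use cr u w in auto)
  show "ev ?w = complex_of_real (r L) * (k + ev u) - complex_of_real (r 0) * k"
    using key[of L] L_pos by (simp add: ev_def prim_w)
qed

text \<open>With \<open>U = aff k u\<close> this integrates \<open>(r |U|\<^sup>2)' = r' |U|\<^sup>2 + 2 r Re (U u)\<close>, the conjugate on \<open>u\<close>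
  understood. Every multiplier computation below is an instance.\<close>

lemma energy_identity:
  assumes der: "\<And>x. (r has_real_derivative r' x) (at x)" and cont': "continuous_on UNIV r'"
    and u: "u \<in> L2 L"
  shows "2 * Re (ip (aff k u) (Mul r u)) + Re (ip (aff k u) (Mul r' (aff k u))) =
    r L * (cmod (k + ev u))\<^sup>2 - r 0 * (cmod k)\<^sup>2"
proof -
  have cr: "continuous_on {0..L} r" and cr': "continuous_on {0..L} r'"
    by (rule continuous_at_imp_continuous_on, blast intro: DERIV_isCont der)
      (rule continuous_on_subset[OF cont'], simp)
  define U where "U = aff k u"
  define w where "w = Mul r' U + Mul r u"
  have mem: "U \<in> L2 L" "w \<in> L2 L" "Mul r u \<in> L2 L" "Mul r' U \<in> L2 L" "Mul r U \<in> L2 L"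
    using cr cr' u by (auto simp: U_def w_def)
  have Mw: "Mul r U = (complex_of_real (r 0) * k) *\<^sub>C one + J w"
    using Mul_aff(1)[OF der cont' u, of k] by (simp add: U_def w_def aff_def)
  have ew: "ev w = complex_of_real (r L) * (k + ev u) - complex_of_real (r 0) * k"
    using Mul_aff(2)[OF der cont' u, of k] by (simp add: U_def w_def)
  have "ip U w + ip u (J w) = (k + ev u) * cnj (ev w)"
    using by_parts[OF u mem(2)] mem u
    by (simp add: U_def aff_def L2.ip_simps ip_one_left algebra_simps)
  moreover have "ip U w = ip U (Mul r' U) + ip U (Mul r u)"
    using mem by (simp add: w_def L2.ip_simps)
  moreover have "ip u (J w) = ip u (Mul r U) - cnj (complex_of_real (r 0) * k) * ev u"
  proof -
    have "J w = Mul r U - (complex_of_real (r 0) * k) *\<^sub>C one" using Mw by simp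
    then show ?thesis
      using mem u by (simp only: L2.ip_diff_right L2.ip_scale_right one_mem L2.scale_mem ev_eq_ip)
  qed
  moreover have "ip u (Mul r U) = cnj (ip U (Mul r u))"
    using mem u cr by (simp add: Mul_symmetric L2.ip_commute[of U L "Mul r u", symmetric])
  ultimately have "ip U (Mul r' U) + ip U (Mul r u) + cnj (ip U (Mul r u)) =
      (k + ev u) * cnj (ev w) + cnj (complex_of_real (r 0) * k) * ev u"
    by (simp add: algebra_simps)
  also have "\<dots> = complex_of_real (r L) * ((k + ev u) * cnj (k + ev u)) - complex_of_real (r 0) * (k * cnj k)"
    by (simp add: ew algebra_simps)
  also have "\<dots> = complex_of_real (r L * (cmod (k + ev u))\<^sup>2 - r 0 * (cmod k)\<^sup>2)"
    by (simp only: complex_norm_square of_real_diff of_real_mult)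
  finally have "Re (ip U (Mul r' U) + ip U (Mul r u) + cnj (ip U (Mul r u))) =
      r L * (cmod (k + ev u))\<^sup>2 - r 0 * (cmod k)\<^sup>2"
    by (simp only: Re_complex_of_real)
  then show ?thesis by (simp add: U_def)
qed

lemma Mul_bound:
  assumes cr: "continuous_on {0..L} r" and u: "u \<in> L2 L"
    and C: "\<And>x. x \<in> {0..L} \<Longrightarrow> \<bar>r x\<bar> \<le> C"
  shows "nm (Mul r u) \<le> C * nm u"
proof -
  have C0: "C \<ge> 0" using C[of 0] L_pos by force
  have c2: "continuous_on {0..L} (\<lambda>x. r x * r x)" by (intro continuous_intros cr)
  have MM: "Mul r (Mul r u) = Mul (\<lambda>x. r x * r x) u"
  proof (rule L2_eqI)
    show "AE x in lborel. x \<in> {0<..<L} \<longrightarrow> rep_lfun (Mul r (Mul r u)) x = rep_lfun (Mul (\<lambda>x. r x * r x) u) x"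
      using Mul_rep[OF cr u] Mul_rep[OF cr Mul_mem[OF cr u]] Mul_rep[OF c2 u]
      by eventually_elim (auto simp: mult_ac)
  qed (use cr c2 u in auto)
  have "(nm (Mul r u))\<^sup>2 = Re (ip u (Mul (\<lambda>x. r x * r x) u))"
    using cr u by (simp add: L2.nrm_sq Mul_symmetric MM)
  also have "\<dots> \<le> Re (ip u (Mul (\<lambda>x. C\<^sup>2 * 1) u))"
  proof (intro Mul_mono c2 u continuous_intros)
    fix x assume "x \<in> {0..L}"
    then have "\<bar>r x\<bar>\<^sup>2 \<le> C\<^sup>2" by (intro power_mono C) auto
    then show "r x * r x \<le> C\<^sup>2 * 1" by (simp add: power2_eq_square)
  qed
  also have "\<dots> = (C * nm u)\<^sup>2"
    using u by (subst Mul_cmult) (auto simp: Mul_const_1 L2.ip_simps L2.nrm_sq power_mult_distrib)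
  finally have "(nm (Mul r u))\<^sup>2 \<le> (C * nm u)\<^sup>2" by simp
  then show ?thesis by (rule power2_le_imp_le) (use C0 u in auto)
qed

text \<open>The energy identity with weight \<open>L - x\<close> bounds \<open>J\<close>.\<close>

lemma J_bound:
  assumes u: "u \<in> L2 L"
  shows "nm (J u) \<le> 2 * L * nm u"
proof -
  have "2 * Re (ip (aff 0 u) (Mul (\<lambda>x. L - x) u)) + Re (ip (aff 0 u) (Mul (\<lambda>x. - 1) (aff 0 u))) =
      (L - L) * (cmod (0 + ev u))\<^sup>2 - (L - 0) * (cmod 0)\<^sup>2"
    by (rule energy_identity[where r="\<lambda>x. L - x"]) (auto intro!: derivative_eq_intros continuous_intros u)
  moreover have "aff 0 u = J u" by (simp add: aff_def)
  moreover have "Mul (\<lambda>x. - 1) (J u) = - J u"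
    using Mul_cmult[of "\<lambda>_. 1" "J u" "- 1"] u by (simp add: Mul_const_1)
  ultimately have "(nm (J u))\<^sup>2 = 2 * Re (ip (J u) (Mul (\<lambda>x. L - x) u))"
    using u by (simp add: L2.ip_simps L2.nrm_sq)
  also have "\<dots> \<le> 2 * (nm (J u) * nm (Mul (\<lambda>x. L - x) u))"
    using L2.Re_ip_le[of "J u" L "Mul (\<lambda>x. L - x) u"] u by (simp add: continuous_intros)
  also have "\<dots> \<le> 2 * (nm (J u) * (L * nm u))"
    using u by (intro mult_left_mono Mul_bound) (auto intro!: continuous_intros)
  finally have "nm (J u) * nm (J u) \<le> nm (J u) * (2 * L * nm u)"
    by (simp add: power2_eq_square algebra_simps)
  then show ?thesis
    using u L_pos L2.nrm_nonneg[OF J_mem[OF u]]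
    by (cases "nm (J u) = 0") (auto simp: mult_le_cancel_left order_less_le)
qed

end

section \<open>Sobolev spaces as ranges of the Volterra operator\<close>

lemma continuous_eq_of_AE:
  fixes f g :: "real \<Rightarrow> complex"
  assumes L: "L > 0" and f: "continuous_on {0..L} f" and g: "continuous_on {0..L} g"
    and eq: "AE x in lborel. x \<in> {0<..<L} \<longrightarrow> f x = g x" and x: "x \<in> {0..L}"
  shows "f x = g x"
proof -
  define h where "h x = f x - g x" for x
  have h: "continuous_on {0..L} h" unfolding h_def[abs_def] by (intro continuous_intros f g)
  have hi: "set_integrable lborel {0<..<L} (\<lambda>x. cmod (h x))"
    by (intro set_integrable_norm sqi_integrable sqi_continuous h)
  have "(LINT x:{0<..<L}|lborel. cmod (h x)) = (LINT x:{0<..<L}|lborel. 0)"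
    unfolding set_lebesgue_integral_def
    by (rule integral_cong_AE)
      (use hi eq in \<open>auto simp: set_integrable_def h_def indicator_def elim!: eventually_mono\<close>)
  then have 0: "integral {0..L} (\<lambda>x. cmod (h x)) = 0"
    using set_borel_integral_eq_integral(2)[OF hi]
    by (simp add: integral_open_interval_real set_lebesgue_integral_def)
  have ch: "continuous_on {0..L} (\<lambda>x. cmod (h x))" by (intro continuous_intros h)
  then have "((\<lambda>x. cmod (h x)) has_integral 0) (cbox 0 L)"
    using integrable_integral[OF integrable_continuous_interval[OF ch]] 0 by simp
  then have "cmod (h x) = 0"
    using ch L x by (intro has_integral_0_cbox_imp_0[of 0 L "\<lambda>x. cmod (h x)" x]) auto
  then show ?thesis by (simp add: h_def)
qed

context interval
begin

lemma test_functionD: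
  assumes "test_function L \<phi>"
  shows "(\<phi> has_real_derivative deriv \<phi> x) (at x)" "continuous_on UNIV (deriv \<phi>)" "\<phi> 0 = 0" "\<phi> L = 0"
proof -
  have d: "(deriv ^^ n) \<phi> field_differentiable at x" for n x
    using assms by (simp add: test_function_def)
  show "(\<phi> has_real_derivative deriv \<phi> x) (at x)"
    using d[of 0] by (simp add: DERIV_deriv_iff_field_differentiable)
  show "continuous_on UNIV (deriv \<phi>)"
    using d[of 1] field_differentiable_imp_continuous_at
    by (intro continuous_at_imp_continuous_on) auto
  obtain a b where "0 < a" "b < L" "\<And>x. x \<notin> {a..b} \<Longrightarrow> \<phi> x = 0"
    using assms unfolding test_function_def by blast
  then show "\<phi> 0 = 0" "\<phi> L = 0" by auto
qed

lemma test_function_cont: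
  assumes "test_function L \<phi>"
  shows "continuous_on {0..L} \<phi>" "continuous_on {0..L} (deriv \<phi>)"
proof -
  show "continuous_on {0..L} \<phi>"
    by (rule continuous_at_imp_continuous_on, blast intro: DERIV_isCont test_functionD(1)[OF assms])
  show "continuous_on {0..L} (deriv \<phi>)"
    by (rule continuous_on_subset[OF test_functionD(2)[OF assms]]) simp
qed

lemma ev_Mul:
  assumes "continuous_on {0..L} r" "u \<in> L2 L"
  shows "ev (Mul r u) = II L (\<lambda>x. rep_lfun u x * complex_of_real (r x))"
  unfolding ev_def prim_cong_rep[OF Mul_rep[OF assms] sqi_Mul[OF assms] order_refl]
  by (simp add: prim_def mult.commute)

lemma has_weak_deriv_iff:
  assumes "u \<in> L2 L" "v \<in> L2 L"
  shows "has_weak_deriv L u v \<longleftrightarrow>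
    (\<forall>\<phi>. test_function L \<phi> \<longrightarrow> ev (Mul (deriv \<phi>) u) = - ev (Mul \<phi> v))"
  unfolding has_weak_deriv_def using assms by (auto simp: ev_Mul test_function_cont)

lemma has_weak_deriv_aff:
  assumes u: "u \<in> L2 L"
  shows "has_weak_deriv L (aff k u) u"
  unfolding has_weak_deriv_iff[OF aff_mem[OF u] u]
proof (intro allI impI)
  fix \<phi> assume \<phi>: "test_function L \<phi>"
  have "ev (Mul (deriv \<phi>) (aff k u) + Mul \<phi> u) = 0"
    using Mul_aff(2)[OF test_functionD(1,2)[OF \<phi>] u, of k] test_functionD(3,4)[OF \<phi>] by simp
  then show "ev (Mul (deriv \<phi>) (aff k u)) = - ev (Mul \<phi> u)"
    using u test_function_cont[OF \<phi>] by (simp add: ev_add add_eq_0_iff)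
qed

lemma weak_deriv_unique:
  assumes "v \<in> L2 L" "v' \<in> L2 L" "has_weak_deriv L u v" "has_weak_deriv L u v'"
  shows "v = v'"
proof (rule L2_eqI[OF assms(1,2)])
  have "AE x in lborel. x \<in> {0<..<L} \<longrightarrow> rep_lfun v x - rep_lfun v' x = 0"
  proof (rule fundamental_lemma[OF L_pos])
    show "set_integrable lborel {0<..<L} (\<lambda>x. rep_lfun v x - rep_lfun v' x)"
      by (intro set_integral_diff rep_integrable assms)
    fix a n assume a: "0 < a" "a \<le> L"
    note t = test_function_bump[OF a, of n]
    have si: "set_integrable lborel {0<..<L} (\<lambda>x. rep_lfun w x * complex_of_real (bump a n x))"
      if "w \<in> L2 L" for w
      by (intro sqi_mult_integrable sqi_continuous continuous_on_of_real test_function_cont[OF t] L2_sqi that)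
    have "II L (\<lambda>x. rep_lfun v x * complex_of_real (bump a n x)) =
        II L (\<lambda>x. rep_lfun v' x * complex_of_real (bump a n x))"
      using assms(3)[unfolded has_weak_deriv_def, rule_format, OF t]
        assms(4)[unfolded has_weak_deriv_def, rule_format, OF t] by simp
    then show "II L (\<lambda>x. (rep_lfun v x - rep_lfun v' x) * complex_of_real (bump a n x)) = 0"
      unfolding left_diff_distrib by (subst set_integral_diff[OF si si]) (use assms in auto)
  qed
  then show "AE x in lborel. x \<in> {0<..<L} \<longrightarrow> rep_lfun v x = rep_lfun v' x"
    by (auto elim: eventually_mono)
qed

lemma wderiv_aff [simp]: "u \<in> L2 L \<Longrightarrow> wderiv L (aff k u) = u"
  unfolding wderiv_def
  by (rule the_equality) (auto intro: has_weak_deriv_aff weak_deriv_unique)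

lemma aff_H1: "u \<in> L2 L \<Longrightarrow> aff k u \<in> H1 L"
  unfolding H1_def using has_weak_deriv_aff by blast

text \<open>If \<open>u\<close> has weak derivative \<open>v\<close>, then \<open>u - J v\<close> has weak derivative \<open>0\<close> and is constant.\<close>

lemma H1_cases:
  assumes "u \<in> H1 L"
  obtains k v where "v \<in> L2 L" "u = aff k v"
proof -
  obtain v where u: "u \<in> L2 L" and v: "v \<in> L2 L" and w: "has_weak_deriv L u v"
    using assms unfolding H1_def by blast
  have "\<exists>c. AE x in lborel. x \<in> {0<..<L} \<longrightarrow> rep_lfun (u - aff 0 v) x = c"
  proof (rule du_Bois_Reymond[OF L_pos])
    show "set_integrable lborel {0<..<L} (rep_lfun (u - aff 0 v))"
      using u v by (intro rep_integrable) auto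
    fix \<phi> assume \<phi>: "test_function L \<phi>"
    note c = test_function_cont[OF \<phi>]
    have "ev (Mul (deriv \<phi>) (u - aff 0 v)) = ev (Mul (deriv \<phi>) u) - ev (Mul (deriv \<phi>) (aff 0 v))"
      using Mul_add[OF c(2), of u "- aff 0 v"] u v c by (simp add: Mul_minus ev_diff)
    also have "\<dots> = 0"
      using w has_weak_deriv_aff[OF v, of 0] \<phi> u v by (simp add: has_weak_deriv_iff)
    finally show "II L (\<lambda>x. rep_lfun (u - aff 0 v) x * complex_of_real (deriv \<phi> x)) = 0"
      using u v c by (simp add: ev_Mul)
  qed
  then obtain k where k: "AE x in lborel. x \<in> {0<..<L} \<longrightarrow> rep_lfun (u - aff 0 v) x = k" by blast
  have "u = aff k v"
  proof (rule L2_eqI[OF u])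
    show "AE x in lborel. x \<in> {0<..<L} \<longrightarrow> rep_lfun u x = rep_lfun (aff k v) x"
      using k aff_rep[OF v, of 0] aff_rep[OF v, of k] rep_diff[of u "aff 0 v"]
      by eventually_elim (auto simp: algebra_simps)
  qed (use v in auto)
  with v show ?thesis by (rule that)
qed

lemma value_at_aff:
  assumes u: "u \<in> L2 L" and x: "x \<in> {0..L}"
  shows "value_at L (aff k u) x = k + prim (rep_lfun u) x"
  unfolding value_at_def
proof (rule the_equality)
  have c: "continuous_on {0..L} (\<lambda>x. k + prim (rep_lfun u) x)"
    by (intro continuous_intros prim_continuous rep_integrable u)
  then show "\<exists>f. continuous_on {0..L} f \<and>
      (AE x in lborel. x \<in> {0<..<L} \<longrightarrow> rep_lfun (aff k u) x = f x) \<and> f x = k + prim (rep_lfun u) x"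
    using aff_rep[OF u, of k] by (intro exI[of _ "\<lambda>x. k + prim (rep_lfun u) x"]) auto
  fix c' assume "\<exists>f. continuous_on {0..L} f \<and>
      (AE x in lborel. x \<in> {0<..<L} \<longrightarrow> rep_lfun (aff k u) x = f x) \<and> f x = c'"
  then obtain f where f: "continuous_on {0..L} f" "f x = c'"
    "AE x in lborel. x \<in> {0<..<L} \<longrightarrow> rep_lfun (aff k u) x = f x" by blast
  have "AE x in lborel. x \<in> {0<..<L} \<longrightarrow> f x = k + prim (rep_lfun u) x"
    using f(3) aff_rep[OF u, of k] by eventually_elim auto
  from continuous_eq_of_AE[OF L_pos f(1) c this x] f(2) show "c' = k + prim (rep_lfun u) x"
    by simp
qed

lemma J_eq_aff: "J u = aff 0 u"
  by (simp add: aff_def)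

lemma value_at_0: "u \<in> L2 L \<Longrightarrow> value_at L (aff k u) 0 = k"
  using value_at_aff[of u 0 k] L_pos by simp

lemma value_at_L: "u \<in> L2 L \<Longrightarrow> value_at L (aff k u) L = k + ev u"
  using value_at_aff[of u L k] L_pos by (simp add: ev_def)

lemma value_at_J [simp]: "u \<in> L2 L \<Longrightarrow> value_at L (J u) L = ev u"
  by (simp add: J_eq_aff value_at_L)

lemma wderiv_J [simp]: "u \<in> L2 L \<Longrightarrow> wderiv L (J u) = u"
  by (simp add: J_eq_aff)

text \<open>From here on weak derivatives and traces can be computed: the spaces with conditions at \<open>0\<close>
  are the ranges of \<open>J\<close> and of its square.\<close>

lemma H1L_iff: "u \<in> H1L L \<longleftrightarrow> (\<exists>v\<in>L2 L. u = J v)"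
proof
  assume "u \<in> H1L L"
  then have u: "u \<in> H1 L" "value_at L u 0 = 0" by (auto simp: H1L_def)
  from u(1) obtain k v where "v \<in> L2 L" "u = aff k v" by (rule H1_cases)
  with u(2) show "\<exists>v\<in>L2 L. u = J v" by (auto simp: value_at_0 J_eq_aff)
next
  assume "\<exists>v\<in>L2 L. u = J v"
  then show "u \<in> H1L L"
    by (auto simp: H1L_def J_eq_aff aff_H1 value_at_0)
qed

lemma H2L_iff: "u \<in> H2L L \<longleftrightarrow> (\<exists>c\<in>L2 L. u = J (J c))"
proof
  assume "u \<in> H2L L"
  then have u: "u \<in> H1L L" "wderiv L u \<in> H1L L"
    by (auto simp: H2L_def H2_def H1L_def)
  then show "\<exists>c\<in>L2 L. u = J (J c)" by (auto simp: H1L_iff)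
next
  assume "\<exists>c\<in>L2 L. u = J (J c)"
  then obtain c where "c \<in> L2 L" "u = J (J c)" by blast
  then show "u \<in> H2L L"
    by (auto simp: H2L_def H2_def J_eq_aff aff_H1 value_at_0)
qed

text \<open>\<open>H\<^sup>1\<^sub>0\<close>: primitives vanishing at both ends.\<close>

definition H10 :: "lfun set" where
  "H10 = {J u |u. u \<in> L2 L \<and> ev u = 0}"

text \<open>If \<open>w\<close> is orthogonal to all \<open>J u\<close> with \<open>u\<close> orthogonal to constants, then the adjoint of \<open>J\<close>
  maps \<open>w\<close> to a constant, and differentiation gives \<open>w = 0\<close>.\<close>

lemma H10_dense:
  assumes "x \<in> L2 L" "e > 0"
  shows "\<exists>y\<in>H10. nm (x - y) < e"
proof (rule L2.dense_of_trivial_complement[OF L2_complete _ _ _ assms])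
  show "csubspace_on H10"
  proof
    show "0 \<in> H10" unfolding H10_def by (auto intro!: exI[of _ 0])
  next
    fix x y assume "x \<in> H10" "y \<in> H10"
    then obtain u v where "u \<in> L2 L" "ev u = 0" "x = J u" "v \<in> L2 L" "ev v = 0" "y = J v"
      unfolding H10_def by blast
    then show "x + y \<in> H10"
      unfolding H10_def by (auto intro!: exI[of _ "u + v"] simp: J_add ev_add)
  next
    fix x c assume "x \<in> H10"
    then obtain u where "u \<in> L2 L" "ev u = 0" "x = J u" unfolding H10_def by blast
    then show "c *\<^sub>C x \<in> H10"
      unfolding H10_def by (auto intro!: exI[of _ "c *\<^sub>C u"] simp: J_scale ev_scale)
  qed
  show "H10 \<subseteq> L2 L" unfolding H10_def by auto
  fix w assume w: "w \<in> L2 L" and orth: "\<And>y. y \<in> H10 \<Longrightarrow> ip w y = 0"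
  define z where "z = ev w *\<^sub>C one - J w"
  define m where "m = ev z / complex_of_real L"
  have ev_one: "ev one = complex_of_real L"
  proof -
    have "ev one = II L (\<lambda>x. 1)"
      unfolding ev_def prim_cong_rep[OF one_rep sqi_const order_refl] by (simp add: prim_def)
    then show ?thesis using L_pos by (simp add: set_lebesgue_integral_def scaleR_conv_of_real)
  qed
  define y where "y = z - m *\<^sub>C one"
  have mem: "z \<in> L2 L" "y \<in> L2 L" using w by (auto simp: z_def y_def)
  have evy: "ev y = 0"
    using mem L_pos by (simp add: y_def ev_diff ev_scale ev_one m_def)
  have "J y \<in> H10" unfolding H10_def using mem evy by blast
  then have "ip z y = 0"
    using orth[of "J y"] ip_J_right[OF w mem(2)] by (simp add: z_def)
  moreover have "ip one y = 0" using mem evy by (simp add: ip_one_left)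
  moreover have "ip y y = ip z y - m * ip one y"
    using mem L2.ip_diff_left[of z L "m *\<^sub>C one" y] by (simp add: y_def[symmetric] L2.ip_scale_left)
  ultimately have "ip y y = 0" by simp
  then have "y = 0" using mem by (intro L2_nrm_eq_0[of y L]) (simp_all add: L2.nrm_def)
  then have "ev w *\<^sub>C one - J w = m *\<^sub>C one" by (simp add: y_def z_def)
  then have "J w = (ev w) *\<^sub>C one + (- m) *\<^sub>C one"
    by (simp add: scaleC_minus_left algebra_simps)
  then have "J w = aff (ev w - m) 0"
    by (simp add: aff_def scaleC_add_left[symmetric])
  then have "w = 0"
    using wderiv_J[OF w] wderiv_aff[of 0 "ev w - m"] by simp
  then show "nm w = 0" by simp
qed

end

section \<open>The energy space of the beam\<close>

lemma sq_sum3_le: "(s + t + r)\<^sup>2 \<le> 3 * (s\<^sup>2 + t\<^sup>2 + (r::real)\<^sup>2)"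
  using sum_squares_ge_zero[of "s - t" "t - r"] zero_le_power2[of "s - r"]
  by (simp add: power2_eq_square algebra_simps)

lemma semi_inner_Times:
  assumes "semi_inner X f" "semi_inner Y g"
  shows "semi_inner (X \<times> Y) (\<lambda>(x, y) (x', y'). f x x' + g y y')"
proof -
  interpret X: semi_inner X f by fact
  interpret Y: semi_inner Y g by fact
  show ?thesis
  proof
    fix u v assume uv: "u \<in> X \<times> Y" "v \<in> X \<times> Y"
    obtain x y x' y' where e: "u = (x, y)" "v = (x', y')" by (cases u, cases v)
    show "(\<lambda>(x, y) (x', y'). f x x' + g y y') v u = cnj ((\<lambda>(x, y) (x', y'). f x x' + g y y') u v)"
      using uv X.ip_commute[of x x'] Y.ip_commute[of y y'] by (simp add: e)
  qed (auto simp: zero_prod_def scaleC_prod_def X.ip_add_left Y.ip_add_left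
      X.ip_scale_left Y.ip_scale_left algebra_simps intro!: add_nonneg_nonneg X.ip_nonneg Y.ip_nonneg)
qed

locale rao_nakra =
  fixes p :: beam
  assumes len_pos: "len p > 0"
    and h_pos: "h1 p > 0" "h2 p > 0" "h3 p > 0"
    and G2_pos: "G2 p > 0"
    and rho_pos: "rho1 p > 0" "rho2 p \<ge> 0" "rho3 p > 0"
    and alpha1_pos: "alpha1_1 p > 0" "alpha1_3 p > 0"
    and beta_pos: "beta1 p > 0" "beta3 p > 0"
    and gain_pos: "s1 p > 0" "s3 p > 0" "k1 p > 0" "k2 p > 0"

sublocale rao_nakra \<subseteq> interval "len p"
  by unfold_locales (rule len_pos)

context rao_nakra
begin

definition cA where "cA = alpha1_1 p * h1 p"
definition cB where "cB = alpha1_3 p * h3 p"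
definition cC where "cC = beam_K2 p"
definition cS where "cS = G2 p / h2 p"
definition rA where "rA = rho1 p * h1 p"
definition rB where "rB = rho3 p * h3 p"
definition rW where "rW = beam_m p"
definition rK where "rK = beam_K1 p"
definition hh where "hh = beam_H p"

lemma coeff_pos: "cA > 0" "cB > 0" "cC > 0" "cS > 0" "rA > 0" "rB > 0" "rW > 0" "rK > 0"
proof -
  have "alpha_1 p > 0" "alpha_3 p > 0"
    using alpha1_pos beta_pos by (auto simp: alpha_1_def alpha_3_def intro: add_pos_nonneg)
  then show "cC > 0"
    using h_pos by (simp add: cC_def beam_K2_def add_pos_pos)
  show "rW > 0"
    using rho_pos h_pos by (simp add: rW_def beam_m_def add_pos_pos add_pos_nonneg)
  show "rK > 0"
    using rho_pos h_pos by (simp add: rK_def beam_K1_def add_pos_pos)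
qed (use h_pos G2_pos rho_pos alpha1_pos in \<open>auto simp: cA_def cB_def cS_def rA_def rB_def\<close>)

text \<open>Displacements and velocities in terms of the square-integrable functions
  \<open>(y\<^sub>1', y\<^sub>2', y\<^sub>3'')\<close> and \<open>(z\<^sub>1, z\<^sub>2, z\<^sub>3')\<close>; \<open>sh\<close> is the derivative of the shear
  \<open>- y\<^sub>1 + y\<^sub>2 + H y\<^sub>3'\<close>.\<close>

definition vV :: "lfun \<Rightarrow> lfun \<Rightarrow> lfun \<Rightarrow> triple" where
  "vV a b c = (J a, J b, J (J c))"

definition vH :: "lfun \<Rightarrow> lfun \<Rightarrow> lfun \<Rightarrow> triple" where
  "vH u v e = (u, v, J e)"

definition sh :: "lfun \<Rightarrow> lfun \<Rightarrow> lfun \<Rightarrow> lfun" where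
  "sh a b c = - a + b + complex_of_real hh *\<^sub>C c"

lemma vV_eq_vH: "vV a b c = vH (J a) (J b) (J c)"
  by (simp add: vV_def vH_def)

lemma sh_mem [simp, intro]: "\<lbrakk>a \<in> L2 (len p); b \<in> L2 (len p); c \<in> L2 (len p)\<rbrakk> \<Longrightarrow> sh a b c \<in> L2 (len p)"
  unfolding sh_def by auto

lemma V_iff: "y \<in> V_space p \<longleftrightarrow> (\<exists>a\<in>L2 (len p). \<exists>b\<in>L2 (len p). \<exists>c\<in>L2 (len p). y = vV a b c)"
  unfolding V_space_def vV_def by (cases y) (auto simp: H1L_iff H2L_iff)

lemma H_iff: "z \<in> H_space p \<longleftrightarrow> (\<exists>u\<in>L2 (len p). \<exists>v\<in>L2 (len p). \<exists>e\<in>L2 (len p). z = vH u v e)"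
  unfolding H_space_def vH_def by (cases z) (auto simp: H1L_iff)

lemma vV_mem [simp, intro]: "\<lbrakk>a \<in> L2 (len p); b \<in> L2 (len p); c \<in> L2 (len p)\<rbrakk> \<Longrightarrow> vV a b c \<in> V_space p"
  by (auto simp: V_iff)

lemma vH_mem [simp, intro]: "\<lbrakk>u \<in> L2 (len p); v \<in> L2 (len p); e \<in> L2 (len p)\<rbrakk> \<Longrightarrow> vH u v e \<in> H_space p"
  by (auto simp: H_iff)

lemma V_subset_H: "V_space p \<subseteq> H_space p"
  by (auto simp: V_iff vV_eq_vH)

lemma vH_add: "\<lbrakk>e \<in> L2 (len p); e' \<in> L2 (len p)\<rbrakk> \<Longrightarrow> vH u v e + vH u' v' e' = vH (u + u') (v + v') (e + e')"
  by (simp add: vH_def J_add)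

lemma vH_scale: "e \<in> L2 (len p) \<Longrightarrow> k *\<^sub>C vH u v e = vH (k *\<^sub>C u) (k *\<^sub>C v) (k *\<^sub>C e)"
  by (simp add: vH_def J_scale scaleC_prod_def)

lemma vH_diff: "\<lbrakk>e \<in> L2 (len p); e' \<in> L2 (len p)\<rbrakk> \<Longrightarrow> vH u v e - vH u' v' e' = vH (u - u') (v - v') (e - e')"
  by (simp add: vH_def J_diff)

lemma vV_add:
  "\<lbrakk>a \<in> L2 (len p); b \<in> L2 (len p); c \<in> L2 (len p); a' \<in> L2 (len p); b' \<in> L2 (len p); c' \<in> L2 (len p)\<rbrakk> \<Longrightarrow>
    vV a b c + vV a' b' c' = vV (a + a') (b + b') (c + c')"
  by (simp add: vV_def J_add)

lemma vV_diff:
  "\<lbrakk>a \<in> L2 (len p); b \<in> L2 (len p); c \<in> L2 (len p); a' \<in> L2 (len p); b' \<in> L2 (len p); c' \<in> L2 (len p)\<rbrakk> \<Longrightarrow>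
    vV a b c - vV a' b' c' = vV (a - a') (b - b') (c - c')"
  by (simp add: vV_def J_diff)

lemma vV_scale:
  "\<lbrakk>a \<in> L2 (len p); b \<in> L2 (len p); c \<in> L2 (len p)\<rbrakk> \<Longrightarrow> k *\<^sub>C vV a b c = vV (k *\<^sub>C a) (k *\<^sub>C b) (k *\<^sub>C c)"
  by (simp add: vV_def J_scale scaleC_prod_def)

lemma zero_eq_vH: "(0 :: triple) = vH 0 0 0"
  by (simp add: vH_def zero_prod_def)

lemma zero_eq_vV: "(0 :: triple) = vV 0 0 0"
  by (simp add: vV_def zero_prod_def)

lemma sh_add: "sh (a + a') (b + b') (c + c') = sh a b c + sh a' b' c'"
  by (simp add: sh_def scaleC_add_right algebra_simps)

lemma sh_scale: "sh (k *\<^sub>C a) (k *\<^sub>C b) (k *\<^sub>C c) = k *\<^sub>C sh a b c"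
  by (simp add: sh_def scaleC_add_right scaleC_scaleC mult.commute
      flip: scaleC_minus_one)

lemma J_sh:
  "\<lbrakk>a \<in> L2 (len p); b \<in> L2 (len p); c \<in> L2 (len p)\<rbrakk> \<Longrightarrow>
    J (sh a b c) = - J a + J b + complex_of_real hh *\<^sub>C J c"
  by (simp add: sh_def J_add J_diff J_scale)

lemma inner_V_vV:
  "\<lbrakk>a \<in> L2 (len p); b \<in> L2 (len p); c \<in> L2 (len p); a' \<in> L2 (len p); b' \<in> L2 (len p); c' \<in> L2 (len p)\<rbrakk> \<Longrightarrow>
    inner_V p (vV a b c) (vV a' b' c') =
      complex_of_real cA * ip a a' + complex_of_real cB * ip b b' + complex_of_real cC * ip c c' +
      complex_of_real cS * ip (J (sh a b c)) (J (sh a' b' c'))"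
  by (simp add: inner_V_def vV_def J_sh Let_def cA_def cB_def cC_def cS_def hh_def)

lemma inner_H_vH:
  "\<lbrakk>u \<in> L2 (len p); v \<in> L2 (len p); e \<in> L2 (len p); u' \<in> L2 (len p); v' \<in> L2 (len p); e' \<in> L2 (len p)\<rbrakk> \<Longrightarrow>
    inner_H p (vH u v e) (vH u' v' e') =
      complex_of_real rA * ip u u' + complex_of_real rB * ip v v' +
      complex_of_real rW * ip (J e) (J e') + complex_of_real rK * ip e e'"
  by (simp add: inner_H_def vH_def Let_def rA_def rB_def rW_def rK_def)

lemma semi_inner_H: "semi_inner (H_space p) (inner_H p)"
proof
  show "0 \<in> H_space p" by (auto simp: zero_eq_vH)
  show "x + y \<in> H_space p" if "x \<in> H_space p" "y \<in> H_space p" for x y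
    using that by (auto simp: H_iff[of x] H_iff[of y] vH_add)
  show "k *\<^sub>C x \<in> H_space p" if "x \<in> H_space p" for x k
    using that by (auto simp: H_iff[of x] vH_scale)
  show "inner_H p (x + y) z = inner_H p x z + inner_H p y z"
    if "x \<in> H_space p" "y \<in> H_space p" "z \<in> H_space p" for x y z
    using that by (auto simp: H_iff vH_add inner_H_vH J_add L2.ip_simps algebra_simps)
  show "inner_H p (k *\<^sub>C x) z = k * inner_H p x z" if "x \<in> H_space p" "z \<in> H_space p" for x z k
    using that by (auto simp: H_iff vH_scale inner_H_vH J_scale L2.ip_simps algebra_simps)
  show "inner_H p y x = cnj (inner_H p x y)" if "x \<in> H_space p" "y \<in> H_space p" for x y
  proof -
    have c: "ip v u = cnj (ip u v)" if "u \<in> L2 (len p)" "v \<in> L2 (len p)" for u v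
      using that by (rule L2.ip_commute)
    obtain u v e u' v' e' where *: "u \<in> L2 (len p)" "v \<in> L2 (len p)" "e \<in> L2 (len p)" "x = vH u v e"
      "u' \<in> L2 (len p)" "v' \<in> L2 (len p)" "e' \<in> L2 (len p)" "y = vH u' v' e'"
      using \<open>x \<in> H_space p\<close> \<open>y \<in> H_space p\<close> unfolding H_iff by blast
    then show ?thesis
      by (simp add: inner_H_vH c[of u u'] c[of v v'] c[of e e'] c[of "J e" "J e'"])
  qed
  show "0 \<le> Re (inner_H p x x)" if "x \<in> H_space p" for x
    using that coeff_pos
    by (auto simp: H_iff inner_H_vH L2.ip_nonneg intro!: add_nonneg_nonneg mult_nonneg_nonneg)
qed

lemma semi_inner_V: "semi_inner (V_space p) (inner_V p)"
proof
  show "0 \<in> V_space p" by (auto simp: zero_eq_vV)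
  show "x + y \<in> V_space p" if "x \<in> V_space p" "y \<in> V_space p" for x y
    using that by (auto simp: V_iff[of x] V_iff[of y] vV_add)
  show "k *\<^sub>C x \<in> V_space p" if "x \<in> V_space p" for x k
    using that by (auto simp: V_iff[of x] vV_scale)
  show "inner_V p (x + y) z = inner_V p x z + inner_V p y z"
    if "x \<in> V_space p" "y \<in> V_space p" "z \<in> V_space p" for x y z
    using that by (auto simp: V_iff vV_add inner_V_vV sh_add J_add L2.ip_simps algebra_simps)
  show "inner_V p (k *\<^sub>C x) z = k * inner_V p x z" if "x \<in> V_space p" "z \<in> V_space p" for x z k
    using that by (auto simp: V_iff vV_scale inner_V_vV sh_scale J_scale L2.ip_simps algebra_simps)
  show "inner_V p y x = cnj (inner_V p x y)" if "x \<in> V_space p" "y \<in> V_space p" for x y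
  proof -
    have c: "ip v u = cnj (ip u v)" if "u \<in> L2 (len p)" "v \<in> L2 (len p)" for u v
      using that by (rule L2.ip_commute)
    obtain a b d a' b' d' where *: "a \<in> L2 (len p)" "b \<in> L2 (len p)" "d \<in> L2 (len p)" "x = vV a b d"
      "a' \<in> L2 (len p)" "b' \<in> L2 (len p)" "d' \<in> L2 (len p)" "y = vV a' b' d'"
      using \<open>x \<in> V_space p\<close> \<open>y \<in> V_space p\<close> unfolding V_iff by blast
    then show ?thesis
      by (simp add: inner_V_vV c[of a a'] c[of b b'] c[of d d'] c[of "J (sh a b d)" "J (sh a' b' d')"])
  qed
  show "0 \<le> Re (inner_V p x x)" if "x \<in> V_space p" for x
    using that coeff_pos
    by (auto simp: V_iff inner_V_vV L2.ip_nonneg intro!: add_nonneg_nonneg mult_nonneg_nonneg)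
qed

sublocale HH: semi_inner "H_space p" "inner_H p"
  by (rule semi_inner_H)

sublocale VV: semi_inner "V_space p" "inner_V p"
  by (rule semi_inner_V)

sublocale ST: semi_inner "state_space p" "inner_state p"
  unfolding state_space_def inner_state_def by (rule semi_inner_Times[OF semi_inner_V semi_inner_H])

lemma norm_state_eq: "norm_state p = ST.nrm"
  by (simp add: fun_eq_iff norm_state_def ST.nrm_def)

lemma norm_H_eq: "norm_H p = HH.nrm"
  by (simp add: fun_eq_iff norm_H_def HH.nrm_def)

lemma HH_nrm_sq:
  assumes "u \<in> L2 (len p)" "v \<in> L2 (len p)" "e \<in> L2 (len p)"
  shows "(HH.nrm (vH u v e))\<^sup>2 = rA * (nm u)\<^sup>2 + rB * (nm v)\<^sup>2 + rW * (nm (J e))\<^sup>2 + rK * (nm e)\<^sup>2"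
  using assms by (simp add: HH.nrm_sq inner_H_vH L2.nrm_sq)

lemma VV_nrm_sq:
  assumes "a \<in> L2 (len p)" "b \<in> L2 (len p)" "c \<in> L2 (len p)"
  shows "(VV.nrm (vV a b c))\<^sup>2 = cA * (nm a)\<^sup>2 + cB * (nm b)\<^sup>2 + cC * (nm c)\<^sup>2 + cS * (nm (J (sh a b c)))\<^sup>2"
  using assms by (simp add: VV.nrm_sq inner_V_vV L2.nrm_sq)

lemma ST_nrm_sq:
  assumes "y \<in> V_space p" "z \<in> H_space p"
  shows "(ST.nrm (y, z))\<^sup>2 = (VV.nrm y)\<^sup>2 + (HH.nrm z)\<^sup>2"
proof -
  have "(y, z) \<in> state_space p" using assms by (simp add: state_space_def)
  from ST.nrm_sq[OF this] show ?thesis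
    unfolding VV.nrm_sq[OF assms(1)] HH.nrm_sq[OF assms(2)] by (simp add: inner_state_def)
qed

lemma le_of_weighted_sq:
  fixes x N c :: real
  assumes "c > 0" "c * x\<^sup>2 \<le> N\<^sup>2" "N \<ge> 0"
  shows "x \<le> (1 / sqrt c) * N"
proof -
  have "x\<^sup>2 \<le> N\<^sup>2 / c" using assms by (simp add: field_simps)
  also have "\<dots> = ((1 / sqrt c) * N)\<^sup>2" using assms by (simp add: power_mult_distrib power_divide)
  finally show ?thesis by (rule power2_le_imp_le) (use assms in auto)
qed

lemma HH_coords:
  assumes "u \<in> L2 (len p)" "v \<in> L2 (len p)" "e \<in> L2 (len p)"
  shows "nm u \<le> (1 / sqrt rA) * HH.nrm (vH u v e)"
    and "nm v \<le> (1 / sqrt rB) * HH.nrm (vH u v e)"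
    and "nm (J e) \<le> (1 / sqrt rW) * HH.nrm (vH u v e)"
    and "nm e \<le> (1 / sqrt rK) * HH.nrm (vH u v e)"
proof -
  have n: "0 \<le> rA * (nm (u))\<^sup>2" "0 \<le> rB * (nm (v))\<^sup>2" "0 \<le> rW * (nm (J e))\<^sup>2" "0 \<le> rK * (nm (e))\<^sup>2"
    using coeff_pos by auto
  have N: "0 \<le> HH.nrm (vH u v e)" using assms by auto
  show "nm u \<le> (1 / sqrt rA) * HH.nrm (vH u v e)"
    by (rule le_of_weighted_sq[OF _ _ N]) (use n coeff_pos in \<open>simp_all add: HH_nrm_sq[OF assms]\<close>)
  show "nm v \<le> (1 / sqrt rB) * HH.nrm (vH u v e)"
    by (rule le_of_weighted_sq[OF _ _ N]) (use n coeff_pos in \<open>simp_all add: HH_nrm_sq[OF assms]\<close>)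
  show "nm (J e) \<le> (1 / sqrt rW) * HH.nrm (vH u v e)"
    by (rule le_of_weighted_sq[OF _ _ N]) (use n coeff_pos in \<open>simp_all add: HH_nrm_sq[OF assms]\<close>)
  show "nm e \<le> (1 / sqrt rK) * HH.nrm (vH u v e)"
    by (rule le_of_weighted_sq[OF _ _ N]) (use n coeff_pos in \<open>simp_all add: HH_nrm_sq[OF assms]\<close>)
qed

lemma VV_coords:
  assumes "a \<in> L2 (len p)" "b \<in> L2 (len p)" "c \<in> L2 (len p)"
  shows "nm a \<le> (1 / sqrt cA) * VV.nrm (vV a b c)"
    and "nm b \<le> (1 / sqrt cB) * VV.nrm (vV a b c)"
    and "nm c \<le> (1 / sqrt cC) * VV.nrm (vV a b c)"
proof -
  have n: "0 \<le> cA * (nm (a))\<^sup>2" "0 \<le> cB * (nm (b))\<^sup>2" "0 \<le> cC * (nm (c))\<^sup>2" "0 \<le> cS * (nm (J (sh a b c)))\<^sup>2"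
    using coeff_pos by auto
  have N: "0 \<le> VV.nrm (vV a b c)" using assms by auto
  show "nm a \<le> (1 / sqrt cA) * VV.nrm (vV a b c)"
    by (rule le_of_weighted_sq[OF _ _ N]) (use n coeff_pos in \<open>simp_all add: VV_nrm_sq[OF assms]\<close>)
  show "nm b \<le> (1 / sqrt cB) * VV.nrm (vV a b c)"
    by (rule le_of_weighted_sq[OF _ _ N]) (use n coeff_pos in \<open>simp_all add: VV_nrm_sq[OF assms]\<close>)
  show "nm c \<le> (1 / sqrt cC) * VV.nrm (vV a b c)"
    by (rule le_of_weighted_sq[OF _ _ N]) (use n coeff_pos in \<open>simp_all add: VV_nrm_sq[OF assms]\<close>)
qed

lemma sqrt_sum_tendsto_0:
  assumes "f1 \<longlonglongrightarrow> (0::real)" "f2 \<longlonglongrightarrow> 0" "f3 \<longlonglongrightarrow> 0"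
  shows "(\<lambda>n. sqrt (c1 * (f1 n)\<^sup>2 + c2 * (f2 n)\<^sup>2 + c3 * (f3 n)\<^sup>2)) \<longlonglongrightarrow> 0"
proof -
  have "(\<lambda>n. sqrt (c1 * (f1 n)\<^sup>2 + c2 * (f2 n)\<^sup>2 + c3 * (f3 n)\<^sup>2)) \<longlonglongrightarrow>
      sqrt (c1 * 0\<^sup>2 + c2 * 0\<^sup>2 + c3 * 0\<^sup>2)"
    by (intro tendsto_intros assms)
  then show ?thesis by simp
qed

lemma HH_nrm_le:
  assumes "u \<in> L2 (len p)" "v \<in> L2 (len p)" "e \<in> L2 (len p)"
  shows "HH.nrm (vH u v e) \<le> sqrt (rA * (nm u)\<^sup>2 + rB * (nm v)\<^sup>2 + (rW * (2 * len p)\<^sup>2 + rK) * (nm e)\<^sup>2)"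
proof (rule real_le_rsqrt)
  have "(nm (J e))\<^sup>2 \<le> (2 * len p * nm e)\<^sup>2"
    using assms by (intro power_mono J_bound) auto
  then have "rW * (nm (J e))\<^sup>2 \<le> rW * (2 * len p)\<^sup>2 * (nm e)\<^sup>2"
    using coeff_pos(7) by (simp add: power_mult_distrib)
  then show "(HH.nrm (vH u v e))\<^sup>2 \<le> rA * (nm u)\<^sup>2 + rB * (nm v)\<^sup>2 + (rW * (2 * len p)\<^sup>2 + rK) * (nm e)\<^sup>2"
    by (simp add: HH_nrm_sq[OF assms] algebra_simps)
qed

lemma L2_Cauchy_lim:
  assumes "\<And>n. s n \<in> L2 (len p)" "\<And>m n. nm (s m - s n) \<le> C * d m n" "C > 0"
    and "\<And>e. e > 0 \<Longrightarrow> \<exists>N. \<forall>m\<ge>N. \<forall>n\<ge>N. d m n < e"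
  obtains u where "u \<in> L2 (len p)" "(\<lambda>n. nm (s n - u)) \<longlonglongrightarrow> 0"
proof -
  have "\<exists>N. \<forall>m\<ge>N. \<forall>n\<ge>N. nm (s m - s n) < e" if "e > 0" for e
  proof -
    have "e / C > 0" using that assms(3) by simp
    from assms(4)[OF this] obtain N where N: "\<And>m n. \<lbrakk>m \<ge> N; n \<ge> N\<rbrakk> \<Longrightarrow> d m n < e / C" by blast
    have "nm (s m - s n) < e" if "m \<ge> N" "n \<ge> N" for m n
    proof -
      have "C * d m n < e" using N[OF that] assms(3) by (simp add: field_simps)
      then show ?thesis using assms(2)[of m n] by linarith
    qed
    then show ?thesis by blast
  qed
  then have "\<exists>u\<in>L2 (len p). (\<lambda>n. nm (s n - u)) \<longlonglongrightarrow> 0"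
    using L2_complete[of "len p", unfolded L2.complete_on_def, rule_format, of s] assms(1) by simp
  then show ?thesis using that by blast
qed

lemma HH_complete: "HH.complete_on (H_space p)"
  unfolding HH.complete_on_def
proof (intro allI impI)
  fix s :: "nat \<Rightarrow> triple"
  assume sm: "\<forall>n. s n \<in> H_space p"
    and Cau: "\<forall>e>0. \<exists>N. \<forall>m\<ge>N. \<forall>n\<ge>N. HH.nrm (s m - s n) < e"
  have "\<forall>n. \<exists>u v e. u \<in> L2 (len p) \<and> v \<in> L2 (len p) \<and> e \<in> L2 (len p) \<and> s n = vH u v e"
    using sm unfolding H_iff by blast
  then obtain u v e where m: "\<And>n. u n \<in> L2 (len p)" "\<And>n. v n \<in> L2 (len p)" "\<And>n. e n \<in> L2 (len p)"
    and s: "\<And>n. s n = vH (u n) (v n) (e n)" by metis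
  have sd: "s i - s j = vH (u i - u j) (v i - v j) (e i - e j)" for i j
    using m by (simp add: s vH_diff)
  have pos: "1 / sqrt rA > 0" "1 / sqrt rB > 0" "1 / sqrt rK > 0" using coeff_pos by auto
  have Cau': "\<And>e. e > 0 \<Longrightarrow> \<exists>N. \<forall>m\<ge>N. \<forall>n\<ge>N. HH.nrm (s m - s n) < e" using Cau by blast
  obtain u' where u': "u' \<in> L2 (len p)" "(\<lambda>n. nm (u n - u')) \<longlonglongrightarrow> 0"
    by (rule L2_Cauchy_lim[of u, OF m(1) _ pos(1) Cau']) (unfold sd, rule HH_coords, use m in auto)
  obtain v' where v': "v' \<in> L2 (len p)" "(\<lambda>n. nm (v n - v')) \<longlonglongrightarrow> 0"
    by (rule L2_Cauchy_lim[of v, OF m(2) _ pos(2) Cau']) (unfold sd, rule HH_coords, use m in auto)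
  obtain e' where e': "e' \<in> L2 (len p)" "(\<lambda>n. nm (e n - e')) \<longlonglongrightarrow> 0"
    by (rule L2_Cauchy_lim[of e, OF m(3) _ pos(3) Cau']) (unfold sd, rule HH_coords, use m in auto)
  have "(\<lambda>n. HH.nrm (s n - vH u' v' e')) \<longlonglongrightarrow> 0"
  proof (rule Lim_null_comparison[OF _ sqrt_sum_tendsto_0[OF u'(2) v'(2) e'(2)]])
    show "\<forall>\<^sub>F n in sequentially. norm (HH.nrm (s n - vH u' v' e')) \<le>
      sqrt (rA * (nm (u n - u'))\<^sup>2 + rB * (nm (v n - v'))\<^sup>2 + (rW * (2 * len p)\<^sup>2 + rK) * (nm (e n - e'))\<^sup>2)"
    proof (rule always_eventually, rule allI)
      fix n
      have "s n - vH u' v' e' = vH (u n - u') (v n - v') (e n - e')"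
        using m e' by (simp add: s vH_diff)
      then show "norm (HH.nrm (s n - vH u' v' e')) \<le>
        sqrt (rA * (nm (u n - u'))\<^sup>2 + rB * (nm (v n - v'))\<^sup>2 + (rW * (2 * len p)\<^sup>2 + rK) * (nm (e n - e'))\<^sup>2)"
        using HH_nrm_le[of "u n - u'" "v n - v'" "e n - e'"] m u' v' e' by simp
    qed
  qed
  then show "\<exists>x\<in>H_space p. (\<lambda>n. HH.nrm (s n - x)) \<longlonglongrightarrow> 0"
    using u' v' e' by (intro bexI[of _ "vH u' v' e'"]) auto
qed

section \<open>The weak form of the equation on the domain of the generator\<close>

text \<open>The Riesz theorem makes \<open>op_M\<close> surjective onto the dual, so that the chosen preimage in the
  definition of \<open>op_M_inv\<close> really is one.\<close>

lemma op_M_inv: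
  assumes \<Lambda>: "\<Lambda> \<in> H_dual p"
  shows "op_M_inv p \<Lambda> \<in> H_space p" "\<psi> \<in> H_space p \<Longrightarrow> inner_H p (op_M_inv p \<Lambda>) \<psi> = \<Lambda> \<psi>"
proof -
  obtain K where "\<And>x. x \<in> H_space p \<Longrightarrow> cmod (\<Lambda> x) \<le> K * HH.nrm x"
    using \<Lambda> unfolding H_dual_def antidual_def norm_H_eq by blast
  then have "\<exists>z\<in>H_space p. \<forall>\<psi>\<in>H_space p. inner_H p z \<psi> = \<Lambda> \<psi>"
    using \<Lambda> by (intro HH.Riesz_representation[OF HH_complete, of _ K])
      (auto simp: H_dual_def antidual_def)
  then obtain z where z: "z \<in> H_space p" "\<And>\<psi>. \<psi> \<in> H_space p \<Longrightarrow> inner_H p z \<psi> = \<Lambda> \<psi>" by blast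
  have "\<Lambda> \<in> extensional (H_space p)" using \<Lambda> by (simp add: H_dual_def antidual_def)
  then have "op_M p z = \<Lambda>"
    unfolding op_M_def using z(2) by (intro extensionalityI[of _ "H_space p"]) auto
  then have im: "\<Lambda> \<in> op_M p ` H_space p" using z(1) by blast
  show m: "op_M_inv p \<Lambda> \<in> H_space p"
    unfolding op_M_inv_def by (rule inv_into_into[OF im])
  have "op_M p (op_M_inv p \<Lambda>) = \<Lambda>"
    unfolding op_M_inv_def by (rule f_inv_into_f[OF im])
  then show "inner_H p (op_M_inv p \<Lambda>) \<psi> = \<Lambda> \<psi>" if "\<psi> \<in> H_space p"
    using that by (metis op_M_def restrict_apply')
qed

lemma op_D0_vV:
  "\<lbrakk>a \<in> L2 (len p); b \<in> L2 (len p); c \<in> L2 (len p); a' \<in> L2 (len p); b' \<in> L2 (len p); c' \<in> L2 (len p)\<rbrakk> \<Longrightarrow>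
    op_D0 p (vV a b c) (vV a' b' c') =
      complex_of_real (s1 p) * ev a * cnj (ev a') + complex_of_real (s3 p) * ev b * cnj (ev b') +
      complex_of_real (k1 p) * ev c * cnj (ev c')"
  using vV_mem[of a' b' c'] by (simp add: op_D0_def vV_def Let_def)

lemma op_B0_vH:
  "\<lbrakk>u \<in> L2 (len p); v \<in> L2 (len p); e \<in> L2 (len p); u' \<in> L2 (len p); v' \<in> L2 (len p); e' \<in> L2 (len p)\<rbrakk> \<Longrightarrow>
    op_B0 p (vH u v e) (vH u' v' e') = complex_of_real (k2 p) * ev e * cnj (ev e')"
  using vH_mem[of u' v' e'] by (simp add: op_B0_def vH_def)

lemma op_B0_dual:
  assumes z: "z \<in> H_space p"
  shows "op_B0 p z \<in> H_dual p"
proof -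
  obtain u v e where zz: "u \<in> L2 (len p)" "v \<in> L2 (len p)" "e \<in> L2 (len p)" "z = vH u v e"
    using z unfolding H_iff by blast
  have bd: "cmod (op_B0 p z x) \<le> (k2 p * cmod (ev e) * nm one * (1 / sqrt rK)) * HH.nrm x" if xH: "x \<in> H_space p" for x
  proof -
    obtain u' v' e' where x: "u' \<in> L2 (len p)" "v' \<in> L2 (len p)" "e' \<in> L2 (len p)" "x = vH u' v' e'"
      using xH unfolding H_iff by blast
    have "cmod (op_B0 p z x) = k2 p * cmod (ev e) * cmod (ev e')"
      using zz x gain_pos by (simp add: op_B0_vH norm_mult)
    also have "\<dots> \<le> k2 p * cmod (ev e) * (nm one * ((1 / sqrt rK) * HH.nrm x))"
      using gain_pos ev_bound[OF x(3)] HH_coords(4)[OF x(1-3)] x(4)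
      by (intro mult_left_mono order_trans[OF ev_bound[OF x(3)]]) auto
    finally show ?thesis by (simp add: mult_ac)
  qed
  have "op_B0 p z \<in> extensional (H_space p)"
    by (cases z) (auto simp: op_B0_def)
  moreover have "op_B0 p z (x + y) = op_B0 p z x + op_B0 p z y" if "x \<in> H_space p" "y \<in> H_space p" for x y
    using that zz by (auto simp: H_iff[of x] H_iff[of y] vH_add op_B0_vH ev_add algebra_simps)
  moreover have "op_B0 p z (k *\<^sub>C x) = cnj k * op_B0 p z x" if "x \<in> H_space p" for x k
    using that zz by (auto simp: H_iff[of x] vH_scale op_B0_vH ev_scale)
  ultimately show ?thesis
    using bd unfolding H_dual_def antidual_def norm_H_eq by blast
qed

text \<open>On its domain the generator maps \<open>(y, z)\<close> to \<open>(z, f)\<close>, where the acceleration \<open>f\<close> is known only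
  through its pairings with \<open>\<psi> \<in> V\<close>. The decay estimate sees the
  operators only through this weak equation.\<close>

lemma generator_weak_form:
  assumes "(y, z) \<in> dom_calA p"
  obtains f where "y \<in> V_space p" "z \<in> V_space p" "f \<in> H_space p"
    "- (calA p (y, z) + op_B p (y, z)) = (z, f)"
    "\<And>\<psi>. \<psi> \<in> V_space p \<Longrightarrow>
      inner_H p f \<psi> + inner_V p y \<psi> + op_D0 p z \<psi> + op_B0 p z \<psi> = 0"
proof -
  have yz: "y \<in> V_space p" "z \<in> V_space p" and im: "op_A_D0 p (y, z) \<in> embed_dual p ` H_dual p"
    using assms by (auto simp: dom_calA_def)
  have zH: "z \<in> H_space p" using yz V_subset_H by blast
  define \<Lambda> where "\<Lambda> = inv_into (H_dual p) (embed_dual p) (op_A_D0 p (y, z))"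
  have \<Lambda>: "\<Lambda> \<in> H_dual p" unfolding \<Lambda>_def by (rule inv_into_into[OF im])
  have emb: "embed_dual p \<Lambda> = op_A_D0 p (y, z)" unfolding \<Lambda>_def by (rule f_inv_into_f[OF im])
  have \<Lambda>V: "\<Lambda> \<psi> = inner_V p y \<psi> + op_D0 p z \<psi>" if "\<psi> \<in> V_space p" for \<psi>
    using fun_cong[OF emb, of \<psi>] that by (simp add: embed_dual_def op_A_D0_def op_A_def)
  define f where "f = - (op_M_inv p \<Lambda> + op_M_inv p (op_B0 p z))"
  note M1 = op_M_inv[OF \<Lambda>] and M2 = op_M_inv[OF op_B0_dual[OF zH]]
  have f: "f \<in> H_space p" unfolding f_def using M1(1) M2(1) by (intro HH.minus_mem HH.add_mem)
  have "inner_H p f \<psi> + inner_V p y \<psi> + op_D0 p z \<psi> + op_B0 p z \<psi> = 0" if \<psi>: "\<psi> \<in> V_space p" for \<psi>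
  proof -
    have \<psi>H: "\<psi> \<in> H_space p" using \<psi> V_subset_H by blast
    have "inner_H p f \<psi> = - (\<Lambda> \<psi> + op_B0 p z \<psi>)"
      unfolding f_def using M1 M2 \<psi>H
      by (simp only: HH.ip_minus_left HH.ip_add_left HH.add_mem)
    then show ?thesis by (simp add: \<Lambda>V[OF \<psi>])
  qed
  moreover have "- (calA p (y, z) + op_B p (y, z)) = (z, f)"
    by (simp add: calA_def op_B_def \<Lambda>_def f_def)
  ultimately show ?thesis using yz f that by blast
qed

text \<open>A function that satisfies a weak first-order equation against all \<open>g\<close> is absolutely
  continuous: move \<open>J\<close> to the other side.\<close>

lemma aff_of_weak_equation:
  assumes a: "a \<in> L2 (len p)" and u: "u \<in> L2 (len p)" and \<alpha>: "\<alpha> \<noteq> 0"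
    and eq: "\<And>g. g \<in> L2 (len p) \<Longrightarrow> complex_of_real \<alpha> * ip a g + ip u (J g) + k * cnj (ev g) = 0"
  obtains k' v where "v \<in> L2 (len p)" "a = aff k' v"
proof -
  define w where "w = complex_of_real \<alpha> *\<^sub>C a + (ev u *\<^sub>C one - J u) + k *\<^sub>C one"
  have w: "w \<in> L2 (len p)" unfolding w_def using a u by auto
  have "ip w g = 0" if g: "g \<in> L2 (len p)" for g
  proof -
    have "ip w g = complex_of_real \<alpha> * ip a g + ip u (J g) + k * cnj (ev g)"
      unfolding w_def ip_J_right[OF u g] using a u g
      by (simp only: L2.ip_add_left L2.ip_scale_left ip_one_left one_mem L2.scale_mem L2.add_mem
          L2.diff_mem J_mem)
    then show ?thesis using eq[OF g] by simp
  qed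
  then have "w = 0" using w by (intro L2_nrm_eq_0[OF w]) (simp add: L2.nrm_def)
  moreover have "complex_of_real \<alpha> *\<^sub>C a = w - ((ev u *\<^sub>C one - J u) + k *\<^sub>C one)"
    by (simp add: w_def)
  moreover have "(- (k + ev u)) *\<^sub>C one = - (k *\<^sub>C one + ev u *\<^sub>C one)"
    by (simp only: scaleC_minus_left scaleC_add_left)
  ultimately have "complex_of_real \<alpha> *\<^sub>C a = (- (k + ev u)) *\<^sub>C one + J u"
    by (simp only:) simp
  then have "(1 / complex_of_real \<alpha>) *\<^sub>C complex_of_real \<alpha> *\<^sub>C a =
      (1 / complex_of_real \<alpha>) *\<^sub>C ((- (k + ev u)) *\<^sub>C one + J u)" by simp
  then have "a = aff ((1 / complex_of_real \<alpha>) * - (k + ev u)) ((1 / complex_of_real \<alpha>) *\<^sub>C u)"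
    using \<alpha> u by (simp add: aff_def J_scale scaleC_add_right scaleC_scaleC scaleC_one)
  then show ?thesis using u by (intro that) auto
qed

section \<open>Density of the domain\<close>

lemma H10_D:
  assumes "u \<in> H10"
  obtains u' where "u' \<in> L2 (len p)" "ev u' = 0" "u = J u'"
  using assms unfolding H10_def by blast

text \<open>Strains in \<open>H\<^sup>1\<^sub>0\<close> can be integrated by parts onto the test function, and velocities with
  vanishing traces make \<open>D\<^sub>0 z = 0\<close>; together these put the state into the domain.\<close>

lemma dom_calA_H10:
  assumes "a \<in> H10" "b \<in> H10" "c \<in> H10" "u \<in> H10" "v \<in> H10" "e \<in> H10"
  shows "(vV a b c, vH u v e) \<in> dom_calA p"
proof -
  obtain a' where a: "a' \<in> L2 (len p)" "ev a' = 0" "a = J a'" using assms by (rule_tac H10_D)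
  obtain b' where b: "b' \<in> L2 (len p)" "ev b' = 0" "b = J b'" using assms by (rule_tac H10_D)
  obtain c' where c: "c' \<in> L2 (len p)" "ev c' = 0" "c = J c'" using assms by (rule_tac H10_D)
  obtain u' where u: "u' \<in> L2 (len p)" "ev u' = 0" "u = J u'" using assms by (rule_tac H10_D)
  obtain v' where v: "v' \<in> L2 (len p)" "ev v' = 0" "v = J v'" using assms by (rule_tac H10_D)
  obtain e' where e: "e' \<in> L2 (len p)" "ev e' = 0" "e = J e'" using assms by (rule_tac H10_D)
  have m: "a \<in> L2 (len p)" "b \<in> L2 (len p)" "c \<in> L2 (len p)" using a b c by auto
  define F where "F = J (sh a b c)"
  have F: "F \<in> L2 (len p)" unfolding F_def using m by auto
  define wA where "wA = (- complex_of_real cA) *\<^sub>C a' - complex_of_real cS *\<^sub>C F"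
  define wB where "wB = (- complex_of_real cB) *\<^sub>C b' + complex_of_real cS *\<^sub>C F"
  define wC where "wC = (- complex_of_real cC) *\<^sub>C c' + complex_of_real (cS * hh) *\<^sub>C F"
  have w: "wA \<in> L2 (len p)" "wB \<in> L2 (len p)" "wC \<in> L2 (len p)"
    using a b c F by (auto simp: wA_def wB_def wC_def)
  define \<Lambda> where "\<Lambda> = restrict (\<lambda>(\<psi>1, \<psi>2, \<psi>3). ip wA \<psi>1 + ip wB \<psi>2 + ip wC (wderiv (len p) \<psi>3)) (H_space p)"
  have \<Lambda>_vH: "\<Lambda> (vH x y z) = ip wA x + ip wB y + ip wC z"
    if "x \<in> L2 (len p)" "y \<in> L2 (len p)" "z \<in> L2 (len p)" for x y z
    using vH_mem[OF that] that by (simp add: \<Lambda>_def vH_def)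
  have "\<Lambda> \<in> H_dual p"
  proof -
    have "cmod (\<Lambda> x) \<le> (nm wA * (1 / sqrt rA) + nm wB * (1 / sqrt rB) + nm wC * (1 / sqrt rK)) * HH.nrm x"
      if xH: "x \<in> H_space p" for x
    proof -
      obtain x1 x2 x3 where x: "x1 \<in> L2 (len p)" "x2 \<in> L2 (len p)" "x3 \<in> L2 (len p)" "x = vH x1 x2 x3"
        using xH unfolding H_iff by blast
      have "cmod (\<Lambda> x) \<le> cmod (ip wA x1) + cmod (ip wB x2) + cmod (ip wC x3)"
        unfolding x(4) \<Lambda>_vH[OF x(1-3)] by (intro norm_triangle_mono norm_triangle_ineq order_refl)
      also have "\<dots> \<le> nm wA * ((1 / sqrt rA) * HH.nrm x) + nm wB * ((1 / sqrt rB) * HH.nrm x) +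
          nm wC * ((1 / sqrt rK) * HH.nrm x)"
        unfolding x(4)
        by (intro add_mono order_trans[OF L2.Cauchy_Schwarz] mult_left_mono HH_coords L2.nrm_nonneg w x)
      finally show ?thesis by (simp add: algebra_simps)
    qed
    moreover have "\<Lambda> \<in> extensional (H_space p)" by (simp add: \<Lambda>_def)
    moreover have "\<Lambda> (x + y) = \<Lambda> x + \<Lambda> y" if "x \<in> H_space p" "y \<in> H_space p" for x y
      using that w by (auto simp: H_iff[of x] H_iff[of y] vH_add \<Lambda>_vH L2.ip_simps)
    moreover have "\<Lambda> (k *\<^sub>C x) = cnj k * \<Lambda> x" if "x \<in> H_space p" for x k
      using that w by (auto simp: H_iff[of x] vH_scale \<Lambda>_vH L2.ip_simps algebra_simps)
    ultimately show ?thesis unfolding H_dual_def antidual_def norm_H_eq by blast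
  qed
  moreover have "embed_dual p \<Lambda> = op_A_D0 p (vV a b c, vH u v e)"
  proof (rule extensionalityI[of _ "V_space p"])
    show "embed_dual p \<Lambda> \<in> extensional (V_space p)" by (simp add: embed_dual_def)
    show "op_A_D0 p (vV a b c, vH u v e) \<in> extensional (V_space p)" by (simp add: op_A_D0_def)
    fix \<psi> assume \<psi>: "\<psi> \<in> V_space p"
    then obtain x y z where x: "x \<in> L2 (len p)" "y \<in> L2 (len p)" "z \<in> L2 (len p)" "\<psi> = vV x y z"
      unfolding V_iff by blast
    have parts: "ip (J s) t = - ip s (J t)" if "s \<in> L2 (len p)" "t \<in> L2 (len p)" "ev s = 0" for s t
      using by_parts[OF that(1,2)] that(3) by (simp add: add_eq_0_iff2)
    have "embed_dual p \<Lambda> \<psi> = ip wA (J x) + ip wB (J y) + ip wC (J z)"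
      using \<psi> x by (simp add: embed_dual_def vV_eq_vH[of x y z] \<Lambda>_vH)
    also have "\<dots> = complex_of_real cA * ip a x + complex_of_real cB * ip b y + complex_of_real cC * ip c z +
        complex_of_real cS * ip F (J (sh x y z))"
      using a b c x F
      by (simp add: wA_def wB_def wC_def L2.ip_simps parts J_sh algebra_simps)
    also have "\<dots> = inner_V p (vV a b c) \<psi> + op_D0 p (vH u v e) \<psi>"
    proof -
      have "vH u v e = vV u' v' e'" using u v e by (simp add: vV_eq_vH)
      then show ?thesis
        using x m u v e by (simp add: inner_V_vV op_D0_vV F_def)
    qed
    also have "\<dots> = op_A_D0 p (vV a b c, vH u v e) \<psi>"
      using \<psi> by (simp add: op_A_D0_def op_A_def)
    finally show "embed_dual p \<Lambda> \<psi> = op_A_D0 p (vV a b c, vH u v e) \<psi>" .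
  qed
  ultimately have "op_A_D0 p (vV a b c, vH u v e) \<in> embed_dual p ` H_dual p" by (metis imageI)
  moreover have "vH u v e \<in> V_space p"
    using u v e vV_mem[of u' v' e'] by (simp add: vV_eq_vH)
  ultimately show ?thesis using m by (simp add: dom_calA_def)
qed

lemma nm_sh_le:
  assumes "a \<in> L2 (len p)" "b \<in> L2 (len p)" "c \<in> L2 (len p)"
  shows "nm (sh a b c) \<le> nm a + nm b + \<bar>hh\<bar> * nm c"
  unfolding sh_def using assms
    L2.nrm_triangle[of "- a + b" "len p" "complex_of_real hh *\<^sub>C c"] L2.nrm_triangle[of "- a" "len p" b]
  by (simp add: L2.nrm_minus L2.nrm_scale)

lemma VV_nrm_le:
  assumes "a \<in> L2 (len p)" "b \<in> L2 (len p)" "c \<in> L2 (len p)"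
  shows "VV.nrm (vV a b c) \<le> sqrt ((cA + cS * 3 * (2 * len p)\<^sup>2) * (nm a)\<^sup>2 +
      (cB + cS * 3 * (2 * len p)\<^sup>2) * (nm b)\<^sup>2 + (cC + cS * 3 * (2 * len p)\<^sup>2 * hh\<^sup>2) * (nm c)\<^sup>2)"
proof (rule real_le_rsqrt)
  have "nm (J (sh a b c)) \<le> 2 * len p * (nm a + nm b + \<bar>hh\<bar> * nm c)"
    using J_bound[OF sh_mem[OF assms]] nm_sh_le[OF assms] len_pos
    by (meson mult_left_mono order_trans less_imp_le mult_pos_pos zero_less_numeral)
  then have "(nm (J (sh a b c)))\<^sup>2 \<le> (2 * len p * (nm a + nm b + \<bar>hh\<bar> * nm c))\<^sup>2"
    using assms by (intro power_mono) auto
  also have "\<dots> \<le> (2 * len p)\<^sup>2 * (3 * ((nm a)\<^sup>2 + (nm b)\<^sup>2 + hh\<^sup>2 * (nm c)\<^sup>2))"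
    using sq_sum3_le[of "nm a" "nm b" "\<bar>hh\<bar> * nm c"]
    unfolding power_mult_distrib[of "2 * len p"]
    by (intro mult_left_mono) (simp_all add: power_mult_distrib)
  finally have "cS * (nm (J (sh a b c)))\<^sup>2 \<le>
      cS * ((2 * len p)\<^sup>2 * (3 * ((nm a)\<^sup>2 + (nm b)\<^sup>2 + hh\<^sup>2 * (nm c)\<^sup>2)))"
    using coeff_pos by (intro mult_left_mono) auto
  then show "(VV.nrm (vV a b c))\<^sup>2 \<le> (cA + cS * 3 * (2 * len p)\<^sup>2) * (nm a)\<^sup>2 +
      (cB + cS * 3 * (2 * len p)\<^sup>2) * (nm b)\<^sup>2 + (cC + cS * 3 * (2 * len p)\<^sup>2 * hh\<^sup>2) * (nm c)\<^sup>2"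
    by (simp add: VV_nrm_sq[OF assms] algebra_simps)
qed

lemma H10_sequence:
  assumes "u \<in> L2 (len p)"
  obtains s where "\<And>n. s n \<in> H10" "\<And>n. s n \<in> L2 (len p)" "(\<lambda>n. nm (u - s n)) \<longlonglongrightarrow> 0"
proof -
  have "\<exists>y\<in>H10. nm (u - y) < 1 / real (Suc n)" for n
    by (rule H10_dense[OF assms]) simp
  then obtain s where s: "\<And>n. s n \<in> H10" "\<And>n. nm (u - s n) < 1 / real (Suc n)" by metis
  have m: "s n \<in> L2 (len p)" for n using s(1)[of n] by (auto simp: H10_def)
  have "(\<lambda>n. nm (u - s n)) \<longlonglongrightarrow> 0"
  proof (rule Lim_null_comparison[OF _ LIMSEQ_inverse_real_of_nat])
    show "\<forall>\<^sub>F n in sequentially. norm (nm (u - s n)) \<le> inverse (real (Suc n))"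
      using s(2) assms m by (intro always_eventually) (simp add: inverse_eq_divide less_imp_le)
  qed
  with s(1) m show ?thesis by (rule that)
qed

lemma domain_dense:
  assumes x: "x \<in> state_space p" and \<epsilon>: "\<epsilon> > 0"
  shows "\<exists>y\<in>dom_calA p. ST.nrm (x - y) < \<epsilon>"
proof -
  obtain a b c u v e where m: "a \<in> L2 (len p)" "b \<in> L2 (len p)" "c \<in> L2 (len p)"
    "u \<in> L2 (len p)" "v \<in> L2 (len p)" "e \<in> L2 (len p)" and xx: "x = (vV a b c, vH u v e)"
    using x unfolding state_space_def by (auto simp: V_iff H_iff)
  obtain a' where a': "\<And>n. a' n \<in> H10" "\<And>n. a' n \<in> L2 (len p)" "(\<lambda>n. nm (a - a' n)) \<longlonglongrightarrow> 0"
    using H10_sequence[OF m(1)] by blast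
  obtain b' where b': "\<And>n. b' n \<in> H10" "\<And>n. b' n \<in> L2 (len p)" "(\<lambda>n. nm (b - b' n)) \<longlonglongrightarrow> 0"
    using H10_sequence[OF m(2)] by blast
  obtain c' where c': "\<And>n. c' n \<in> H10" "\<And>n. c' n \<in> L2 (len p)" "(\<lambda>n. nm (c - c' n)) \<longlonglongrightarrow> 0"
    using H10_sequence[OF m(3)] by blast
  obtain u' where u': "\<And>n. u' n \<in> H10" "\<And>n. u' n \<in> L2 (len p)" "(\<lambda>n. nm (u - u' n)) \<longlonglongrightarrow> 0"
    using H10_sequence[OF m(4)] by blast
  obtain v' where v': "\<And>n. v' n \<in> H10" "\<And>n. v' n \<in> L2 (len p)" "(\<lambda>n. nm (v - v' n)) \<longlonglongrightarrow> 0"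
    using H10_sequence[OF m(5)] by blast
  obtain e' where e': "\<And>n. e' n \<in> H10" "\<And>n. e' n \<in> L2 (len p)" "(\<lambda>n. nm (e - e' n)) \<longlonglongrightarrow> 0"
    using H10_sequence[OF m(6)] by blast
  note mm = m a'(2) b'(2) c'(2) u'(2) v'(2) e'(2)
  have lV: "(\<lambda>n. VV.nrm (vV (a - a' n) (b - b' n) (c - c' n))) \<longlonglongrightarrow> 0"
  proof (rule Lim_null_comparison[OF _ sqrt_sum_tendsto_0[OF a'(3) b'(3) c'(3)]],
      rule always_eventually, rule allI)
    fix n
    note d = L2.diff_mem[OF m(1) a'(2)] L2.diff_mem[OF m(2) b'(2)] L2.diff_mem[OF m(3) c'(2)]
    from VV_nrm_le[OF d, of n n n]
    show "norm (VV.nrm (vV (a - a' n) (b - b' n) (c - c' n))) \<le> sqrt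
        ((cA + cS * 3 * (2 * len p)\<^sup>2) * (nm (a - a' n))\<^sup>2 +
         (cB + cS * 3 * (2 * len p)\<^sup>2) * (nm (b - b' n))\<^sup>2 +
         (cC + cS * 3 * (2 * len p)\<^sup>2 * hh\<^sup>2) * (nm (c - c' n))\<^sup>2)"
      using VV.nrm_nonneg[OF vV_mem[OF d, of n n n]] by (simp only: real_norm_def abs_of_nonneg)
  qed
  have lH: "(\<lambda>n. HH.nrm (vH (u - u' n) (v - v' n) (e - e' n))) \<longlonglongrightarrow> 0"
  proof (rule Lim_null_comparison[OF _ sqrt_sum_tendsto_0[OF u'(3) v'(3) e'(3)]],
      rule always_eventually, rule allI)
    fix n
    note d = L2.diff_mem[OF m(4) u'(2)] L2.diff_mem[OF m(5) v'(2)] L2.diff_mem[OF m(6) e'(2)]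
    from HH_nrm_le[OF d, of n n n]
    show "norm (HH.nrm (vH (u - u' n) (v - v' n) (e - e' n))) \<le> sqrt
        (rA * (nm (u - u' n))\<^sup>2 + rB * (nm (v - v' n))\<^sup>2 +
         (rW * (2 * len p)\<^sup>2 + rK) * (nm (e - e' n))\<^sup>2)"
      using HH.nrm_nonneg[OF vH_mem[OF d, of n n n]] by (simp only: real_norm_def abs_of_nonneg)
  qed
  have "(\<lambda>n. (VV.nrm (vV (a - a' n) (b - b' n) (c - c' n)))\<^sup>2 +
      (HH.nrm (vH (u - u' n) (v - v' n) (e - e' n)))\<^sup>2) \<longlonglongrightarrow> 0\<^sup>2 + 0\<^sup>2"
    by (intro tendsto_intros lV lH)
  then have "\<forall>\<^sub>F n in sequentially. (VV.nrm (vV (a - a' n) (b - b' n) (c - c' n)))\<^sup>2 +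
      (HH.nrm (vH (u - u' n) (v - v' n) (e - e' n)))\<^sup>2 < \<epsilon>\<^sup>2"
    by (rule order_tendstoD) (use \<epsilon> in simp)
  then obtain n where n: "(VV.nrm (vV (a - a' n) (b - b' n) (c - c' n)))\<^sup>2 +
      (HH.nrm (vH (u - u' n) (v - v' n) (e - e' n)))\<^sup>2 < \<epsilon>\<^sup>2"
    by (auto simp: eventually_sequentially)
  have "x - (vV (a' n) (b' n) (c' n), vH (u' n) (v' n) (e' n)) =
      (vV (a - a' n) (b - b' n) (c - c' n), vH (u - u' n) (v - v' n) (e - e' n))"
    using mm by (simp add: xx vV_diff vH_diff)
  then have "(ST.nrm (x - (vV (a' n) (b' n) (c' n), vH (u' n) (v' n) (e' n))))\<^sup>2 < \<epsilon>\<^sup>2"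
    using n mm by (simp add: ST_nrm_sq)
  then have "ST.nrm (x - (vV (a' n) (b' n) (c' n), vH (u' n) (v' n) (e' n))) < \<epsilon>"
    by (rule power_less_imp_less_base) (use \<epsilon> in simp)
  then show ?thesis
    using dom_calA_H10[OF a'(1) b'(1) c'(1) u'(1) v'(1) e'(1), of n n n n n n] by blast
qed

end

section \<open>Weighted estimates with an exponential multiplier\<close>

context interval
begin

text \<open>The multiplier \<open>qf\<close> vanishes at \<open>0\<close>, which keeps the clamped end out of all estimates, and its
  derivative \<open>wt\<close> satisfies \<open>wt' = K wt\<close>: it dominates \<open>qf\<close> and all lower-order terms for large
  \<open>K\<close>.\<close>

definition qf :: "real \<Rightarrow> real \<Rightarrow> real" where
  "qf K x = exp (K * x) - 1"

definition wt :: "real \<Rightarrow> real \<Rightarrow> real" where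
  "wt K x = K * exp (K * x)"

definition I :: "real \<Rightarrow> lfun \<Rightarrow> real" where
  "I K u = Re (ip u (Mul (wt K) u))"

lemma qf_deriv: "(qf K has_real_derivative wt K x) (at x)"
  unfolding qf_def wt_def by (auto intro!: derivative_eq_intros)

lemma wt_deriv: "(wt K has_real_derivative K * wt K x) (at x)"
  unfolding wt_def by (auto intro!: derivative_eq_intros)

lemma qf_cont [simp, intro]: "continuous_on S (qf K)"
  unfolding qf_def[abs_def] by (intro continuous_intros)

lemma wt_cont [simp, intro]: "continuous_on S (wt K)"
  unfolding wt_def[abs_def] by (intro continuous_intros)

lemma Mul_diff: "\<lbrakk>continuous_on {0..L} r; u \<in> L2 L; v \<in> L2 L\<rbrakk> \<Longrightarrow> Mul r (u - v) = Mul r u - Mul r v"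
  using Mul_add[of r u "- v"] by (simp add: Mul_minus)

lemma qf_0 [simp]: "qf K 0 = 0"
  by (simp add: qf_def)

lemma qf_mono: "\<lbrakk>K > 0; x \<in> {0..L}\<rbrakk> \<Longrightarrow> \<bar>qf K x\<bar> \<le> qf K L"
  by (simp add: qf_def)

lemma qf_L_nonneg: "K > 0 \<Longrightarrow> 0 \<le> qf K L"
  using L_pos by (simp add: qf_def)

lemma semi_inner_weight: "K > 0 \<Longrightarrow> semi_inner (L2 L) (\<lambda>u v. ip u (Mul (wt K) v))"
proof
  show "0 \<le> Re (ip u (Mul (wt K) u))" if "K > 0" "u \<in> L2 L" for u
  proof -
    have "Re (ip u (Mul (\<lambda>x. 0 * 1) u)) \<le> Re (ip u (Mul (wt K) u))"
      using that by (intro Mul_mono wt_cont continuous_intros) (auto simp: wt_def)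
    then show ?thesis using that by (subst (asm) Mul_cmult) auto
  qed
  show "ip v (Mul (wt K) u) = cnj (ip u (Mul (wt K) v))" if "u \<in> L2 L" "v \<in> L2 L" for u v
    using that Mul_symmetric[of "wt K" v u] L2.ip_commute[of u L "Mul (wt K) v"] by auto
qed (auto simp: L2.ip_simps)

lemma I_lower:
  assumes "K > 0" "u \<in> L2 L"
  shows "K * (nm u)\<^sup>2 \<le> I K u"
proof -
  have "Re (ip u (Mul (\<lambda>x. K * 1) u)) \<le> I K u"
    unfolding I_def using assms by (intro Mul_mono wt_cont continuous_intros) (auto simp: wt_def)
  then show ?thesis
    using assms by (subst (asm) Mul_cmult) (auto simp: Mul_const_1 L2.ip_simps L2.nrm_sq)
qed

lemma I_nonneg: "\<lbrakk>K > 0; u \<in> L2 L\<rbrakk> \<Longrightarrow> 0 \<le> I K u"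
  using I_lower[of K u] by (meson mult_nonneg_nonneg less_imp_le order_trans zero_le_power2)

lemma weighted_Young:
  fixes x y t :: real
  assumes "t > 0"
  shows "2 * (x * y) \<le> t * x\<^sup>2 + y\<^sup>2 / t"
proof -
  have "0 \<le> (t * x - y)\<^sup>2" by simp
  then have "(t * (2 * (x * y))) / t \<le> (t * (t * x\<^sup>2) + y\<^sup>2) / t"
    using assms by (intro divide_right_mono) (auto simp: power2_eq_square algebra_simps)
  then show ?thesis using assms by (simp add: add_divide_distrib)
qed

lemma I_Young:
  assumes K: "K > 0" and t: "t > 0" and u: "u \<in> L2 L" and v: "v \<in> L2 L"
  shows "2 * \<bar>Re (ip u (Mul (wt K) v))\<bar> \<le> t * I K u + I K v / t"
proof -
  interpret W: semi_inner "L2 L" "\<lambda>u v. ip u (Mul (wt K) v)"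
    by (rule semi_inner_weight[OF K])
  have "2 * \<bar>Re (ip u (Mul (wt K) v))\<bar> \<le> 2 * (W.nrm u * W.nrm v)"
    using W.Re_ip_le[OF u v] by simp
  also have "\<dots> \<le> t * (W.nrm u)\<^sup>2 + (W.nrm v)\<^sup>2 / t"
    by (rule weighted_Young[OF t])
  finally show ?thesis by (simp add: W.nrm_sq u v I_def)
qed

lemma I_minus: "u \<in> L2 L \<Longrightarrow> I K (- u) = I K u"
  by (simp add: I_def Mul_minus L2.ip_simps)

lemma I_sum3:
  assumes K: "K > 0" and m: "a \<in> L2 L" "b \<in> L2 L" "c \<in> L2 L"
  shows "I K (- a + b + complex_of_real h *\<^sub>C c) \<le> 3 * (I K a + I K b + h\<^sup>2 * I K c)"
proof -
  interpret W: semi_inner "L2 L" "\<lambda>u v. ip u (Mul (wt K) v)"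
    by (rule semi_inner_weight[OF K])
  have Ieq: "I K u = (W.nrm u)\<^sup>2" if "u \<in> L2 L" for u
    using that by (simp add: W.nrm_sq I_def)
  have "W.nrm (- a + b + complex_of_real h *\<^sub>C c) \<le> W.nrm a + W.nrm b + \<bar>h\<bar> * W.nrm c"
    using W.nrm_triangle[of "- a + b" "complex_of_real h *\<^sub>C c"] W.nrm_triangle[of "- a" b] m
    by (simp add: W.nrm_minus W.nrm_scale)
  then have "(W.nrm (- a + b + complex_of_real h *\<^sub>C c))\<^sup>2 \<le> (W.nrm a + W.nrm b + \<bar>h\<bar> * W.nrm c)\<^sup>2"
    by (rule power_mono) (use m in auto)
  also have "\<dots> \<le> 3 * ((W.nrm a)\<^sup>2 + (W.nrm b)\<^sup>2 + (\<bar>h\<bar> * W.nrm c)\<^sup>2)"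
    by (rule sq_sum3_le)
  finally show ?thesis using m by (simp add: Ieq power_mult_distrib)
qed

text \<open>A Hardy inequality that integrates from the right end, where the weight is largest: the
  constant \<open>4 / K\<^sup>2\<close> makes terms of lower order small when \<open>K\<close> is large.\<close>

lemma Hardy:
  assumes K: "K > 0" and u: "u \<in> L2 L"
  shows "I K (aff k u) \<le> 2 * exp (K * L) * (cmod (k + ev u))\<^sup>2 + (4 / K\<^sup>2) * I K u"
proof -
  let ?U = "aff k u"
  have U: "?U \<in> L2 L" using u by simp
  have "2 * Re (ip ?U (Mul (wt K) u)) + Re (ip ?U (Mul (\<lambda>x. K * wt K x) ?U)) =
      wt K L * (cmod (k + ev u))\<^sup>2 - wt K 0 * (cmod k)\<^sup>2"
    by (rule energy_identity[OF wt_deriv _ u]) (intro continuous_intros wt_cont)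
  moreover have "Re (ip ?U (Mul (\<lambda>x. K * wt K x) ?U)) = K * I K ?U"
    using U by (subst Mul_cmult) (auto simp: I_def L2.ip_simps)
  moreover have "0 \<le> wt K 0 * (cmod k)\<^sup>2" using K by (simp add: wt_def)
  moreover have "2 * \<bar>Re (ip ?U (Mul (wt K) u))\<bar> \<le> (K/2) * I K ?U + I K u / (K/2)"
    by (rule I_Young[OF K _ U u]) (use K in simp)
  ultimately have "(K/2) * I K ?U \<le> wt K L * (cmod (k + ev u))\<^sup>2 + (2 / K) * I K u"
    by (auto simp: abs_if field_simps split: if_splits)
  then have "(2/K) * ((K/2) * I K ?U) \<le> (2/K) * (wt K L * (cmod (k + ev u))\<^sup>2 + (2 / K) * I K u)"
    using K by (intro mult_left_mono) auto
  then show ?thesis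
    using K by (simp add: wt_def power2_eq_square field_simps)
qed

lemma q_identity:
  assumes K: "K > 0" and u: "u \<in> L2 L"
  shows "Re (ip (aff k u) (Mul (qf K) u)) = (qf K L * (cmod (k + ev u))\<^sup>2 - I K (aff k u)) / 2"
  using energy_identity[OF qf_deriv _ u, of K k] by (simp add: I_def field_simps)

lemma q_identity_J:
  assumes K: "K > 0" and u: "u \<in> L2 L"
  shows "Re (ip (J u) (Mul (qf K) u)) = (qf K L * (cmod (ev u))\<^sup>2 - I K (J u)) / 2"
  using q_identity[OF assms, of 0] by (simp add: J_eq_aff)

text \<open>The derivative of the product of \<open>qf K\<close> with \<open>aff k u\<close>.\<close>

definition dq :: "real \<Rightarrow> complex \<Rightarrow> lfun \<Rightarrow> lfun" where
  "dq K k u = Mul (wt K) (aff k u) + Mul (qf K) u"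

lemma dq_mem [simp, intro]: "u \<in> L2 L \<Longrightarrow> dq K k u \<in> L2 L"
  unfolding dq_def by auto

lemma Mul_qf_aff:
  assumes u: "u \<in> L2 L"
  shows "Mul (qf K) (aff k u) = J (dq K k u)" "ev (dq K k u) = complex_of_real (qf K L) * (k + ev u)"
  using Mul_aff[OF qf_deriv wt_cont u, of K k] by (simp_all add: J_eq_aff dq_def)

lemma ip_dq:
  assumes K: "K > 0" and u: "u \<in> L2 L"
  shows "Re (ip (aff k u) (dq K k u)) = (qf K L * (cmod (k + ev u))\<^sup>2 + I K (aff k u)) / 2"
proof -
  have "ip (aff k u) (dq K k u) = ip (aff k u) (Mul (wt K) (aff k u)) + ip (aff k u) (Mul (qf K) u)"
    unfolding dq_def using u by (intro L2.ip_add_right) auto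
  then show ?thesis
    using q_identity[OF assms, of k] by (simp add: I_def field_simps)
qed

text \<open>The rotary inertia term carries one derivative more than the translational one; against the
  multiplier \<open>J (q e')\<close> with \<open>e = J e'\<close> the velocity \<open>J e\<close> leaves, besides its energy, only a
  term that is small for large weights.\<close>

lemma inertia_identity:
  assumes K: "K > 0" and c: "c \<in> L2 L"
  shows "Re (ip (J (J c)) (J (Mul (qf K) c))) \<le>
    (qf K L * (cmod (ev (J c)))\<^sup>2 - I K (J (J c))) / 2 + (I K (J (J c)) + I K (J c)) / K"
proof -
  define e where "e = J c"
  define z where "z = J e"
  have m: "e \<in> L2 L" "z \<in> L2 L" using c by (auto simp: e_def z_def)
  have "Mul (qf K) e = J (Mul (wt K) e + Mul (qf K) c)"
    using Mul_qf_aff(1)[OF c, of K 0] by (simp add: e_def J_eq_aff dq_def)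
  then have "J (Mul (qf K) c) = Mul (qf K) e - J (Mul (wt K) e)"
    using m c by (simp add: J_add)
  then have split: "ip z (J (Mul (qf K) c)) = ip z (Mul (qf K) e) - ip z (J (Mul (wt K) e))"
    using m c by (simp add: L2.ip_simps)
  have main: "Re (ip z (Mul (qf K) e)) = (qf K L * (cmod (ev e))\<^sup>2 - I K z) / 2"
    unfolding z_def by (rule q_identity_J[OF K m(1)])
  have rest: "2 * \<bar>Re (ip z (J (Mul (wt K) e)))\<bar> \<le> 2 * ((I K z + I K e) / K)"
  proof -
    define Z where "Z = aff (ev z) (- z)"
    have Z: "Z \<in> L2 L" using m by (auto simp: Z_def)
    have "ev z *\<^sub>C one - J z = Z" using m by (simp add: Z_def aff_def J_minus)
    then have eq: "ip z (J (Mul (wt K) e)) = ip Z (Mul (wt K) e)"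
      using ip_J_right[OF m(2), of "Mul (wt K) e"] m by simp
    have "I K Z \<le> (4 / K\<^sup>2) * I K z"
      using Hardy[OF K, of "- z" "ev z"] m by (simp add: Z_def ev_minus I_minus)
    then have "(K/2) * I K Z \<le> (K/2) * ((4 / K\<^sup>2) * I K z)"
      using K by (intro mult_left_mono) auto
    also have "\<dots> = (2 / K) * I K z" using K by (simp add: power2_eq_square)
    finally have "(K/2) * I K Z \<le> (2 / K) * I K z" .
    moreover have "2 * \<bar>Re (ip Z (Mul (wt K) e))\<bar> \<le> (K/2) * I K Z + I K e / (K/2)"
      by (rule I_Young[OF K _ Z m(1)]) (use K in simp)
    moreover have "I K e / (K/2) = 2 * (I K e / K)" "(2 / K) * I K z = 2 * (I K z / K)"
      "2 * ((I K z + I K e) / K) = 2 * (I K z / K) + 2 * (I K e / K)"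
      by (simp_all add: add_divide_distrib)
    moreover have "W \<le> R" if "X \<le> Y" "W \<le> X + V" "V = v" "Y = y" "R = y + v" for X Y W V v y R :: real
      using that by simp
    ultimately show ?thesis unfolding eq by blast
  qed
  have arith: "X - Y \<le> A + R" if "X = A" "2 * \<bar>Y\<bar> \<le> 2 * R" for X Y A R :: real
    using that by linarith
  show ?thesis
    unfolding e_def[symmetric] z_def[symmetric] split minus_complex.simps by (rule arith[OF main rest])
qed

lemma ev_Mul_qf_bound:
  assumes K: "K > 0" and c: "c \<in> L2 L"
  shows "cmod (ev (Mul (qf K) c)) \<le> nm one * qf K L * nm c"
proof -
  have "nm (Mul (qf K) c) \<le> qf K L * nm c"
    by (rule Mul_bound[OF qf_cont c]) (rule qf_mono[OF K])
  then have "nm one * nm (Mul (qf K) c) \<le> nm one * (qf K L * nm c)"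
    by (intro mult_left_mono) auto
  then show ?thesis
    using ev_bound[OF Mul_mem[OF qf_cont c], of K] by simp
qed

end

lemma boundary_Young:
  assumes c: "(c::real) > 0" and Q: "Q \<ge> 0" and s: "s > 0"
  shows "- Re (complex_of_real s * x * cnj (complex_of_real Q * y)) \<le>
    Q * (c * (cmod y)\<^sup>2) / 2 + Q * (s / (2 * c)) * (s * (cmod x)\<^sup>2)"
proof -
  have "- Re (complex_of_real s * x * cnj (complex_of_real Q * y)) \<le>
      cmod (complex_of_real s * x * cnj (complex_of_real Q * y))"
    using abs_Re_le_cmod[of "complex_of_real s * x * cnj (complex_of_real Q * y)"] by linarith
  also have "\<dots> = Q * ((s * cmod x) * cmod y)"
    using Q s by (simp add: norm_mult mult_ac)
  also have "\<dots> \<le> Q * (c * (cmod y)\<^sup>2 / 2 + (s / (2 * c)) * (s * (cmod x)\<^sup>2))"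
  proof (rule mult_left_mono[OF _ Q])
    have "0 \<le> (c * cmod y - s * cmod x)\<^sup>2" by simp
    then show "(s * cmod x) * cmod y \<le> c * (cmod y)\<^sup>2 / 2 + (s / (2 * c)) * (s * (cmod x)\<^sup>2)"
      using c by (simp add: power2_eq_square field_simps)
  qed
  finally show ?thesis by (simp add: distrib_left mult.assoc)
qed

section \<open>The multiplier estimate\<close>

context rao_nakra
begin

text \<open>The boundary dissipation rate, for the velocity \<open>vV a b c\<close>.\<close>

definition diss :: "lfun \<Rightarrow> lfun \<Rightarrow> lfun \<Rightarrow> real" where
  "diss a b c = s1 p * (cmod (ev a))\<^sup>2 + s3 p * (cmod (ev b))\<^sup>2 + k1 p * (cmod (ev c))\<^sup>2 +
     k2 p * (cmod (ev (J c)))\<^sup>2"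

lemma diss_nonneg: "0 \<le> diss a b c"
  using gain_pos by (auto simp: diss_def intro!: add_nonneg_nonneg)

definition weak_eq where
  "weak_eq a b c az bz cz f \<longleftrightarrow> (\<forall>\<psi>\<in>V_space p.
     inner_H p f \<psi> + inner_V p (vV a b c) \<psi> + op_D0 p (vV az bz cz) \<psi> + op_B0 p (vV az bz cz) \<psi> = 0)"

lemma weak_eq_vV:
  assumes m: "a \<in> L2 (len p)" "b \<in> L2 (len p)" "c \<in> L2 (len p)"
    "az \<in> L2 (len p)" "bz \<in> L2 (len p)" "cz \<in> L2 (len p)"
    and n: "a' \<in> L2 (len p)" "b' \<in> L2 (len p)" "c' \<in> L2 (len p)"
    and eq: "weak_eq a b c az bz cz f"
  shows "inner_H p f (vV a' b' c') = - (inner_V p (vV a b c) (vV a' b' c') +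
    complex_of_real (s1 p) * ev az * cnj (ev a') + complex_of_real (s3 p) * ev bz * cnj (ev b') +
      complex_of_real (k1 p) * ev cz * cnj (ev c') + complex_of_real (k2 p) * ev (J cz) * cnj (ev (J c')))"
proof -
  have "inner_H p f (vV a' b' c') + inner_V p (vV a b c) (vV a' b' c') +
      op_D0 p (vV az bz cz) (vV a' b' c') + op_B0 p (vV az bz cz) (vV a' b' c') = 0"
    using eq n unfolding weak_eq_def by blast
  moreover have "op_B0 p (vV az bz cz) (vV a' b' c') = complex_of_real (k2 p) * ev (J cz) * cnj (ev (J c'))"
    unfolding vV_eq_vH using m n by (intro op_B0_vH) auto
  ultimately show ?thesis
    using m n by (simp add: op_D0_vV add_eq_0_iff2 algebra_simps)
qed

text \<open>Testing with displacements that have a single nonzero strain \<open>g\<close> gives an equation of the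
  form treated in \<open>aff_of_weak_equation\<close> for each strain. Only with this regularity is the
  multiplier of the next theorem an admissible test function.\<close>

lemma domain_regularity:
  assumes m: "a \<in> L2 (len p)" "b \<in> L2 (len p)" "c \<in> L2 (len p)"
    "az \<in> L2 (len p)" "bz \<in> L2 (len p)" "cz \<in> L2 (len p)"
    and f: "f1 \<in> L2 (len p)" "f2 \<in> L2 (len p)" "ef \<in> L2 (len p)"
    and eq: "weak_eq a b c az bz cz (vH f1 f2 ef)"
  shows "\<exists>ka a' kb b' kc c'. a' \<in> L2 (len p) \<and> b' \<in> L2 (len p) \<and> c' \<in> L2 (len p) \<and>
    a = aff ka a' \<and> b = aff kb b' \<and> c = aff kc c'"
proof -
  define F where "F = J (sh a b c)"
  have F: "F \<in> L2 (len p)" unfolding F_def using m by auto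
  note W = weak_eq_vV[OF m _ _ _ eq]
  have sh1: "J (sh g 0 0) = - J g" "J (sh 0 g 0) = J g" "J (sh 0 0 g) = complex_of_real hh *\<^sub>C J g"
    if "g \<in> L2 (len p)" for g
    using that by (simp_all add: J_sh)
  have z: "0 \<in> L2 (len p)" by simp
  have test_vectors:
    "inner_H p (vH f1 f2 ef) (vV g 0 0) = complex_of_real rA * ip f1 (J g)"
    "inner_H p (vH f1 f2 ef) (vV 0 g 0) = complex_of_real rB * ip f2 (J g)"
    "inner_H p (vH f1 f2 ef) (vV 0 0 g) =
      complex_of_real rW * ip (J ef) (J (J g)) + complex_of_real rK * ip ef (J g)"
    "inner_V p (vV a b c) (vV g 0 0) = complex_of_real cA * ip a g - complex_of_real cS * ip F (J g)"
    "inner_V p (vV a b c) (vV 0 g 0) = complex_of_real cB * ip b g + complex_of_real cS * ip F (J g)"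
    "inner_V p (vV a b c) (vV 0 0 g) =
      complex_of_real cC * ip c g + complex_of_real (cS * hh) * ip F (J g)"
    if "g \<in> L2 (len p)" for g
    using that m f F by (simp_all add: inner_V_vV sh1 L2.ip_simps F_def[symmetric])
      (simp_all add: vV_eq_vH inner_H_vH)
  obtain ka a' where a': "a' \<in> L2 (len p)" "a = aff ka a'"
  proof (rule aff_of_weak_equation[OF m(1)])
    show "complex_of_real rA *\<^sub>C f1 - complex_of_real cS *\<^sub>C F \<in> L2 (len p)" using f F by auto
    show "cA \<noteq> 0" using coeff_pos by simp
    fix g assume g: "g \<in> L2 (len p)"
    from W[OF g z z] show "complex_of_real cA * ip a g +
        ip (complex_of_real rA *\<^sub>C f1 - complex_of_real cS *\<^sub>C F) (J g) +
        (complex_of_real (s1 p) * ev az) * cnj (ev g) = 0"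
      unfolding test_vectors[OF g]
      using g m f F by (simp add: L2.ip_simps algebra_simps)
  qed blast
  obtain kb b' where b': "b' \<in> L2 (len p)" "b = aff kb b'"
  proof (rule aff_of_weak_equation[OF m(2)])
    show "complex_of_real rB *\<^sub>C f2 + complex_of_real cS *\<^sub>C F \<in> L2 (len p)" using f F by auto
    show "cB \<noteq> 0" using coeff_pos by simp
    fix g assume g: "g \<in> L2 (len p)"
    from W[OF z g z] show "complex_of_real cB * ip b g +
        ip (complex_of_real rB *\<^sub>C f2 + complex_of_real cS *\<^sub>C F) (J g) +
        (complex_of_real (s3 p) * ev bz) * cnj (ev g) = 0"
      unfolding test_vectors[OF g]
      using g m f F by (simp add: L2.ip_simps algebra_simps)
  qed blast
  define uC where "uC = complex_of_real rW *\<^sub>C (ev (J ef) *\<^sub>C one - J (J ef)) + complex_of_real rK *\<^sub>C ef +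
      complex_of_real (cS * hh) *\<^sub>C F + (complex_of_real (k2 p) * ev (J cz)) *\<^sub>C one"
  have uC: "uC \<in> L2 (len p)" unfolding uC_def using f F m by auto
  obtain kc c' where c': "c' \<in> L2 (len p)" "c = aff kc c'"
  proof (rule aff_of_weak_equation[OF m(3) uC])
    show "cC \<noteq> 0" using coeff_pos by simp
    fix g assume g: "g \<in> L2 (len p)"
    have 1: "ip uC (J g) = complex_of_real rW * ip (J ef) (J (J g)) + complex_of_real rK * ip ef (J g) +
        complex_of_real (cS * hh) * ip F (J g) + complex_of_real (k2 p) * ev (J cz) * cnj (ev (J g))"
      unfolding uC_def using g f F m
      by (simp add: L2.ip_add_left L2.ip_scale_left ip_one_left ip_J_right[of "J ef" "J g"])
    from W[OF z z g] show "complex_of_real cC * ip c g + ip uC (J g) +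
        (complex_of_real (k1 p) * ev cz) * cnj (ev g) = 0"
      unfolding 1
      unfolding test_vectors[OF g]
      using g m f F by (simp add: L2.ip_simps algebra_simps)
  qed blast
  from a' b' c' show ?thesis by blast
qed

text \<open>These conditions make the remainders from the rotary inertia (\<open>rW / K\<close>) and from the shear
  (\<open>cS / K\<^sup>2\<close>, through the Hardy inequality) at most half of the energy terms that they are
  absorbed into.\<close>

definition weight_large :: "real \<Rightarrow> bool" where
  "weight_large K \<longleftrightarrow> K \<ge> 4 \<and> rW / K \<le> rK / 4 \<and> 6 * cS / K\<^sup>2 \<le> cA / 4 \<and> 6 * cS / K\<^sup>2 \<le> cB / 4 \<and>
     6 * cS * hh\<^sup>2 / K\<^sup>2 \<le> cC / 8"

lemma weight_large_ex: "\<exists>K. weight_large K"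
proof -
  define K where "K = 4 + 4 * rW / rK + 24 * cS / cA + 24 * cS / cB + 48 * cS * hh\<^sup>2 / cC"
  have nn: "0 \<le> 4 * rW / rK" "0 \<le> 24 * cS / cA" "0 \<le> 24 * cS / cB" "0 \<le> 48 * cS * hh\<^sup>2 / cC"
    using coeff_pos by auto
  have K4: "K \<ge> 4" using nn by (simp add: K_def)
  have sq: "K \<le> K\<^sup>2" using K4 by (simp add: power2_eq_square)
  have div: "x / K\<^sup>2 \<le> y" if "x / y \<le> K" "y > 0" "x \<ge> 0" for x y
  proof -
    have "x \<le> y * K" using that by (simp add: field_simps)
    also have "\<dots> \<le> y * K\<^sup>2" using sq that by (intro mult_left_mono) auto
    finally show ?thesis using K4 by (simp add: field_simps)
  qed
  have "rW / K \<le> rK / 4"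
  proof -
    have "4 * rW / rK \<le> K" using nn by (simp add: K_def)
    then show ?thesis using coeff_pos K4 by (simp add: field_simps)
  qed
  moreover have "6 * cS / K\<^sup>2 \<le> cA / 4" "6 * cS / K\<^sup>2 \<le> cB / 4" "6 * cS * hh\<^sup>2 / K\<^sup>2 \<le> cC / 8"
    using coeff_pos nn div[of "6 * cS" "cA / 4"] div[of "6 * cS" "cB / 4"]
      div[of "6 * cS * hh\<^sup>2" "cC / 8"] K_def by (simp_all add: mult.assoc)
  ultimately have "weight_large K" using K4 by (simp add: weight_large_def)
  then show ?thesis by blast
qed

definition energy_sum :: "real \<Rightarrow> lfun \<Rightarrow> lfun \<Rightarrow> lfun \<Rightarrow> lfun \<Rightarrow> lfun \<Rightarrow> lfun \<Rightarrow> real" where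
  "energy_sum K a b c az bz cz = cA * I K a + cB * I K b + cC * I K c +
     rA * I K (J az) + rB * I K (J bz) + rW * I K (J (J cz)) + rK * I K (J cz)"

text \<open>The first three summands collect, for the three traces with a Young inequality against
  the strain at \<open>L\<close>, the boundary term of the kinetic energy and the cost of the damping term; the
  last one belongs to the trace \<open>z\<^sub>3(L)\<close>, whose damping term is paid for in the interior.\<close>

definition mult_const :: "real \<Rightarrow> real" where
  "mult_const K = qf K (len p) * (rA / (2 * s1 p) + s1 p / (2 * cA)) +
     qf K (len p) * (rB / (2 * s3 p) + s3 p / (2 * cB)) +
     qf K (len p) * (rK / (2 * k1 p) + k1 p / (2 * cC)) +
     (qf K (len p) * rW / 2 + 2 * (k2 p * (nm one * qf K (len p)))\<^sup>2 / cC) / k2 p"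

text \<open>The multiplier has strain primitives \<open>(q y\<^sub>1', q y\<^sub>2', q y\<^sub>3'')\<close>. In its third component
  \<open>J (q y\<^sub>3'')\<close> replaces the customary \<open>q y\<^sub>3'\<close>: then the rotary inertia has the good sign, and since
  the shear strain of the multiplier is \<open>q\<close> times the derivative of the shear, the other terms are
  instances of \<open>energy_identity\<close>. The boundary terms of the strains at \<open>L\<close> are negative and absorb
  the damping forces that act on them. Apart from the small inertia remainder, the only bad interior
  term comes from the shear; the Hardy inequality trades it for the trace of the shear at \<open>L\<close>, the
  one quantity on the right that the dissipation does not control.\<close>

theorem multiplier_estimate:
  assumes K: "weight_large K"
    and m: "a \<in> L2 (len p)" "b \<in> L2 (len p)" "c \<in> L2 (len p)"
    "az \<in> L2 (len p)" "bz \<in> L2 (len p)" "cz \<in> L2 (len p)"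
    and f: "f1 \<in> L2 (len p)" "f2 \<in> L2 (len p)" "ef \<in> L2 (len p)"
    and eq: "weak_eq a b c az bz cz (vH f1 f2 ef)"
  shows "Re (inner_H p (vH f1 f2 ef) (vH (Mul (qf K) a) (Mul (qf K) b) (Mul (qf K) c))) +
      Re (inner_H p (vV az bz cz) (vH (Mul (qf K) az) (Mul (qf K) bz) (Mul (qf K) cz))) \<le>
    - (1/4) * energy_sum K a b c az bz cz + cS * exp (K * len p) * (cmod (ev (sh a b c)))\<^sup>2 +
      mult_const K * diss az bz cz"
proof -
  have K4: "K \<ge> 4" and K0: "K > 0" using K by (auto simp: weight_large_def)
  obtain ka a' kb b' kc c' where n: "a' \<in> L2 (len p)" "b' \<in> L2 (len p)" "c' \<in> L2 (len p)"
    and abc: "a = aff ka a'" "b = aff kb b'" "c = aff kc c'"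
    using domain_regularity[OF m f eq] by blast
  define Q where "Q = qf K (len p)"
  have Q: "Q \<ge> 0" unfolding Q_def by (rule qf_L_nonneg[OF K0])
  define A where "A = dq K ka a'"
  define B where "B = dq K kb b'"
  define C where "C = dq K kc c'"
  have ABC: "A \<in> L2 (len p)" "B \<in> L2 (len p)" "C \<in> L2 (len p)" using n by (auto simp: A_def B_def C_def)
  have MJ: "Mul (qf K) a = J A" "Mul (qf K) b = J B" "Mul (qf K) c = J C"
    unfolding abc A_def B_def C_def by (rule Mul_qf_aff(1)[OF n(1)] Mul_qf_aff(1)[OF n(2)] Mul_qf_aff(1)[OF n(3)])+
  have evs: "ev A = complex_of_real Q * (ka + ev a')" "ev B = complex_of_real Q * (kb + ev b')"
    "ev C = complex_of_real Q * (kc + ev c')"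
    unfolding A_def B_def C_def Q_def by (rule Mul_qf_aff(2)[OF n(1)] Mul_qf_aff(2)[OF n(2)] Mul_qf_aff(2)[OF n(3)])+
  define \<sigma> where "\<sigma> = sh a b c"
  have \<sigma>: "\<sigma> \<in> L2 (len p)" unfolding \<sigma>_def using m by auto
  have M\<sigma>: "J (sh A B C) = Mul (qf K) \<sigma>"
    using m ABC MJ by (simp add: \<sigma>_def sh_def[of a b c] J_sh Mul_add Mul_diff Mul_scale)
  define xa where "xa = (cmod (ka + ev a'))\<^sup>2"
  define xb where "xb = (cmod (kb + ev b'))\<^sup>2"
  define xc where "xc = (cmod (kc + ev c'))\<^sup>2"
  define x\<sigma> where "x\<sigma> = (cmod (ev \<sigma>))\<^sup>2"
  have va: "Re (ip a A) = (Q * xa + I K a) / 2"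
    unfolding abc A_def Q_def xa_def by (rule ip_dq[OF K0 n(1)])
  have vb: "Re (ip b B) = (Q * xb + I K b) / 2"
    unfolding abc B_def Q_def xb_def by (rule ip_dq[OF K0 n(2)])
  have vc: "Re (ip c C) = (Q * xc + I K c) / 2"
    unfolding abc C_def Q_def xc_def by (rule ip_dq[OF K0 n(3)])
  have vs: "Re (ip (J \<sigma>) (Mul (qf K) \<sigma>)) = (Q * x\<sigma> - I K (J \<sigma>)) / 2"
    unfolding Q_def x\<sigma>_def by (rule q_identity_J[OF K0 \<sigma>])
  have RV: "Re (inner_V p (vV a b c) (vV A B C)) =
      (Q * (cA * xa) + cA * I K a) / 2 + (Q * (cB * xb) + cB * I K b) / 2 +
      (Q * (cC * xc) + cC * I K c) / 2 + (Q * (cS * x\<sigma>) - cS * I K (J \<sigma>)) / 2"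
    using m ABC by (simp add: inner_V_vV M\<sigma> \<sigma>_def[symmetric] va vb vc vs algebra_simps add_divide_distrib diff_divide_distrib)
  have "vH (Mul (qf K) a) (Mul (qf K) b) (Mul (qf K) c) = vV A B C"
    by (simp add: MJ vV_eq_vH)
  then have T1: "Re (inner_H p (vH f1 f2 ef) (vH (Mul (qf K) a) (Mul (qf K) b) (Mul (qf K) c))) =
      - Re (inner_V p (vV a b c) (vV A B C))
      - Re (complex_of_real (s1 p) * ev az * cnj (ev A)) - Re (complex_of_real (s3 p) * ev bz * cnj (ev B))
      - Re (complex_of_real (k1 p) * ev cz * cnj (ev C)) - Re (complex_of_real (k2 p) * ev (J cz) * cnj (ev (J C)))"
    by (simp only: weak_eq_vV[OF m ABC eq] uminus_complex.simps plus_complex.simps)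
  define ya where "ya = s1 p * (cmod (ev az))\<^sup>2"
  define yb where "yb = s3 p * (cmod (ev bz))\<^sup>2"
  define yc where "yc = k1 p * (cmod (ev cz))\<^sup>2"
  define ye where "ye = k2 p * (cmod (ev (J cz)))\<^sup>2"
  have y0: "0 \<le> ya" "0 \<le> yb" "0 \<le> yc" "0 \<le> ye"
    using gain_pos by (auto simp: ya_def yb_def yc_def ye_def)
  have ba: "- Re (complex_of_real (s1 p) * ev az * cnj (ev A)) \<le> Q * (cA * xa) / 2 + Q * (s1 p / (2 * cA)) * ya"
    unfolding evs xa_def ya_def by (rule boundary_Young[OF coeff_pos(1) Q gain_pos(1)])
  have bb: "- Re (complex_of_real (s3 p) * ev bz * cnj (ev B)) \<le> Q * (cB * xb) / 2 + Q * (s3 p / (2 * cB)) * yb"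
    unfolding evs xb_def yb_def by (rule boundary_Young[OF coeff_pos(2) Q gain_pos(2)])
  have bc: "- Re (complex_of_real (k1 p) * ev cz * cnj (ev C)) \<le> Q * (cC * xc) / 2 + Q * (k1 p / (2 * cC)) * yc"
    unfolding evs xc_def yc_def by (rule boundary_Young[OF coeff_pos(3) Q gain_pos(3)])
  define r where "r = k2 p * (nm one * Q)"
  have be: "- Re (complex_of_real (k2 p) * ev (J cz) * cnj (ev (J C))) \<le> cC * I K c / 8 + (2 * r\<^sup>2 / cC / k2 p) * ye"
  proof -
    have "- Re (complex_of_real (k2 p) * ev (J cz) * cnj (ev (J C))) \<le>
        cmod (complex_of_real (k2 p) * ev (J cz) * cnj (ev (J C)))"
      using abs_Re_le_cmod[of "complex_of_real (k2 p) * ev (J cz) * cnj (ev (J C))"] by linarith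
    also have "\<dots> = k2 p * cmod (ev (J cz)) * cmod (ev (J C))"
      using gain_pos by (simp add: norm_mult)
    also have "\<dots> \<le> k2 p * cmod (ev (J cz)) * (nm one * Q * nm c)"
      using ev_Mul_qf_bound[OF K0 m(3)] gain_pos
      unfolding MJ(3) Q_def by (intro mult_left_mono) auto
    also have "\<dots> = (r * cmod (ev (J cz))) * nm c" by (simp add: r_def mult_ac)
    also have "\<dots> \<le> ((4 / cC) * (r * cmod (ev (J cz)))\<^sup>2 + (nm c)\<^sup>2 / (4 / cC)) / 2"
      using weighted_Young[of "4 / cC" "r * cmod (ev (J cz))" "nm c"] coeff_pos by simp
    also have "\<dots> = (2 * r\<^sup>2 / cC / k2 p) * ye + (cC / 8) * (nm c)\<^sup>2"
      using gain_pos coeff_pos by (simp add: ye_def power_mult_distrib field_simps)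
    also have "(cC / 8) * (nm c)\<^sup>2 \<le> (cC / 8) * I K c"
    proof -
      have "1 * (nm c)\<^sup>2 \<le> K * (nm c)\<^sup>2" using K4 by (intro mult_right_mono) auto
      then have "(nm c)\<^sup>2 \<le> I K c" using I_lower[OF K0 m(3)] by linarith
      then show ?thesis using coeff_pos by (intro mult_left_mono) auto
    qed
    finally show ?thesis by simp
  qed
  have T2: "Re (inner_H p (vV az bz cz) (vH (Mul (qf K) az) (Mul (qf K) bz) (Mul (qf K) cz))) =
      rA * Re (ip (J az) (Mul (qf K) az)) + rB * Re (ip (J bz) (Mul (qf K) bz)) +
      rW * Re (ip (J (J cz)) (J (Mul (qf K) cz))) + rK * Re (ip (J cz) (Mul (qf K) cz))"
    unfolding vV_eq_vH using m by (simp add: inner_H_vH)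
  have za: "rA * Re (ip (J az) (Mul (qf K) az)) = Q * (rA / (2 * s1 p)) * ya - rA * I K (J az) / 2"
    using gain_pos by (simp add: q_identity_J[OF K0 m(4)] Q_def ya_def field_simps)
  have zb: "rB * Re (ip (J bz) (Mul (qf K) bz)) = Q * (rB / (2 * s3 p)) * yb - rB * I K (J bz) / 2"
    using gain_pos by (simp add: q_identity_J[OF K0 m(5)] Q_def yb_def field_simps)
  have zc: "rK * Re (ip (J cz) (Mul (qf K) cz)) = Q * (rK / (2 * k1 p)) * yc - rK * I K (J cz) / 2"
    using gain_pos by (simp add: q_identity_J[OF K0 m(6)] Q_def yc_def field_simps)
  have Inn: "0 \<le> I K (J (J cz))" "0 \<le> I K (J cz)" "0 \<le> I K a" "0 \<le> I K b" "0 \<le> I K c"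
    "0 \<le> I K (J az)" "0 \<le> I K (J bz)"
    using m by (auto intro!: I_nonneg[OF K0])
  have ze: "rW * Re (ip (J (J cz)) (J (Mul (qf K) cz))) \<le>
      (Q * rW / 2 / k2 p) * ye - rW * I K (J (J cz)) / 2 + rW * I K (J (J cz)) / 4 + rK * I K (J cz) / 4"
  proof -
    have "rW * Re (ip (J (J cz)) (J (Mul (qf K) cz))) \<le>
        rW * ((Q * (cmod (ev (J cz)))\<^sup>2 - I K (J (J cz))) / 2 + (I K (J (J cz)) + I K (J cz)) / K)"
      unfolding Q_def using coeff_pos by (intro mult_left_mono inertia_identity[OF K0 m(6)]) auto
    also have "\<dots> = (Q * rW / 2 / k2 p) * ye - rW * I K (J (J cz)) / 2 +
        (rW / K) * I K (J (J cz)) + (rW / K) * I K (J cz)"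
      using gain_pos K0 by (simp add: ye_def field_simps)
    also have "(rW / K) * I K (J (J cz)) \<le> (rW / 4) * I K (J (J cz))"
      using K4 coeff_pos Inn by (intro mult_right_mono) (auto simp: field_simps)
    also have "(rW / K) * I K (J cz) \<le> (rK / 4) * I K (J cz)"
      using K Inn by (intro mult_right_mono) (auto simp: weight_large_def)
    finally show ?thesis by simp
  qed
  have zs: "cS * I K (J \<sigma>) / 2 \<le> cS * exp (K * len p) * x\<sigma> + cA * I K a / 4 + cB * I K b / 4 + cC * I K c / 8"
  proof -
    have "I K (J \<sigma>) \<le> 2 * exp (K * len p) * x\<sigma> + (4 / K\<^sup>2) * I K \<sigma>"
      using Hardy[OF K0 \<sigma>, of 0] by (simp add: J_eq_aff x\<sigma>_def)
    also have "(4 / K\<^sup>2) * I K \<sigma> \<le> (4 / K\<^sup>2) * (3 * (I K a + I K b + hh\<^sup>2 * I K c))"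
      unfolding \<sigma>_def sh_def using K0 by (intro mult_left_mono I_sum3 m) auto
    finally have "(cS / 2) * I K (J \<sigma>) \<le>
        (cS / 2) * (2 * exp (K * len p) * x\<sigma> + (4 / K\<^sup>2) * (3 * (I K a + I K b + hh\<^sup>2 * I K c)))"
      using coeff_pos by (intro mult_left_mono) auto
    also have "\<dots> = cS * exp (K * len p) * x\<sigma> + (6 * cS / K\<^sup>2) * I K a + (6 * cS / K\<^sup>2) * I K b +
        (6 * cS * hh\<^sup>2 / K\<^sup>2) * I K c"
      by (simp add: algebra_simps)
    also have "\<dots> \<le> cS * exp (K * len p) * x\<sigma> + (cA / 4) * I K a + (cB / 4) * I K b + (cC / 8) * I K c"
      using K Inn by (intro add_mono mult_right_mono order_refl) (auto simp: weight_large_def)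
    finally show ?thesis by simp
  qed
  define Ma where "Ma = Q * (rA / (2 * s1 p)) + Q * (s1 p / (2 * cA))"
  define Mb where "Mb = Q * (rB / (2 * s3 p)) + Q * (s3 p / (2 * cB))"
  define Mc where "Mc = Q * (rK / (2 * k1 p)) + Q * (k1 p / (2 * cC))"
  define Me where "Me = Q * rW / 2 / k2 p + 2 * r\<^sup>2 / cC / k2 p"
  have Mnn: "0 \<le> Ma" "0 \<le> Mb" "0 \<le> Mc" "0 \<le> Me"
    using Q gain_pos coeff_pos by (auto simp: Ma_def Mb_def Mc_def Me_def)
  have Mm: "mult_const K = Ma + Mb + Mc + Me"
    by (simp add: mult_const_def Ma_def Mb_def Mc_def Me_def Q_def r_def distrib_left add_divide_distrib)
  have dd: "diss az bz cz = ya + yb + yc + ye"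
    by (simp add: diss_def ya_def yb_def yc_def ye_def)
  have "Ma * ya \<le> mult_const K * ya" "Mb * yb \<le> mult_const K * yb" "Mc * yc \<le> mult_const K * yc"
    "Me * ye \<le> mult_const K * ye"
    using Mnn y0 by (auto intro!: mult_right_mono simp: Mm)
  then have bound: "Ma * ya + Mb * yb + Mc * yc + Me * ye \<le> mult_const K * diss az bz cz"
    by (simp add: dd distrib_left)
  have ex: "Ma * ya = Q * (rA / (2 * s1 p)) * ya + Q * (s1 p / (2 * cA)) * ya"
    "Mb * yb = Q * (rB / (2 * s3 p)) * yb + Q * (s3 p / (2 * cB)) * yb"
    "Mc * yc = Q * (rK / (2 * k1 p)) * yc + Q * (k1 p / (2 * cC)) * yc"
    "Me * ye = (Q * rW / 2 / k2 p) * ye + (2 * r\<^sup>2 / cC / k2 p) * ye"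
    by (simp_all only: Ma_def Mb_def Mc_def Me_def distrib_right)
  have nnx: "0 \<le> Q * (cS * x\<sigma>)" using Q coeff_pos by (simp add: x\<sigma>_def)
  have pos: "0 \<le> rA * I K (J az)" "0 \<le> rB * I K (J bz)"
    using Inn coeff_pos by auto
  have es: "- (1/4) * energy_sum K a b c az bz cz = - (cA * I K a) / 4 - (cB * I K b) / 4 - (cC * I K c) / 4 -
      (rA * I K (J az)) / 4 - (rB * I K (J bz)) / 4 - (rW * I K (J (J cz))) / 4 - (rK * I K (J cz)) / 4"
    by (simp add: energy_sum_def add_divide_distrib)
  have arith: "- ((qa + PA) / 2 + (qb + PB) / 2 + (qc + PC) / 2 + (qs - S) / 2) - ra - rb - rc - re +
      (ta + tb + tw + tk) \<le>
      - PA / 4 - PB / 4 - PC / 4 - EA / 4 - EB / 4 - EW / 4 - EK / 4 + ex + D"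
    if h: "- ra \<le> qa / 2 + ma" "- rb \<le> qb / 2 + mb" "- rc \<le> qc / 2 + mc" "- re \<le> PC / 8 + me"
      and t: "ta = na - EA / 2" "tb = nb - EB / 2" "tk = nk - EK / 2"
      "tw \<le> nw - EW / 2 + EW / 4 + EK / 4"
      and S: "S / 2 \<le> ex + PA / 4 + PB / 4 + PC / 8"
      and D: "na + ma + (nb + mb) + (nk + mc) + (nw + me) \<le> D"
      and nn: "0 \<le> qs" "0 \<le> EA" "0 \<le> EB"
    for qa PA qb PB qc PC qs S ra rb rc re ta tb tw tk EA EB EW EK ex D ma mb mc me na nb nk nw :: real
  proof -
    have 1: "- ra - rb - rc - re \<le> qa / 2 + qb / 2 + qc / 2 + PC / 8 + (ma + mb + mc + me)"
      using h by linarith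
    have 2: "ta + tb + tw + tk \<le> (na + nb + nk + nw) - EA / 2 - EB / 2 - EW / 4 - EK / 4"
      using t by linarith
    have 3: "- ra - rb - rc - re + (ta + tb + tw + tk) \<le>
        qa / 2 + qb / 2 + qc / 2 + PC / 8 + D - EA / 2 - EB / 2 - EW / 4 - EK / 4"
      using 1 2 D by linarith
    have 4: "- ((qa + PA) / 2 + (qb + PB) / 2 + (qc + PC) / 2 + (qs - S) / 2) \<le>
        - qa / 2 - qb / 2 - qc / 2 - PA / 4 - PB / 4 - PC / 2 + PC / 8 + ex"
      using S nn(1) by (simp add: field_simps)
    show ?thesis using 3 4 nn(2,3) by linarith
  qed
  show ?thesis
    unfolding T1 T2 RV es x\<sigma>_def[symmetric] \<sigma>_def[symmetric]
    by (rule arith[OF ba bb bc be za zb zc ze zs bound[unfolded ex] nnx pos])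
qed

end

section \<open>Control of the shear trace\<close>

context rao_nakra
begin

text \<open>The functional \<open>y \<mapsto> (- y\<^sub>1 + y\<^sub>2 + H y\<^sub>3')(L)\<close> is represented in the elastic inner product by
  an explicit displacement: all three strains are multiples of \<open>cosh (\<mu> x) / cosh (\<mu> L)\<close>, where
  \<open>\<mu>\<close> is chosen so that the shear term cancels the derivative left by integration by parts.\<close>

lemma shear_trace_representation:
  "\<exists>ea\<in>L2 (len p). \<exists>eb\<in>L2 (len p). \<exists>ec\<in>L2 (len p). \<forall>a\<in>L2 (len p). \<forall>b\<in>L2 (len p). \<forall>c\<in>L2 (len p).
    inner_V p (vV a b c) (vV ea eb ec) = ev (sh a b c)"
proof -
  define \<kappa> where "\<kappa> = 1 / cA + 1 / cB + hh\<^sup>2 / cC"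
  have \<kappa>: "\<kappa> > 0" using coeff_pos by (simp add: \<kappa>_def add_pos_nonneg add_pos_pos)
  define \<mu> where "\<mu> = sqrt (cS * \<kappa>)"
  have \<mu>2: "\<mu> * \<mu> = cS * \<kappa>" using \<kappa> coeff_pos by (simp add: \<mu>_def)
  define r where "r x = cosh (\<mu> * x) / cosh (\<mu> * len p)" for x
  define r' where "r' x = \<mu> * sinh (\<mu> * x) / cosh (\<mu> * len p)" for x
  have ch: "cosh (\<mu> * len p) \<noteq> 0" using cosh_real_pos[of "\<mu> * len p"] by linarith
  have dr: "(r has_real_derivative r' x) (at x)" for x
    unfolding r_def r'_def using ch by (auto intro!: derivative_eq_intros)
  have dr': "(r' has_real_derivative (\<mu> * \<mu>) * r x) (at x)" for x
    unfolding r_def r'_def using ch by (auto intro!: derivative_eq_intros)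
  have cr: "continuous_on S r" "continuous_on S r'" for S
    by (rule continuous_at_imp_continuous_on, blast intro: DERIV_isCont dr dr')+
  have rL: "r (len p) = 1" "r' 0 = 0" using ch by (auto simp: r_def r'_def)
  have one_aff: "aff 1 0 = one" by (simp add: aff_def scaleC_one)
  have z: "0 \<in> L2 (len p)" by simp
  have Mul0: "Mul s 0 = 0" if "continuous_on {0..len p} s" for s
    using Mul_scale[OF that z, of 0] by simp
  define \<theta> where "\<theta> = Mul r one"
  define \<theta>' where "\<theta>' = Mul r' one"
  have m: "\<theta> \<in> L2 (len p)" "\<theta>' \<in> L2 (len p)" using cr by (auto simp: \<theta>_def \<theta>'_def)
  have \<theta>_aff: "\<theta> = complex_of_real (r 0) *\<^sub>C one + J \<theta>'"
    using Mul_aff(1)[OF dr cr(2) z, of 1, unfolded one_aff] cr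
    by (simp add: Mul0 \<theta>_def \<theta>'_def aff_def)
  have ev\<theta>': "ev \<theta>' = complex_of_real (1 - r 0)"
    using Mul_aff(2)[OF dr cr(2) z, of 1, unfolded one_aff] cr by (simp add: Mul0 \<theta>'_def rL)
  have crr: "continuous_on UNIV (\<lambda>x. (\<mu> * \<mu>) * r x)" by (intro continuous_intros cr)
  have J\<theta>: "\<theta>' = complex_of_real (cS * \<kappa>) *\<^sub>C J \<theta>"
  proof -
    have "\<theta>' = J (Mul (\<lambda>x. (\<mu> * \<mu>) * r x) one + Mul r' 0)"
      using Mul_aff(1)[OF dr' crr z, of 1, unfolded one_aff] by (simp add: \<theta>'_def rL aff_def)
    also have "\<dots> = J (complex_of_real (cS * \<kappa>) *\<^sub>C \<theta>)"
      using cr by (simp add: Mul0 Mul_cmult \<theta>_def \<mu>2)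
    finally show ?thesis using m by (simp add: J_scale)
  qed
  define ea where "ea = complex_of_real (- (1 / cA)) *\<^sub>C \<theta>"
  define eb where "eb = complex_of_real (1 / cB) *\<^sub>C \<theta>"
  define ec where "ec = complex_of_real (hh / cC) *\<^sub>C \<theta>"
  have e: "ea \<in> L2 (len p)" "eb \<in> L2 (len p)" "ec \<in> L2 (len p)"
    using m by (auto simp: ea_def eb_def ec_def)
  have she: "sh ea eb ec = complex_of_real \<kappa> *\<^sub>C \<theta>"
  proof -
    have "sh ea eb ec = complex_of_real (1 / cA) *\<^sub>C \<theta> + complex_of_real (1 / cB) *\<^sub>C \<theta> +
        (complex_of_real hh * complex_of_real (hh / cC)) *\<^sub>C \<theta>"
      unfolding sh_def ea_def eb_def ec_def of_real_minus scaleC_minus_left scaleC_scaleC by simp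
    also have "\<dots> = (complex_of_real (1 / cA) + complex_of_real (1 / cB) +
        complex_of_real hh * complex_of_real (hh / cC)) *\<^sub>C \<theta>"
      by (simp only: scaleC_add_left)
    also have "complex_of_real (1 / cA) + complex_of_real (1 / cB) +
        complex_of_real hh * complex_of_real (hh / cC) = complex_of_real \<kappa>"
      by (simp add: \<kappa>_def power2_eq_square)
    finally show ?thesis .
  qed
  have "inner_V p (vV a b c) (vV ea eb ec) = ev (sh a b c)"
    if n: "a \<in> L2 (len p)" "b \<in> L2 (len p)" "c \<in> L2 (len p)" for a b c
  proof -
    define \<sigma> where "\<sigma> = sh a b c"
    have \<sigma>: "\<sigma> \<in> L2 (len p)" using n by (auto simp: \<sigma>_def)
    have "inner_V p (vV a b c) (vV ea eb ec) = complex_of_real cA * ip a ea + complex_of_real cB * ip b eb +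
        complex_of_real cC * ip c ec + complex_of_real cS * ip (J \<sigma>) (J (sh ea eb ec))"
      using n e by (simp add: inner_V_vV \<sigma>_def)
    also have "complex_of_real cA * ip a ea = - ip a \<theta>"
      using n m coeff_pos by (simp add: ea_def L2.ip_scale_right)
    also have "complex_of_real cB * ip b eb = ip b \<theta>"
      using n m coeff_pos by (simp add: eb_def L2.ip_scale_right)
    also have "complex_of_real cC * ip c ec = complex_of_real hh * ip c \<theta>"
      using n m coeff_pos by (simp add: ec_def L2.ip_scale_right)
    also have "- ip a \<theta> + ip b \<theta> + complex_of_real hh * ip c \<theta> = ip \<sigma> \<theta>"
      using n m by (simp only: \<sigma>_def sh_def L2.ip_add_left L2.ip_minus_left L2.ip_scale_left
          L2.add_mem L2.minus_mem L2.scale_mem)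
    also have "complex_of_real cS * ip (J \<sigma>) (J (sh ea eb ec)) = ip (J \<sigma>) \<theta>'"
      using \<sigma> m by (simp add: she J\<theta> J_scale L2.ip_scale_right)
    also have "ip \<sigma> \<theta> + ip (J \<sigma>) \<theta>' = complex_of_real (r 0) * ev \<sigma> + (ip (J \<sigma>) \<theta>' + ip \<sigma> (J \<theta>'))"
      using \<sigma> m by (subst \<theta>_aff) (simp add: L2.ip_add_right L2.ip_scale_right ev_eq_ip)
    also have "\<dots> = ev \<sigma>"
      using by_parts[OF \<sigma> m(2)] by (simp add: ev\<theta>' algebra_simps)
    finally show ?thesis by (simp add: \<sigma>_def)
  qed
  with e show ?thesis by blast
qed

text \<open>The multiplier is the fixed displacement \<open>\<eta>\<close> times the shear trace; its elastic part
  reproduces the square of the trace, and everything else is paid for by the dissipation.\<close>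

lemma shear_trace_estimate:
  assumes e: "ea \<in> L2 (len p)" "eb \<in> L2 (len p)" "ec \<in> L2 (len p)"
    and rep: "\<And>a b c. \<lbrakk>a \<in> L2 (len p); b \<in> L2 (len p); c \<in> L2 (len p)\<rbrakk> \<Longrightarrow>
      inner_V p (vV a b c) (vV ea eb ec) = ev (sh a b c)"
    and \<delta>: "\<delta> > 0"
  obtains C where "C \<ge> 0" "\<And>a b c az bz cz f. \<lbrakk>a \<in> L2 (len p); b \<in> L2 (len p); c \<in> L2 (len p);
      az \<in> L2 (len p); bz \<in> L2 (len p); cz \<in> L2 (len p); weak_eq a b c az bz cz f\<rbrakk> \<Longrightarrow>
    Re (cnj (ev (sh az bz cz)) * inner_H p (vV az bz cz) (vV ea eb ec) +
        cnj (ev (sh a b c)) * inner_H p f (vV ea eb ec)) \<le>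
    - (1/2) * (cmod (ev (sh a b c)))\<^sup>2 + \<delta> * (HH.nrm (vV az bz cz))\<^sup>2 + C * diss az bz cz"
proof -
  define \<eta> where "\<eta> = vV ea eb ec"
  have \<eta>: "\<eta> \<in> H_space p" using e by (auto simp: \<eta>_def vV_eq_vH)
  define c1 where "c1 = s1 p * (1 / sqrt (s1 p)) * cmod (ev ea) + s3 p * (1 / sqrt (s3 p)) * cmod (ev eb) +
      k1 p * (1 / sqrt (k1 p)) * cmod (ev ec) + k2 p * (1 / sqrt (k2 p)) * cmod (ev (J ec))"
  define c2 where "c2 = 1 / sqrt (s1 p) + 1 / sqrt (s3 p) + \<bar>hh\<bar> * (1 / sqrt (k1 p))"
  define C where "C = c1\<^sup>2 / 2 + (c2 * HH.nrm \<eta>)\<^sup>2 / (4 * \<delta>)"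
  have C: "C \<ge> 0" using \<delta> by (simp add: C_def)
  have "Re (cnj (ev (sh az bz cz)) * inner_H p (vV az bz cz) \<eta> + cnj (ev (sh a b c)) * inner_H p f \<eta>) \<le>
      - (1/2) * (cmod (ev (sh a b c)))\<^sup>2 + \<delta> * (HH.nrm (vV az bz cz))\<^sup>2 + C * diss az bz cz"
    if m: "a \<in> L2 (len p)" "b \<in> L2 (len p)" "c \<in> L2 (len p)"
      "az \<in> L2 (len p)" "bz \<in> L2 (len p)" "cz \<in> L2 (len p)" and eq: "weak_eq a b c az bz cz f"
    for a b c az bz cz f
  proof -
    define d where "d = sqrt (diss az bz cz)"
    have d: "d \<ge> 0" "d\<^sup>2 = diss az bz cz" using diss_nonneg by (auto simp: d_def)
    have t: "cmod (ev az) \<le> (1 / sqrt (s1 p)) * d" "cmod (ev bz) \<le> (1 / sqrt (s3 p)) * d"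
      "cmod (ev cz) \<le> (1 / sqrt (k1 p)) * d" "cmod (ev (J cz)) \<le> (1 / sqrt (k2 p)) * d"
      using gain_pos by (auto intro!: le_of_weighted_sq[OF _ _ d(1)] simp: d(2) diss_def simp del: times_divide_eq_left)
    define x where "x = ev (sh a b c)"
    define Bd where "Bd = complex_of_real (s1 p) * ev az * cnj (ev ea) + complex_of_real (s3 p) * ev bz * cnj (ev eb) +
      complex_of_real (k1 p) * ev cz * cnj (ev ec) + complex_of_real (k2 p) * ev (J cz) * cnj (ev (J ec))"
    have f\<eta>: "inner_H p f \<eta> = - (x + Bd)"
      unfolding \<eta>_def weak_eq_vV[OF m e eq] rep[OF m(1-3)] x_def Bd_def by (simp add: add.assoc)
    have tri4: "cmod (z1 + z2 + z3 + z4) \<le> cmod z1 + cmod z2 + cmod z3 + cmod z4" for z1 z2 z3 z4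
      using norm_triangle_ineq[of "z1 + z2 + z3" z4] norm_triangle_ineq[of "z1 + z2" z3] norm_triangle_ineq[of z1 z2]
      by linarith
    have "cmod Bd \<le> s1 p * cmod (ev az) * cmod (ev ea) + s3 p * cmod (ev bz) * cmod (ev eb) +
        k1 p * cmod (ev cz) * cmod (ev ec) + k2 p * cmod (ev (J cz)) * cmod (ev (J ec))"
      unfolding Bd_def using gain_pos by (rule_tac order_trans[OF tri4]) (simp add: norm_mult)
    also have "\<dots> \<le> s1 p * ((1 / sqrt (s1 p)) * d) * cmod (ev ea) + s3 p * ((1 / sqrt (s3 p)) * d) * cmod (ev eb) +
        k1 p * ((1 / sqrt (k1 p)) * d) * cmod (ev ec) + k2 p * ((1 / sqrt (k2 p)) * d) * cmod (ev (J ec))"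
      using gain_pos t by (intro add_mono mult_right_mono mult_left_mono) auto
    also have "\<dots> = c1 * d" by (simp add: c1_def algebra_simps)
    finally have Bd: "cmod Bd \<le> c1 * d" .
    have evsh: "ev (sh az bz cz) = - ev az + ev bz + complex_of_real hh * ev cz"
      using m by (simp only: sh_def ev_add ev_minus ev_scale L2.add_mem L2.minus_mem L2.scale_mem)
    have "cmod (ev (sh az bz cz)) \<le> cmod (ev az) + cmod (ev bz) + \<bar>hh\<bar> * cmod (ev cz)"
      unfolding evsh
      using norm_triangle_ineq[of "- ev az + ev bz" "complex_of_real hh * ev cz"] norm_triangle_ineq[of "- ev az" "ev bz"]
      by (simp add: norm_mult)
    also have "\<dots> \<le> (1 / sqrt (s1 p)) * d + (1 / sqrt (s3 p)) * d + \<bar>hh\<bar> * ((1 / sqrt (k1 p)) * d)"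
      using t by (intro add_mono mult_left_mono) auto
    also have "\<dots> = c2 * d" by (simp add: c2_def algebra_simps)
    finally have lz: "cmod (ev (sh az bz cz)) \<le> c2 * d" .
    define N where "N = HH.nrm (vV az bz cz)"
    have zH: "vV az bz cz \<in> H_space p" using m by (auto simp: vV_eq_vH)
    have 1: "Re (cnj (ev (sh az bz cz)) * inner_H p (vV az bz cz) \<eta>) \<le> \<delta> * N\<^sup>2 + (c2 * HH.nrm \<eta>)\<^sup>2 / (4 * \<delta>) * d\<^sup>2"
    proof -
      have "Re (cnj (ev (sh az bz cz)) * inner_H p (vV az bz cz) \<eta>) \<le>
          cmod (ev (sh az bz cz)) * cmod (inner_H p (vV az bz cz) \<eta>)"
        using complex_Re_le_cmod[of "cnj (ev (sh az bz cz)) * inner_H p (vV az bz cz) \<eta>"]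
        by (simp add: norm_mult)
      also have "\<dots> \<le> (c2 * d) * (N * HH.nrm \<eta>)"
        unfolding N_def using d lz order_trans[OF norm_ge_zero lz]
        by (intro mult_mono HH.Cauchy_Schwarz zH \<eta>) auto
      also have "\<dots> = N * (c2 * HH.nrm \<eta> * d)" by (simp add: mult_ac)
      also have "\<dots> \<le> ((2 * \<delta>) * N\<^sup>2 + (c2 * HH.nrm \<eta> * d)\<^sup>2 / (2 * \<delta>)) / 2"
        using weighted_Young[of "2 * \<delta>" N "c2 * HH.nrm \<eta> * d"] \<delta> by simp
      also have "\<dots> = \<delta> * N\<^sup>2 + (c2 * HH.nrm \<eta>)\<^sup>2 / (4 * \<delta>) * d\<^sup>2"
        using \<delta> by (simp add: power_mult_distrib field_simps)
      finally show ?thesis .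
    qed
    have 2: "Re (cnj x * inner_H p f \<eta>) \<le> - (1/2) * (cmod x)\<^sup>2 + c1\<^sup>2 / 2 * d\<^sup>2"
    proof -
      have "cnj x * inner_H p f \<eta> = - (x * cnj x) - cnj x * Bd"
        unfolding f\<eta> by (simp add: algebra_simps)
      also have "x * cnj x = complex_of_real ((cmod x)\<^sup>2)" by (rule complex_norm_square[symmetric])
      finally have "Re (cnj x * inner_H p f \<eta>) = - (cmod x)\<^sup>2 - Re (cnj x * Bd)"
        by (simp only: minus_complex.simps uminus_complex.simps Re_complex_of_real)
      moreover have "- Re (cnj x * Bd) \<le> cmod x * cmod Bd"
        using abs_Re_le_cmod[of "cnj x * Bd"] by (simp only: norm_mult complex_mod_cnj abs_le_iff)
      ultimately have A: "Re (cnj x * inner_H p f \<eta>) \<le> - (cmod x)\<^sup>2 + cmod x * cmod Bd" by linarith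
      have B: "cmod x * cmod Bd \<le> (cmod x)\<^sup>2 / 2 + (cmod Bd)\<^sup>2 / 2"
        using sum_squares_bound[of "cmod x" "cmod Bd"] by simp
      have D: "(cmod Bd)\<^sup>2 \<le> c1\<^sup>2 * d\<^sup>2"
        using power_mono[OF Bd norm_ge_zero, of 2] by (simp add: power_mult_distrib)
      show ?thesis using A B D by simp
    qed
    have "C * diss az bz cz = c1\<^sup>2 / 2 * d\<^sup>2 + (c2 * HH.nrm \<eta>)\<^sup>2 / (4 * \<delta>) * d\<^sup>2"
      by (simp only: C_def d(2)[symmetric] distrib_right)
    then show ?thesis using 1 2 unfolding N_def x_def by simp
  qed
  with C that show ?thesis unfolding \<eta>_def by blast
qed

section \<open>The Lyapunov functional\<close>

text \<open>The multiplier and the shear trace as maps on displacements, so that the Lyapunov functional is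
  a bilinear form on the whole state space and not only on the domain.\<close>

definition Psi :: "real \<Rightarrow> triple \<Rightarrow> triple" where
  "Psi K = (\<lambda>(y1, y2, y3). vH (Mul (qf K) (wderiv (len p) y1)) (Mul (qf K) (wderiv (len p) y2))
     (Mul (qf K) (wderiv (len p) (wderiv (len p) y3))))"

definition ell :: "triple \<Rightarrow> complex" where
  "ell = (\<lambda>(y1, y2, y3). ev (sh (wderiv (len p) y1) (wderiv (len p) y2) (wderiv (len p) (wderiv (len p) y3))))"

lemma Psi_vV:
  "\<lbrakk>a \<in> L2 (len p); b \<in> L2 (len p); c \<in> L2 (len p)\<rbrakk> \<Longrightarrow>
    Psi K (vV a b c) = vH (Mul (qf K) a) (Mul (qf K) b) (Mul (qf K) c)"
  by (simp add: Psi_def vV_def)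

lemma ell_vV:
  "\<lbrakk>a \<in> L2 (len p); b \<in> L2 (len p); c \<in> L2 (len p)\<rbrakk> \<Longrightarrow> ell (vV a b c) = ev (sh a b c)"
  by (simp add: ell_def vV_def)

lemma Psi_mem [simp]: "y \<in> V_space p \<Longrightarrow> Psi K y \<in> H_space p"
  by (auto simp: V_iff Psi_vV)

lemma Psi_add: "\<lbrakk>y \<in> V_space p; y' \<in> V_space p\<rbrakk> \<Longrightarrow> Psi K (y + y') = Psi K y + Psi K y'"
  by (auto simp: V_iff vV_add Psi_vV vH_add Mul_add)

lemma Psi_scale: "y \<in> V_space p \<Longrightarrow> Psi K (k *\<^sub>C y) = k *\<^sub>C Psi K y"
  by (auto simp: V_iff vV_scale Psi_vV vH_scale Mul_scale)

lemma ell_add: "\<lbrakk>y \<in> V_space p; y' \<in> V_space p\<rbrakk> \<Longrightarrow> ell (y + y') = ell y + ell y'"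
  by (auto simp: V_iff vV_add ell_vV sh_add ev_add)

lemma ell_scale: "y \<in> V_space p \<Longrightarrow> ell (k *\<^sub>C y) = k * ell y"
  by (auto simp: V_iff vV_scale ell_vV sh_scale ev_scale)

lemma Psi_bound:
  assumes K: "K > 0"
  obtains C where "C \<ge> 0" "\<And>y. y \<in> V_space p \<Longrightarrow> HH.nrm (Psi K y) \<le> C * VV.nrm y"
proof -
  define Q where "Q = qf K (len p)"
  have Q: "Q \<ge> 0" unfolding Q_def by (rule qf_L_nonneg[OF K])
  define C where "C = sqrt (rA * (Q * (1 / sqrt cA))\<^sup>2 + rB * (Q * (1 / sqrt cB))\<^sup>2 +
      (rW * (2 * len p)\<^sup>2 + rK) * (Q * (1 / sqrt cC))\<^sup>2)"
  have arg: "0 \<le> rA * (Q * (1 / sqrt cA))\<^sup>2 + rB * (Q * (1 / sqrt cB))\<^sup>2 +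
      (rW * (2 * len p)\<^sup>2 + rK) * (Q * (1 / sqrt cC))\<^sup>2"
    using coeff_pos by (intro add_nonneg_nonneg mult_nonneg_nonneg) auto
  have "HH.nrm (Psi K y) \<le> C * VV.nrm y" if y: "y \<in> V_space p" for y
  proof -
    obtain a b c where m: "a \<in> L2 (len p)" "b \<in> L2 (len p)" "c \<in> L2 (len p)" "y = vV a b c"
      using y unfolding V_iff by blast
    define N where "N = VV.nrm y"
    have N: "N \<ge> 0" unfolding N_def using y by simp
    have Mb: "nm (Mul (qf K) u) \<le> Q * nm u" if "u \<in> L2 (len p)" for u
      unfolding Q_def by (rule Mul_bound[OF qf_cont that]) (rule qf_mono[OF K])
    note cc = VV_coords[OF m(1-3), folded m(4), folded N_def]
    have b: "nm (Mul (qf K) a) \<le> Q * (1 / sqrt cA) * N" "nm (Mul (qf K) b) \<le> Q * (1 / sqrt cB) * N"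
      "nm (Mul (qf K) c) \<le> Q * (1 / sqrt cC) * N"
      using order_trans[OF Mb[OF m(1)] mult_left_mono[OF cc(1) Q]] order_trans[OF Mb[OF m(2)] mult_left_mono[OF cc(2) Q]]
        order_trans[OF Mb[OF m(3)] mult_left_mono[OF cc(3) Q]] by (simp_all only: mult.assoc)
    have sq: "(nm (Mul (qf K) a))\<^sup>2 \<le> (Q * (1 / sqrt cA))\<^sup>2 * N\<^sup>2" "(nm (Mul (qf K) b))\<^sup>2 \<le> (Q * (1 / sqrt cB))\<^sup>2 * N\<^sup>2"
      "(nm (Mul (qf K) c))\<^sup>2 \<le> (Q * (1 / sqrt cC))\<^sup>2 * N\<^sup>2"
      using power_mono[OF b(1) L2.nrm_nonneg, of 2] power_mono[OF b(2) L2.nrm_nonneg, of 2]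
        power_mono[OF b(3) L2.nrm_nonneg, of 2] m
      by (simp_all only: power_mult_distrib Mul_mem qf_cont)
    have "HH.nrm (Psi K y) \<le> sqrt (rA * (nm (Mul (qf K) a))\<^sup>2 + rB * (nm (Mul (qf K) b))\<^sup>2 +
        (rW * (2 * len p)\<^sup>2 + rK) * (nm (Mul (qf K) c))\<^sup>2)"
      using m by (simp only: m(4) Psi_vV) (intro HH_nrm_le Mul_mem qf_cont)
    also have "\<dots> \<le> sqrt (rA * ((Q * (1 / sqrt cA))\<^sup>2 * N\<^sup>2) + rB * ((Q * (1 / sqrt cB))\<^sup>2 * N\<^sup>2) +
        (rW * (2 * len p)\<^sup>2 + rK) * ((Q * (1 / sqrt cC))\<^sup>2 * N\<^sup>2))"
      using coeff_pos by (intro real_sqrt_le_mono add_mono mult_left_mono sq) auto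
    also have "\<dots> = sqrt ((rA * (Q * (1 / sqrt cA))\<^sup>2 + rB * (Q * (1 / sqrt cB))\<^sup>2 +
        (rW * (2 * len p)\<^sup>2 + rK) * (Q * (1 / sqrt cC))\<^sup>2) * N\<^sup>2)"
      by (simp only: distrib_right mult.assoc)
    also have "\<dots> = C * N" unfolding C_def real_sqrt_mult using N by simp
    finally show ?thesis by (simp add: N_def)
  qed
  moreover have "C \<ge> 0" unfolding C_def using arg by simp
  ultimately show ?thesis by (rule_tac that) auto
qed

lemma ell_bound:
  obtains C where "C \<ge> 0" "\<And>y. y \<in> V_space p \<Longrightarrow> cmod (ell y) \<le> C * VV.nrm y"
proof -
  define C where "C = nm one * (1 / sqrt cA + 1 / sqrt cB + \<bar>hh\<bar> * (1 / sqrt cC))"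
  have "cmod (ell y) \<le> C * VV.nrm y" if y: "y \<in> V_space p" for y
  proof -
    obtain a b c where m: "a \<in> L2 (len p)" "b \<in> L2 (len p)" "c \<in> L2 (len p)" "y = vV a b c"
      using y unfolding V_iff by blast
    note cc = VV_coords[OF m(1-3), folded m(4)]
    have "nm (sh a b c) \<le> nm a + nm b + \<bar>hh\<bar> * nm c"
      by (rule nm_sh_le[OF m(1-3)])
    also have "\<dots> \<le> (1 / sqrt cA) * VV.nrm y + (1 / sqrt cB) * VV.nrm y + \<bar>hh\<bar> * ((1 / sqrt cC) * VV.nrm y)"
      by (intro add_mono mult_left_mono cc) auto
    also have "\<dots> = (1 / sqrt cA + 1 / sqrt cB + \<bar>hh\<bar> * (1 / sqrt cC)) * VV.nrm y"
      by (simp only: distrib_right mult.assoc)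
    finally have "nm one * nm (sh a b c) \<le> nm one * ((1 / sqrt cA + 1 / sqrt cB + \<bar>hh\<bar> * (1 / sqrt cC)) * VV.nrm y)"
      by (rule mult_left_mono) simp
    then show ?thesis
      using ev_bound[OF sh_mem[OF m(1-3)]] m by (simp add: ell_vV C_def mult.assoc)
  qed
  moreover have "C \<ge> 0" using coeff_pos by (simp add: C_def)
  ultimately show ?thesis by (rule_tac that) auto
qed

text \<open>Here the weight only matters through \<open>wt \<ge> K \<ge> 1\<close>, and the shear energy is recovered from the
  strains because \<open>J\<close> is bounded.\<close>

lemma energy_sum_lower:
  assumes K: "K \<ge> 1"
  obtains \<gamma> where "\<gamma> > 0" "\<And>a b c az bz cz. \<lbrakk>a \<in> L2 (len p); b \<in> L2 (len p); c \<in> L2 (len p);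
      az \<in> L2 (len p); bz \<in> L2 (len p); cz \<in> L2 (len p)\<rbrakk> \<Longrightarrow>
    \<gamma> * (ST.nrm (vV a b c, vV az bz cz))\<^sup>2 \<le> energy_sum K a b c az bz cz"
proof -
  define Y where "Y = cS * 3 * (2 * len p)\<^sup>2"
  have Y: "Y \<ge> 0" using coeff_pos by (simp add: Y_def)
  define X where "X = 1 + Y / cA + Y / cB + Y * hh\<^sup>2 / cC"
  have X1: "X \<ge> 1" using Y coeff_pos by (simp add: X_def)
  have "(1 / X) * (ST.nrm (vV a b c, vV az bz cz))\<^sup>2 \<le> energy_sum K a b c az bz cz"
    if m: "a \<in> L2 (len p)" "b \<in> L2 (len p)" "c \<in> L2 (len p)"
      "az \<in> L2 (len p)" "bz \<in> L2 (len p)" "cz \<in> L2 (len p)" for a b c az bz cz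
  proof -
    have low: "(nm u)\<^sup>2 \<le> I K u" if "u \<in> L2 (len p)" for u
    proof -
      have "1 * (nm u)\<^sup>2 \<le> K * (nm u)\<^sup>2" using K by (intro mult_right_mono) auto
      then show ?thesis using I_lower[of K u] K that by simp
    qed
    define S where "S = cA * (nm a)\<^sup>2 + cB * (nm b)\<^sup>2 + cC * (nm c)\<^sup>2"
    define R where "R = rA * (nm (J az))\<^sup>2 + rB * (nm (J bz))\<^sup>2 + rW * (nm (J (J cz)))\<^sup>2 + rK * (nm (J cz))\<^sup>2"
    have SR: "S + R \<le> energy_sum K a b c az bz cz"
    proof -
      have "S + R \<le> (cA * I K a + cB * I K b + cC * I K c) +
          (rA * I K (J az) + rB * I K (J bz) + rW * I K (J (J cz)) + rK * I K (J cz))"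
        unfolding S_def R_def using coeff_pos m by (intro add_mono mult_left_mono low) auto
      then show ?thesis by (simp add: energy_sum_def)
    qed
    have R: "(HH.nrm (vV az bz cz))\<^sup>2 = R" "R \<ge> 0"
      unfolding vV_eq_vH R_def using m coeff_pos by (auto simp: HH_nrm_sq intro!: add_nonneg_nonneg)
    have "(VV.nrm (vV a b c))\<^sup>2 \<le> (cA + Y) * (nm a)\<^sup>2 + (cB + Y) * (nm b)\<^sup>2 + (cC + Y * hh\<^sup>2) * (nm c)\<^sup>2"
    proof -
      have "(VV.nrm (vV a b c))\<^sup>2 \<le> (sqrt ((cA + Y) * (nm a)\<^sup>2 + (cB + Y) * (nm b)\<^sup>2 + (cC + Y * hh\<^sup>2) * (nm c)\<^sup>2))\<^sup>2"
        unfolding Y_def using m by (intro power_mono VV_nrm_le) auto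
      also have "\<dots> = (cA + Y) * (nm a)\<^sup>2 + (cB + Y) * (nm b)\<^sup>2 + (cC + Y * hh\<^sup>2) * (nm c)\<^sup>2"
        using Y coeff_pos by (intro real_sqrt_pow2 add_nonneg_nonneg mult_nonneg_nonneg) auto
      finally show ?thesis .
    qed
    also have "\<dots> \<le> (X * cA) * (nm a)\<^sup>2 + (X * cB) * (nm b)\<^sup>2 + (X * cC) * (nm c)\<^sup>2"
    proof -
      have p1: "X * cA = cA + Y + (Y / cB) * cA + (Y * hh\<^sup>2 / cC) * cA"
        using coeff_pos by (simp add: X_def distrib_right)
      have p2: "X * cB = cB + Y + (Y / cA) * cB + (Y * hh\<^sup>2 / cC) * cB"
        using coeff_pos by (simp add: X_def distrib_right)
      have p3: "X * cC = cC + Y * hh\<^sup>2 + (Y / cA) * cC + (Y / cB) * cC"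
        using coeff_pos by (simp add: X_def distrib_right)
      have q: "cA + Y \<le> X * cA" "cB + Y \<le> X * cB" "cC + Y * hh\<^sup>2 \<le> X * cC"
        unfolding p1 p2 p3 using Y coeff_pos by simp_all
      show ?thesis by (intro add_mono mult_right_mono q) auto
    qed
    also have "\<dots> = X * S" by (simp add: S_def algebra_simps)
    finally have VS: "(VV.nrm (vV a b c))\<^sup>2 \<le> X * S" .
    have "1 * R \<le> X * R" using X1 R by (intro mult_right_mono) auto
    then have "(ST.nrm (vV a b c, vV az bz cz))\<^sup>2 \<le> X * (S + R)"
      using VS R m V_subset_H by (subst ST_nrm_sq) (auto simp: distrib_left)
    also have "\<dots> \<le> X * energy_sum K a b c az bz cz"
      using SR X1 by (intro mult_left_mono) auto
    finally show ?thesis using X1 by (simp add: pos_divide_le_eq mult.commute)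
  qed
  then show ?thesis using X1 by (intro that[of "1 / X"]) auto
qed

lemma ST_ge:
  assumes "y \<in> V_space p" "z \<in> H_space p"
  shows "VV.nrm y \<le> ST.nrm (y, z)" "HH.nrm z \<le> ST.nrm (y, z)"
proof -
  have m: "(y, z) \<in> state_space p" using assms by (simp add: state_space_def)
  note sq = ST_nrm_sq[OF assms]
  show "VV.nrm y \<le> ST.nrm (y, z)" by (rule power2_le_imp_le) (use sq m in auto)
  show "HH.nrm z \<le> ST.nrm (y, z)" by (rule power2_le_imp_le) (use sq m in auto)
qed

text \<open>With the velocity as test function the elastic terms cancel and the damping terms remain.\<close>

lemma energy_dissipation:
  assumes m: "a \<in> L2 (len p)" "b \<in> L2 (len p)" "c \<in> L2 (len p)"
    "az \<in> L2 (len p)" "bz \<in> L2 (len p)" "cz \<in> L2 (len p)"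
    and f: "f \<in> H_space p" and eq: "weak_eq a b c az bz cz f"
  shows "Re (inner_state p (vV az bz cz, f) (vV a b c, vV az bz cz)) = - diss az bz cz"
proof -
  have sq: "Re (complex_of_real s * x * cnj x) = s * (cmod x)\<^sup>2" for s x
  proof -
    have "complex_of_real s * x * cnj x = complex_of_real (s * (cmod x)\<^sup>2)"
      by (simp only: of_real_mult complex_norm_square mult.assoc)
    then show ?thesis by (simp only: Re_complex_of_real)
  qed
  have V: "inner_V p (vV az bz cz) (vV a b c) = cnj (inner_V p (vV a b c) (vV az bz cz))"
    using m by (intro VV.ip_commute) auto
  have "inner_state p (vV az bz cz, f) (vV a b c, vV az bz cz) =
      cnj (inner_V p (vV a b c) (vV az bz cz)) + inner_H p f (vV az bz cz)"
    by (simp add: inner_state_def V)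
  also have "Re \<dots> = - diss az bz cz"
    unfolding weak_eq_vV[OF m m(4-6) eq] plus_complex.simps uminus_complex.simps sq
    by (simp add: diss_def)
  finally show ?thesis .
qed

theorem exponential_stability:
  assumes T: "C0_semigroup_on (state_space p) (norm_state p) T"
    and G: "generator_on (state_space p) (norm_state p) T (dom_calA p) (\<lambda>\<phi>. - (calA p \<phi> + op_B p \<phi>))"
  shows "\<exists>C>0. \<exists>\<omega>>0. \<forall>t\<ge>0. opnorm_on (state_space p) (norm_state p) (T t) \<le> C * exp (- \<omega> * t)"
proof -
  interpret S: csemigroup "state_space p" "inner_state p" T
    by unfold_locales (use T in \<open>simp add: norm_state_eq\<close>)
  obtain K where K: "weight_large K" using weight_large_ex by blast
  then have K1: "K \<ge> 1" "K > 0" by (auto simp: weight_large_def)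
  obtain ea eb ec where e: "ea \<in> L2 (len p)" "eb \<in> L2 (len p)" "ec \<in> L2 (len p)"
    and rep': "\<forall>a\<in>L2 (len p). \<forall>b\<in>L2 (len p). \<forall>c\<in>L2 (len p).
      inner_V p (vV a b c) (vV ea eb ec) = ev (sh a b c)"
    by (rule bexE[OF shear_trace_representation], elim bexE) (rule that)
  have rep: "inner_V p (vV a b c) (vV ea eb ec) = ev (sh a b c)"
    if "a \<in> L2 (len p)" "b \<in> L2 (len p)" "c \<in> L2 (len p)" for a b c
    using rep' that by simp
  define \<eta> where "\<eta> = vV ea eb ec"
  have \<eta>: "\<eta> \<in> H_space p" using e by (auto simp: \<eta>_def vV_eq_vH)
  obtain \<gamma> where \<gamma>: "\<gamma> > 0" and low: "\<And>a b c az bz cz. \<lbrakk>a \<in> L2 (len p); b \<in> L2 (len p); c \<in> L2 (len p);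
      az \<in> L2 (len p); bz \<in> L2 (len p); cz \<in> L2 (len p)\<rbrakk> \<Longrightarrow>
    \<gamma> * (ST.nrm (vV a b c, vV az bz cz))\<^sup>2 \<le> energy_sum K a b c az bz cz"
    using energy_sum_lower[OF K1(1)] by blast
  define C1 where "C1 = cS * exp (K * len p)"
  have C1: "C1 > 0" using coeff_pos by (simp add: C1_def)
  \<comment> \<open>\<open>A\<close> makes the second multiplier cancel the shear trace, \<open>\<delta>\<close> lets half of the interior decay
    survive that, and \<open>M\<close> makes the energy dominate the multiplier terms and pay all dissipation\<close>
  define A where "A = 2 * C1"
  have A: "A > 0" using C1 by (simp add: A_def)
  define \<delta> where "\<delta> = \<gamma> / (8 * A)"
  have \<delta>: "\<delta> > 0" using \<gamma> A by (simp add: \<delta>_def)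
  obtain C3 where C3: "C3 \<ge> 0" and trace: "\<And>a b c az bz cz f. \<lbrakk>a \<in> L2 (len p); b \<in> L2 (len p); c \<in> L2 (len p);
      az \<in> L2 (len p); bz \<in> L2 (len p); cz \<in> L2 (len p); weak_eq a b c az bz cz f\<rbrakk> \<Longrightarrow>
    Re (cnj (ev (sh az bz cz)) * inner_H p (vV az bz cz) (vV ea eb ec) +
        cnj (ev (sh a b c)) * inner_H p f (vV ea eb ec)) \<le>
    - (1/2) * (cmod (ev (sh a b c)))\<^sup>2 + \<delta> * (HH.nrm (vV az bz cz))\<^sup>2 + C3 * diss az bz cz"
    using shear_trace_estimate[OF e rep \<delta>] by blast
  obtain CP where CP: "CP \<ge> 0" "\<And>y. y \<in> V_space p \<Longrightarrow> HH.nrm (Psi K y) \<le> CP * VV.nrm y"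
    using Psi_bound[OF K1(2)] by blast
  obtain Cl where Cl: "Cl \<ge> 0" "\<And>y. y \<in> V_space p \<Longrightarrow> cmod (ell y) \<le> Cl * VV.nrm y"
    using ell_bound by blast
  define P where "P = CP + A * (Cl * HH.nrm \<eta>)"
  have P: "P \<ge> 0" using CP Cl A \<eta> by (simp add: P_def)
  define M where "M = 1 + P + \<bar>mult_const K\<bar> + A * C3"
  have M: "M \<ge> 1 + P" using A C3 by (simp add: M_def)
  define W where "W \<phi> \<phi>' = Re (inner_H p (snd \<phi>) (Psi K (fst \<phi>'))) +
      A * Re (cnj (ell (fst \<phi>')) * inner_H p (snd \<phi>) \<eta>)" for \<phi> \<phi>' :: state
  define B where "B \<phi> \<phi>' = M * Re (inner_state p \<phi> \<phi>') + W \<phi> \<phi>'" for \<phi> \<phi>'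
  have split: "fst \<phi> \<in> V_space p" "snd \<phi> \<in> H_space p" if "\<phi> \<in> state_space p" for \<phi>
    using that by (auto simp: state_space_def)
  have fs: "fst (k *\<^sub>C \<phi>) = k *\<^sub>C fst \<phi>" "snd (k *\<^sub>C \<phi>) = k *\<^sub>C snd \<phi>" for k and \<phi> :: state
    by (simp_all add: scaleC_prod_def)
  have W_bound: "\<bar>W \<phi> \<phi>'\<bar> \<le> P * (ST.nrm \<phi> * ST.nrm \<phi>')" if "\<phi> \<in> state_space p" "\<phi>' \<in> state_space p" for \<phi> \<phi>'
  proof -
    note s = split[OF that(1)] split[OF that(2)]
    have n1: "HH.nrm (snd \<phi>) \<le> ST.nrm \<phi>" using ST_ge(2)[OF s(1,2)] by simp
    have n2: "VV.nrm (fst \<phi>') \<le> ST.nrm \<phi>'" using ST_ge(1)[OF s(3,4)] by simp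
    have a: "\<bar>Re (inner_H p (snd \<phi>) (Psi K (fst \<phi>')))\<bar> \<le> ST.nrm \<phi> * (CP * ST.nrm \<phi>')"
    proof (rule order_trans[OF HH.Re_ip_le])
      show "HH.nrm (snd \<phi>) * HH.nrm (Psi K (fst \<phi>')) \<le> ST.nrm \<phi> * (CP * ST.nrm \<phi>')"
        using s n1 that order_trans[OF CP(2)[OF s(3)] mult_left_mono[OF n2 CP(1)]]
        by (intro mult_mono) auto
    qed (use s in auto)
    have b: "\<bar>Re (cnj (ell (fst \<phi>')) * inner_H p (snd \<phi>) \<eta>)\<bar> \<le> (Cl * ST.nrm \<phi>') * (ST.nrm \<phi> * HH.nrm \<eta>)"
    proof (rule order_trans[OF abs_Re_le_cmod])
      have l: "cmod (ell (fst \<phi>')) \<le> Cl * ST.nrm \<phi>'"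
        using order_trans[OF Cl(2)[OF s(3)] mult_left_mono[OF n2 Cl(1)]] .
      have r: "cmod (inner_H p (snd \<phi>) \<eta>) \<le> ST.nrm \<phi> * HH.nrm \<eta>"
        using order_trans[OF HH.Cauchy_Schwarz[OF s(2) \<eta>] mult_right_mono[OF n1]] \<eta> by simp
      show "cmod (cnj (ell (fst \<phi>')) * inner_H p (snd \<phi>) \<eta>) \<le> (Cl * ST.nrm \<phi>') * (ST.nrm \<phi> * HH.nrm \<eta>)"
        unfolding norm_mult complex_mod_cnj using order_trans[OF norm_ge_zero l]
        by (intro mult_mono l r) auto
    qed
    have "\<bar>W \<phi> \<phi>'\<bar> \<le> \<bar>Re (inner_H p (snd \<phi>) (Psi K (fst \<phi>')))\<bar> +
        A * \<bar>Re (cnj (ell (fst \<phi>')) * inner_H p (snd \<phi>) \<eta>)\<bar>"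
    proof -
      have "\<bar>s + A * t\<bar> \<le> \<bar>s\<bar> + A * \<bar>t\<bar>" for s t
        using A abs_triangle_ineq[of s "A * t"] by (simp add: abs_mult)
      then show ?thesis unfolding W_def .
    qed
    also have "\<dots> \<le> ST.nrm \<phi> * (CP * ST.nrm \<phi>') + A * ((Cl * ST.nrm \<phi>') * (ST.nrm \<phi> * HH.nrm \<eta>))"
      using A by (intro add_mono a mult_left_mono[OF b]) auto
    also have "\<dots> = P * (ST.nrm \<phi> * ST.nrm \<phi>')" by (simp add: P_def algebra_simps)
    finally show ?thesis .
  qed
  have "\<exists>C>0. \<exists>\<omega>>0. \<forall>t\<ge>0. opnorm_on (state_space p) ST.nrm (T t) \<le> C * exp (- \<omega> * t)"
  proof (rule S.exponential_decay_of_Lyapunov[where B = B and M = "M + P" and c = "\<gamma> / 8"])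
    show "generator_on (state_space p) ST.nrm T (dom_calA p) (\<lambda>\<phi>. - (calA p \<phi> + op_B p \<phi>))"
      using G by (simp add: norm_state_eq)
    show "\<exists>y\<in>dom_calA p. ST.nrm (x - y) < \<epsilon>" if "x \<in> state_space p" "\<epsilon> > 0" for x \<epsilon>
      using that by (rule domain_dense)
    show "M + P > 0" "\<gamma> / 8 > 0" using M P \<gamma> by auto
    show "B (x + y) z = B x z + B y z"
      if "x \<in> state_space p" "y \<in> state_space p" "z \<in> state_space p" for x y z
      using split[OF that(1)] split[OF that(2)] split[OF that(3)] that \<eta>
      by (simp add: B_def W_def ST.ip_add_left HH.ip_add_left algebra_simps)
    show "B z (x + y) = B z x + B z y"
      if "x \<in> state_space p" "y \<in> state_space p" "z \<in> state_space p" for x y z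
      using split[OF that(1)] split[OF that(2)] split[OF that(3)] that \<eta>
      by (simp add: B_def W_def ST.ip_add_right HH.ip_add_right Psi_add ell_add algebra_simps)
    show "B (complex_of_real r *\<^sub>C x) y = r * B x y"
      if "x \<in> state_space p" "y \<in> state_space p" for r x y
      using split[OF that(1)] split[OF that(2)] that \<eta>
      by (simp add: B_def W_def ST.ip_scale_left HH.ip_scale_left fs algebra_simps)
    show "B y (complex_of_real r *\<^sub>C x) = r * B y x"
      if "x \<in> state_space p" "y \<in> state_space p" for r x y
      using split[OF that(1)] split[OF that(2)] that \<eta>
      by (simp add: B_def W_def ST.ip_scale_right HH.ip_scale_right Psi_scale ell_scale fs algebra_simps)
    show "\<bar>B x y\<bar> \<le> (M + P) * (ST.nrm x * ST.nrm y)" if "x \<in> state_space p" "y \<in> state_space p" for x y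
    proof -
      have "\<bar>B x y\<bar> \<le> M * \<bar>Re (inner_state p x y)\<bar> + \<bar>W x y\<bar>"
        unfolding B_def using M P abs_triangle_ineq[of "M * Re (inner_state p x y)" "W x y"]
        by (simp add: abs_mult)
      also have "\<dots> \<le> M * (ST.nrm x * ST.nrm y) + P * (ST.nrm x * ST.nrm y)"
        using M P that by (intro add_mono mult_left_mono ST.Re_ip_le W_bound) auto
      finally show ?thesis by (simp add: distrib_right)
    qed
    show "(ST.nrm x)\<^sup>2 \<le> B x x" if "x \<in> state_space p" for x
    proof -
      have "- (P * (ST.nrm x)\<^sup>2) \<le> W x x"
        using W_bound[OF that that] by (simp add: power2_eq_square abs_le_iff)
      moreover have "(1 + P) * (ST.nrm x)\<^sup>2 \<le> M * (ST.nrm x)\<^sup>2"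
        using M by (intro mult_right_mono) auto
      ultimately show ?thesis
        unfolding B_def ST.nrm_sq[OF that, symmetric] by (simp add: distrib_right)
    qed
    fix x assume x: "x \<in> dom_calA p"
    obtain y z where yz: "x = (y, z)" by (cases x)
    have xx: "(y, z) \<in> dom_calA p" using x yz by simp
    obtain f where yV: "y \<in> V_space p" and zV: "z \<in> V_space p" and f: "f \<in> H_space p"
      and Gyz: "- (calA p (y, z) + op_B p (y, z)) = (z, f)"
      and eq: "\<And>\<psi>. \<psi> \<in> V_space p \<Longrightarrow> inner_H p f \<psi> + inner_V p y \<psi> + op_D0 p z \<psi> + op_B0 p z \<psi> = 0"
      by (rule generator_weak_form[OF xx]) (rule that)
    have Gx: "- (calA p x + op_B p x) = (z, f)" unfolding yz by (rule Gyz)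
    obtain a b c where ya: "a \<in> L2 (len p)" "b \<in> L2 (len p)" "c \<in> L2 (len p)" "y = vV a b c"
      using yV unfolding V_iff by blast
    obtain az bz cz where za: "az \<in> L2 (len p)" "bz \<in> L2 (len p)" "cz \<in> L2 (len p)" "z = vV az bz cz"
      using zV unfolding V_iff by blast
    obtain f1 f2 ef where fa: "f1 \<in> L2 (len p)" "f2 \<in> L2 (len p)" "ef \<in> L2 (len p)" "f = vH f1 f2 ef"
      using f unfolding H_iff by blast
    have w: "weak_eq a b c az bz cz f" unfolding weak_eq_def using eq ya(4) za(4) by blast
    have zH: "z \<in> H_space p" using zV V_subset_H by blast
    have st: "(z, f) \<in> state_space p" "(y, z) \<in> state_space p"
      using yV zV zH f by (auto simp: state_space_def)
    have en: "Re (inner_state p (z, f) (y, z)) = - diss az bz cz"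
      using energy_dissipation[OF ya(1-3) za(1-3) f w] by (simp add: ya(4) za(4))
    have en': "Re (inner_state p (y, z) (z, f)) = - diss az bz cz"
      using en ST.ip_commute[OF st] by simp
    have mult: "Re (inner_H p f (Psi K y)) + Re (inner_H p z (Psi K z)) \<le>
        - (1/4) * energy_sum K a b c az bz cz + C1 * (cmod (ell y))\<^sup>2 + mult_const K * diss az bz cz"
      using multiplier_estimate[OF K ya(1-3) za(1-3) fa(1-3)] w ya za fa
      by (simp add: Psi_vV ell_vV C1_def)
    have tr: "Re (cnj (ell z) * inner_H p z \<eta> + cnj (ell y) * inner_H p f \<eta>) \<le>
        - (1/2) * (cmod (ell y))\<^sup>2 + \<delta> * (HH.nrm z)\<^sup>2 + C3 * diss az bz cz"
      using trace[OF ya(1-3) za(1-3) w] ya za by (simp add: ell_vV \<eta>_def)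
    define N where "N = (ST.nrm (y, z))\<^sup>2"
    define d where "d = diss az bz cz"
    have d: "d \<ge> 0" unfolding d_def by (rule diss_nonneg)
    have "(HH.nrm z)\<^sup>2 \<le> N"
      unfolding N_def using zH by (intro power_mono ST_ge[OF yV zH]) auto
    then have "\<delta> * (HH.nrm z)\<^sup>2 \<le> \<delta> * N" using \<delta> by (intro mult_left_mono) auto
    then have "A * Re (cnj (ell z) * inner_H p z \<eta> + cnj (ell y) * inner_H p f \<eta>) \<le>
        A * (- (1/2) * (cmod (ell y))\<^sup>2 + \<delta> * N + C3 * d)"
      using tr A unfolding d_def by (intro mult_left_mono) auto
    also have "\<dots> = - (C1 * (cmod (ell y))\<^sup>2) + \<gamma> / 8 * N + A * C3 * d"
    proof -
      have "A * \<delta> = \<gamma> / 8" using A by (simp add: \<delta>_def)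
      moreover have "A * (- (1/2) * X + \<delta> * N + C3 * d) = - ((A / 2) * X) + (A * \<delta>) * N + A * C3 * d" for X
        by (simp add: algebra_simps)
      ultimately show ?thesis by (simp add: A_def)
    qed
    finally have tr': "A * Re (cnj (ell z) * inner_H p z \<eta> + cnj (ell y) * inner_H p f \<eta>) \<le>
        - (C1 * (cmod (ell y))\<^sup>2) + \<gamma> / 8 * N + A * C3 * d" .
    have low': "\<gamma> * N \<le> energy_sum K a b c az bz cz"
      unfolding N_def ya(4) za(4) by (rule low[OF ya(1-3) za(1-3)])
    have "mult_const K * d \<le> \<bar>mult_const K\<bar> * d" using d by (intro mult_right_mono) auto
    moreover have "(\<bar>mult_const K\<bar> + A * C3) * d \<le> (2 * M) * d"
      using d M P by (intro mult_right_mono) (auto simp: M_def)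
    ultimately have dd: "mult_const K * d + A * C3 * d \<le> 2 * M * d" by (simp add: distrib_right)
    have WW: "W (z, f) (y, z) + W (y, z) (z, f) =
        (Re (inner_H p f (Psi K y)) + Re (inner_H p z (Psi K z))) +
        A * Re (cnj (ell z) * inner_H p z \<eta> + cnj (ell y) * inner_H p f \<eta>)"
      by (simp add: W_def distrib_left)
    have "B (z, f) (y, z) + B (y, z) (z, f) = - (2 * M * d) + (W (z, f) (y, z) + W (y, z) (z, f))"
      unfolding B_def en en' d_def by simp
    also have "\<dots> \<le> - (2 * M * d) + ((- (1/4) * energy_sum K a b c az bz cz + C1 * (cmod (ell y))\<^sup>2 +
        mult_const K * d) + (- (C1 * (cmod (ell y))\<^sup>2) + \<gamma> / 8 * N + A * C3 * d))"
      unfolding WW by (intro add_left_mono add_mono[OF mult[folded d_def] tr'])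
    also have "\<dots> \<le> - (\<gamma> / 8) * N"
    proof -
      have "- D + ((- (1/4) * E + X + k) + (- X + t / 8 + m)) \<le> - (t / 8)"
        if "k + m \<le> D" "t \<le> E" for D E X k t m :: real
        using that by linarith
      from this[OF dd low'] show ?thesis by simp
    qed
    finally show "B (- (calA p x + op_B p x)) x + B x (- (calA p x + op_B p x)) \<le> - (\<gamma> / 8) * (ST.nrm x)\<^sup>2"
      unfolding Gx unfolding yz N_def .
  qed
  then show ?thesis by (simp add: norm_state_eq)
qed

end

theorem mainTheorem2:
  fixes p :: beam and T :: "real \<Rightarrow> state \<Rightarrow> state"
  assumes "len p > 0" "h1 p > 0" "h2 p > 0" "h3 p > 0" "G2 p > 0"
    and "rho1 p > 0" "rho2 p \<ge> 0" "rho3 p > 0"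
    and "alpha1_1 p > 0" "alpha1_3 p > 0" "beta1 p > 0" "beta3 p > 0"
    and "s1 p > 0" "s3 p > 0" "k1 p > 0" "k2 p > 0"
    and "C0_semigroup_on (state_space p) (norm_state p) T"
    and "generator_on (state_space p) (norm_state p) T
           (dom_calA p) (\<lambda>\<phi>. - (calA p \<phi> + op_B p \<phi>))"
  shows "\<exists>C>0. \<exists>\<omega>>0. \<forall>t\<ge>0.
           opnorm_on (state_space p) (norm_state p) (T t) \<le> C * exp (- \<omega> * t)"
proof -
  interpret rao_nakra p
    by unfold_locales (fact assms)+
  show ?thesis
    using assms(17,18) by (rule exponential_stability)
qed

end
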